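(* Let $(X_i)_{i\ge1}$ be i.i.d. real random variables on $(\Omega,\mathcal F,\mathbb P)$, $S_0:=0$, $S_n:=X_1+\cdots+X_n$, with $(S_n)$ recurrent and $S_n/A_n\to X$ in distribution for some positive reals $A_n$, where $X$ is a stable random variable of index $\alpha=1$ with density $f_X$. Assume the Cramér condition $\limsup_{|t|\to\infty}|\mathbb E[e^{itX_1}]|<1$. Let $S_0'$ be a real random variable, independent of $(S_n)_{n\ge0}$, with an arbitrary fixed distribution, and set $S_n':=S_0'+S_n$. Fix $x\in\mathbb R$, let $\tilde\tau^x_\varepsilon:=\inf\{m\ge1:|S'_m-x|<\varepsilon\}$ and $\Omega^*_x:=\{S'_n\ne x\ \forall n\ge1\}$. Let $\Omega^*:=\{S_n\ne0\ \forall n\ge1\}$, $\gamma:=2f_X(0)\,\mathbb P(\Omega^* )$, and let $G:[0,\infty)\to[0,\infty)$ be the continuous function with $G(0)=0$, $G(n)=\sum_{k=1}^n\frac1{A_k}$ for integers $n\ge1$, and affine on each interval $[n,n+1]$, $n\ge0$. Then for every $t>0$, \[ \lim_{\varepsilon\to0}\mathbb P\left(\gamma\,\varepsilon\,G(\tilde\tau^x_\varepsilon)\le t\ \middle|\ \Omega^*_x\right)=\frac{t}{1+t}. \] *)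

theory Defs
  imports "HOL-Probability.Probability"
begin

definition stable1 :: "real measure \<Rightarrow> bool" where
  "stable1 \<mu> \<longleftrightarrow> real_distribution \<mu> \<and>
     (\<exists>c \<beta> m. c > 0 \<and> -1 \<le> \<beta> \<and> \<beta> \<le> 1 \<and>
        (\<forall>t. char \<mu> t = exp (- complex_of_real (c * \<bar>t\<bar>) *
                (1 + \<i> * complex_of_real (\<beta> * (2 / pi) * sgn t * ln \<bar>t\<bar>))
              + \<i> * complex_of_real (m * t))))"

definition rw_recurrent :: "'a measure \<Rightarrow> (nat \<Rightarrow> 'a \<Rightarrow> real) \<Rightarrow> bool" where
  "rw_recurrent M S \<longleftrightarrow> (\<forall>\<epsilon>>0. AE \<omega> in M. \<exists>\<^sub>\<infinity>n. \<bar>S n \<omega>\<bar> < \<epsilon>)"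

definition Gfun :: "(nat \<Rightarrow> real) \<Rightarrow> real \<Rightarrow> real" where
  "Gfun A r = (\<Sum>k=1..nat \<lfloor>r\<rfloor>. 1 / A k) + (r - of_int \<lfloor>r\<rfloor>) * (1 / A (nat \<lfloor>r\<rfloor> + 1))"

definition hit_time :: "(nat \<Rightarrow> 'a \<Rightarrow> real) \<Rightarrow> real \<Rightarrow> real \<Rightarrow> 'a \<Rightarrow> enat" where
  "hit_time S' x \<epsilon> \<omega> =
     (if \<exists>m\<ge>1. \<bar>S' m \<omega> - x\<bar> < \<epsilon> then enat (LEAST m. m \<ge> 1 \<and> \<bar>S' m \<omega> - x\<bar> < \<epsilon>) else \<infinity>)"

definition cprob :: "'a measure \<Rightarrow> 'a set \<Rightarrow> 'a set \<Rightarrow> real" where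
  "cprob M E F = measure M (E \<inter> F) / measure M F"

end

theory Submission
  imports Defs "HOL-Real_Asymp.Real_Asymp"
begin

text \<open>
  Comparing \<open>S\<^sub>2\<^sub>n\<close> with two independent copies of \<open>S\<^sub>n\<close> shows \<open>A\<^sub>2\<^sub>n / A\<^sub>n \<rightarrow> 2\<close>, so the limit law is
  strictly stable, hence a shifted symmetric Cauchy law with \<open>f(0) > 0\<close>, and
  \<open>G(2n) / G(n) \<rightarrow> 1\<close>. The Cramer condition gives the local limit theorem
  \<open>P(|S'\<^sub>k - y| < \<eta>) = 2 \<eta> f(0) / A\<^sub>k (1 + o(1)) + O(\<rho>\<^sup>k)\<close> uniformly in small \<open>\<eta>\<close> and \<open>y\<close>.

  Decompose by the last visit to the interval of radius \<open>r = b \<epsilon>\<close> up to time \<open>n\<close>, for a walk whose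
  start is perturbed uniformly on \<open>(-a \<epsilon>, a \<epsilon>)\<close>. Since \<open>G(2n) - G(n) = o(G(n))\<close>, the time left after the
  last visit may be replaced by \<open>n\<close>, and the decomposition becomes
  \<open>1 = p + \<alpha> q + 2 r f(0) G(n) Q + o(1)\<close>: here \<open>p\<close> is the probability of no visit up to \<open>n\<close>,
  \<open>\<alpha>\<close> the expected number of exact hits of the centre, and \<open>q\<close>, \<open>Q\<close> are the probabilities of no
  visit from a uniform start on \<open>(-a \<epsilon>, a \<epsilon>)\<close> and on \<open>(-r, r)\<close>. Taking the start at the centre with
  \<open>a = b\<close>, then at the centre with \<open>a < b\<close>, then at \<open>S0'\<close>, successively determines \<open>Q\<close>, \<open>q\<close> and
  \<open>p\<close>; letting \<open>b \<rightarrow> 1\<close> removes the perturbation.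
\<close>

subsection \<open>Characteristic functions\<close>

text \<open>The local limit theorem controls short intervals only up to an error C \<rho>^k that
  does not shrink with the interval, because the law at time k may have atoms. Bounded times are
  therefore treated separately, through the atoms at the centre, and only the tail of the geometric
  error is spent on large times. The perturbation of the start is needed because the chance of no
  further visit depends on the exact place of the last one: the smeared walk visits with nearly
  constant density, so the place becomes uniform and the unknown functions reduce to the numbers q
  and Q. Its radius is proportional to \<epsilon> so that the factor b / a multiplying the geometric
  error does not depend on \<epsilon>. The probability v of never returning enters \<gamma> because
  exact returns give v (1 + \<alpha>) = 1 for the start at the centre: both coefficients of Q for a
  = b are then multiples of 1 / v, and Q tends to v / (1 + b t). The Cramer condition also excludes
  a purely atomic step law, which makes v and the probability of the conditioning event
  positive.\<close>

lemma char_uniform_convergence_on_compacts: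
  fixes \<nu> :: "nat \<Rightarrow> real measure" and \<mu> :: "real measure"
  assumes nu: "\<And>n. real_distribution (\<nu> n)" and mu: "real_distribution \<mu>"
    and conv: "weak_conv_m \<nu> \<mu>" and e: "e > 0"
  shows "\<forall>\<^sub>F n in sequentially. \<forall>s. \<bar>s\<bar> \<le> K \<longrightarrow> cmod (char (\<nu> n) s - char \<mu> s) \<le> e"
proof -
  from Skorohod[OF nu mu conv] obtain \<Omega> Ys Y where
    O: "prob_space (\<Omega> :: real measure)" and
    Ys [measurable]: "\<And>n. Ys n \<in> borel_measurable \<Omega>" and
    dYs: "\<And>n. distr \<Omega> borel (Ys n) = \<nu> n" and
    Y [measurable]: "Y \<in> borel_measurable \<Omega>" and
    dY: "distr \<Omega> borel Y = \<mu>" and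
    lim: "\<And>x. x \<in> space \<Omega> \<Longrightarrow> (\<lambda>n. Ys n x) \<longlonglongrightarrow> Y x" by force
  interpret O: prob_space \<Omega> by (rule O)
  \<comment> \<open>In the Skorohod coupling \<open>d n\<close> bounds the difference of the
    characteristic functions for all \<open>\<bar>s\<bar> \<le> K\<close> at once, because the
    integrand no longer involves \<open>s\<close>. The truncation at 2 permits dominated
    convergence.\<close>
  define d where "d n = (\<integral>x. min 2 (\<bar>K\<bar> * \<bar>Ys n x - Y x\<bar>) \<partial>\<Omega>)" for n
  have "d \<longlonglongrightarrow> (\<integral>x. 0 \<partial>\<Omega>)"
    unfolding d_def
  proof (rule integral_dominated_convergence[where w = "\<lambda>_. 2"])
    show "AE x in \<Omega>. (\<lambda>n. min 2 (\<bar>K\<bar> * \<bar>Ys n x - Y x\<bar>)) \<longlonglongrightarrow> 0"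
    proof (rule AE_I2)
      fix x assume "x \<in> space \<Omega>"
      from lim[OF this] have "(\<lambda>n. min 2 (\<bar>K\<bar> * \<bar>Ys n x - Y x\<bar>)) \<longlonglongrightarrow> min 2 (\<bar>K\<bar> * \<bar>Y x - Y x\<bar>)"
        by (intro tendsto_intros)
      then show "(\<lambda>n. min 2 (\<bar>K\<bar> * \<bar>Ys n x - Y x\<bar>)) \<longlonglongrightarrow> 0" by simp
    qed
  qed auto
  then have "\<forall>\<^sub>F n in sequentially. d n < e"
    using e by (auto intro: order_tendstoD)
  then show ?thesis
  proof eventually_elim
    case (elim n)
    show ?case
    proof safe
      fix s :: real assume s: "\<bar>s\<bar> \<le> K"
      have i: "integrable \<Omega> (\<lambda>x. iexp (s * Ys n x))" "integrable \<Omega> (\<lambda>x. iexp (s * Y x))"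
        by (auto intro!: O.integrable_const_bound[where B = 1])
      have "char (\<nu> n) s - char \<mu> s = (\<integral>x. iexp (s * Ys n x) - iexp (s * Y x) \<partial>\<Omega>)"
        unfolding char_def dYs[symmetric] dY[symmetric]
        using i by (simp add: integral_distr)
      also have "cmod \<dots> \<le> (\<integral>x. cmod (iexp (s * Ys n x) - iexp (s * Y x)) \<partial>\<Omega>)"
        by (rule integral_norm_bound)
      also have "\<dots> \<le> d n"
        unfolding d_def
      proof (rule integral_mono)
        show "integrable \<Omega> (\<lambda>x. cmod (iexp (s * Ys n x) - iexp (s * Y x)))"
          using i by auto
        show "integrable \<Omega> (\<lambda>x. min 2 (\<bar>K\<bar> * \<bar>Ys n x - Y x\<bar>))"
          by (auto intro!: O.integrable_const_bound[where B = 2])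
        fix x
        let ?a = "s * Ys n x" and ?b = "s * Y x"
        have "iexp ?a - iexp ?b = iexp ?b * (iexp (?a - ?b) - 1)"
          by (simp add: algebra_simps flip: exp_add)
        then have "cmod (iexp ?a - iexp ?b) = cmod (iexp (?a - ?b) - 1)"
          by (simp add: norm_mult del: of_real_diff of_real_mult)
        also have "\<dots> \<le> \<bar>?a - ?b\<bar>"
          using iexp_approx1[of "?a - ?b" 0] by simp
        also have "\<dots> = \<bar>s\<bar> * \<bar>Ys n x - Y x\<bar>"
          by (simp add: abs_mult flip: right_diff_distrib)
        also have "\<dots> \<le> \<bar>K\<bar> * \<bar>Ys n x - Y x\<bar>"
          using s by (intro mult_right_mono) auto
        finally have 1: "cmod (iexp ?a - iexp ?b) \<le> \<bar>K\<bar> * \<bar>Ys n x - Y x\<bar>" .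
        have "cmod (iexp ?a - iexp ?b) \<le> cmod (iexp ?a) + cmod (iexp ?b)"
          by (rule norm_triangle_ineq4)
        also have "\<dots> = 2" by (simp del: of_real_mult)
        finally show "cmod (iexp ?a - iexp ?b) \<le> min 2 (\<bar>K\<bar> * \<bar>Ys n x - Y x\<bar>)"
          using 1 by simp
      qed
      finally show "cmod (char (\<nu> n) s - char \<mu> s) \<le> e" using elim by simp
    qed
  qed
qed

text \<open>Symmetrisation: the squared modulus is the characteristic function of the difference of
  two independent copies. It is real, so inequalities between cosines can be integrated.\<close>

lemma (in real_distribution) cmod_char_square:
  "(cmod (char M t))\<^sup>2 = (\<integral>x. \<integral>y. cos (t * (x - y)) \<partial>M \<partial>M)"
proof -
  have i: "integrable M (\<lambda>x. cos (t * x))" "integrable M (\<lambda>x. sin (t * x))"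
    by (auto intro!: integrable_const_bound[where B = 1])
  have ii: "integrable M (\<lambda>x. iexp (t * x))"
    by (auto intro!: integrable_const_bound[where B = 1])
  have R: "Re (char M t) = (\<integral>x. cos (t * x) \<partial>M)"
    unfolding char_def using ii by (simp add: Re_exp flip: integral_Re)
  have I: "Im (char M t) = (\<integral>x. sin (t * x) \<partial>M)"
    unfolding char_def using ii by (simp add: Im_exp flip: integral_Im)
  have "(\<integral>y. cos (t * (x - y)) \<partial>M) = cos (t * x) * Re (char M t) + sin (t * x) * Im (char M t)" for x
    using i by (simp add: right_diff_distrib cos_diff R I)
  then have "(\<integral>x. \<integral>y. cos (t * (x - y)) \<partial>M \<partial>M) = (Re (char M t))\<^sup>2 + (Im (char M t))\<^sup>2"
    using i by (simp add: R I power2_eq_square)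
  then show ?thesis by (simp add: cmod_power2)
qed

text \<open>The pointwise inequality 1 - cos 2z \<le> 4 (1 - cos z), which amounts to (1 - cos z)^2
  \<ge> 0, integrated against the symmetrised law.\<close>

lemma (in real_distribution) char_doubling:
  "1 - (cmod (char M (2 * t)))\<^sup>2 \<le> 4 * (1 - (cmod (char M t))\<^sup>2)"
proof -
  have b: "\<bar>\<integral>y. cos (s * (x - y)) \<partial>M\<bar> \<le> 1" for s x
    by (rule order_trans[OF integral_abs_bound]) (auto intro!: integral_le_const integrable_const_bound[where B=1])
  have i: "integrable M (\<lambda>x. \<integral>y. cos (s * (x - y)) \<partial>M)" for s
    using b by (auto intro!: integrable_const_bound[where B = 1])
  have j: "integrable M (\<lambda>y. cos (s * (x - y)))" for s x
    by (auto intro!: integrable_const_bound[where B = 1])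
  have "(\<integral>x. \<integral>y. 4 * cos (t * (x - y)) \<partial>M \<partial>M) \<le> (\<integral>x. \<integral>y. 3 + cos (2 * t * (x - y)) \<partial>M \<partial>M)"
  proof (intro integral_mono)
    show "integrable M (\<lambda>x. \<integral>y. 4 * cos (t * (x - y)) \<partial>M)" using i by simp
    show "integrable M (\<lambda>x. \<integral>y. 3 + cos (2 * t * (x - y)) \<partial>M)" 
      using i[of "2 * t"] j by simp
    fix x y
    have "0 \<le> (1 - cos (t * (x - y)))\<^sup>2" by simp
    moreover have "cos (2 * t * (x - y)) = 2 * (cos (t * (x - y)))\<^sup>2 - 1"
      using cos_double_cos[of "t * (x - y)"] by (simp add: mult.assoc)
    ultimately show "4 * cos (t * (x - y)) \<le> 3 + cos (2 * t * (x - y))"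
      by (simp add: power2_eq_square algebra_simps)
  qed (use j in auto)
  then show ?thesis
    using i j by (simp add: cmod_char_square prob_space del: space_eq_univ)
qed

text \<open>The Cramer condition bounds the modulus only far out. A fixed number \<open>j\<close> of
  doublings carries every \<open>t\<close> with \<open>\<bar>t\<bar> \<ge> \<eta>\<close> there, and
  \<open>char_doubling\<close> brings the gap below 1 back at the price of a factor 4 per
  doubling.\<close>

lemma (in real_distribution) char_bounded_away_from_1:
  assumes cramer: "Limsup at_infinity (\<lambda>s::real. ereal (norm (char M s))) < 1" and "\<eta> > 0"
  obtains \<rho> where "0 < \<rho>" "\<rho> < 1" "\<And>t. \<bar>t\<bar> \<ge> \<eta> \<Longrightarrow> cmod (char M t) \<le> \<rho>"
proof -
  from cramer obtain y where y: "Limsup at_infinity (\<lambda>s::real. ereal (norm (char M s))) < y" "y < 1"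
    using dense by blast
  from Limsup_lessD[OF y(1)] obtain T where T: "\<And>s. \<bar>s\<bar> \<ge> T \<Longrightarrow> ereal (cmod (char M s)) < y"
    by (auto simp: eventually_at_infinity)
  obtain r where r: "y = ereal r"
    using T[OF abs_ge_self] y(2) by (cases y) auto
  with y T have r1: "r < 1" and T: "\<And>s. \<bar>s\<bar> \<ge> T \<Longrightarrow> cmod (char M s) < r" by (auto simp: one_ereal_def)
  have r0: "r > 0" using T[OF abs_ge_self] norm_ge_zero by (rule le_less_trans[rotated])
  have it: "1 - (cmod (char M (2 ^ j * t)))\<^sup>2 \<le> 4 ^ j * (1 - (cmod (char M t))\<^sup>2)" for j t
  proof (induction j)
    case (Suc j)
    have "1 - (cmod (char M (2 ^ Suc j * t)))\<^sup>2 \<le> 4 * (1 - (cmod (char M (2 ^ j * t)))\<^sup>2)"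
      using char_doubling[of "2 ^ j * t"] by (simp add: mult.assoc)
    with Suc show ?case by simp
  qed simp
  obtain j where j: "T / \<eta> < 2 ^ j" using real_arch_pow[of 2 "T / \<eta>"] by auto
  define \<rho> where "\<rho> = sqrt (1 - (1 - r\<^sup>2) / 4 ^ j)"
  have r2: "0 < r\<^sup>2" "r\<^sup>2 < 1" using r0 r1 by (auto simp: power_less_one_iff)
  have "(1 - r\<^sup>2) / 4 ^ j \<le> (1 - r\<^sup>2) / 1" using r2 by (intro divide_left_mono) auto
  also have "\<dots> < 1" using r2 by simp
  finally have q: "0 < 1 - (1 - r\<^sup>2) / 4 ^ j" by simp
  have q': "1 - (1 - r\<^sup>2) / 4 ^ j < 1" using r2 by simp
  show ?thesis
  proof
    show "0 < \<rho>" "\<rho> < 1" using q q' by (auto simp: \<rho>_def)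
    fix t assume t: "\<bar>t\<bar> \<ge> \<eta>"
    have "T \<le> 2 ^ j * \<eta>" using j \<open>\<eta> > 0\<close> by (simp add: field_simps)
    also have "\<dots> \<le> \<bar>2 ^ j * t\<bar>" using t by (simp add: abs_mult)
    finally have "cmod (char M (2 ^ j * t)) < r" by (rule T)
    then have "(cmod (char M (2 ^ j * t)))\<^sup>2 \<le> r\<^sup>2" by (intro power_mono) auto
    with it[of j t] have "1 - r\<^sup>2 \<le> 4 ^ j * (1 - (cmod (char M t))\<^sup>2)" by simp
    then have "(cmod (char M t))\<^sup>2 \<le> 1 - (1 - r\<^sup>2) / 4 ^ j" by (simp add: field_simps)
    then show "cmod (char M t) \<le> \<rho>" unfolding \<rho>_def by (rule real_le_rsqrt)
  qed
qed

subsection \<open>The norming sequence\<close>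

text \<open>\<open>\<Phi>\<close> is the limiting characteristic function. Only its modulus is
  prescribed: skewness and drift of a stable law of index 1 are pure phases, and skewness is
  excluded later by means of \<open>Phi_double\<close>.\<close>

locale cauchy_domain = real_distribution D for D :: "real measure" +
  fixes A :: "nat \<Rightarrow> real" and \<Phi> :: "real \<Rightarrow> complex" and c :: real
  assumes A_pos: "A n > 0"
    and c_pos: "c > 0"
    and char_lim: "e > 0 \<Longrightarrow>
      \<forall>\<^sub>F n in sequentially. \<forall>s. \<bar>s\<bar> \<le> K \<longrightarrow> cmod (char D (s / A n) ^ n - \<Phi> s) \<le> e"
    and Phi_cont: "isCont \<Phi> s"
    and Phi_norm: "cmod (\<Phi> s) = exp (- c * \<bar>s\<bar>)"
    and cramer: "Limsup at_infinity (\<lambda>s::real. ereal (norm (char D s))) < 1"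
begin

lemma modulus_lim:
  assumes "e > 0"
  shows "\<forall>\<^sub>F n in sequentially. \<forall>s. \<bar>s\<bar> \<le> K \<longrightarrow> \<bar>cmod (char D (s / A n)) ^ n - exp (- c * \<bar>s\<bar>)\<bar> \<le> e"
  using char_lim[OF assms, of K]
proof eventually_elim
  case (elim n)
  show ?case
  proof safe
    fix s assume "\<bar>s\<bar> \<le> K"
    then have "cmod (char D (s / A n) ^ n - \<Phi> s) \<le> e" using elim by auto
    then show "\<bar>cmod (char D (s / A n)) ^ n - exp (- c * \<bar>s\<bar>)\<bar> \<le> e"
      using norm_triangle_ineq3[of "char D (s / A n) ^ n" "\<Phi> s"] by (simp add: norm_power Phi_norm)
  qed
qed

lemma modulus_tendsto:
  assumes s: "\<And>n. \<bar>s n\<bar> \<le> K" and m: "filterlim m at_top sequentially"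
  shows "(\<lambda>n. cmod (char D (s n / A (m n))) ^ m n - exp (- c * \<bar>s n\<bar>)) \<longlonglongrightarrow> 0"
proof (rule LIMSEQ_I)
  fix e :: real assume e: "e > 0"
  have "\<forall>\<^sub>F n in sequentially. \<bar>cmod (char D (s n / A (m n))) ^ m n - exp (- c * \<bar>s n\<bar>)\<bar> \<le> e / 2"
    using filterlim_iff[THEN iffD1, OF m, rule_format, OF modulus_lim[of "e/2" K]] e s
    by (auto elim: eventually_mono)
  then have "\<forall>\<^sub>F n in sequentially. \<bar>cmod (char D (s n / A (m n))) ^ m n - exp (- c * \<bar>s n\<bar>)\<bar> < e"
    by eventually_elim (use e in linarith)
  then show "\<exists>N. \<forall>n\<ge>N. norm (cmod (char D (s n / A (m n))) ^ m n - exp (- c * \<bar>s n\<bar>) - 0) < e"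
    by (simp add: eventually_sequentially)
qed

text \<open>If \<open>A n < K\<close> for arbitrarily large \<open>n\<close>, then
  \<open>1 / A n\<close> stays away from 0 along these indices and the n-th power of the modulus is
  at most \<open>\<rho> ^ n\<close>, against its limit \<open>exp (- c)\<close>.\<close>

lemma A_at_top: "filterlim A at_top sequentially"
proof (rule filterlim_at_top_gt[THEN iffD2, rule_format, where c = 0])
  fix K :: real assume K: "K > 0"
  obtain \<rho> where \<rho>: "0 < \<rho>" "\<rho> < 1" "\<And>t. \<bar>t\<bar> \<ge> 1 / K \<Longrightarrow> cmod (char D t) \<le> \<rho>"
    using char_bounded_away_from_1[OF cramer, of "1 / K"] K by auto
  have "(\<lambda>n. \<rho> ^ n) \<longlonglongrightarrow> 0" using \<rho> by (intro LIMSEQ_realpow_zero) auto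
  then have 1: "\<forall>\<^sub>F n in sequentially. \<rho> ^ n < exp (- c) / 2"
    by (rule order_tendstoD) auto
  have 2: "\<forall>\<^sub>F n in sequentially. \<bar>cmod (char D (1 / A n)) ^ n - exp (- c)\<bar> \<le> exp (- c) / 2"
    using modulus_lim[of "exp (- c) / 2" 1] by (auto elim!: eventually_mono dest: spec[of _ 1])
  from 1 2 show "\<forall>\<^sub>F n in sequentially. K \<le> A n"
  proof eventually_elim
    case (elim n)
    show ?case
    proof (rule ccontr)
      assume "\<not> K \<le> A n"
      then have "1 / K \<le> \<bar>1 / A n\<bar>" using A_pos[of n] K by (simp add: field_simps)
      then have "cmod (char D (1 / A n)) ^ n \<le> \<rho> ^ n" by (intro power_mono \<rho>) auto
      with elim show False by linarith
    qed
  qed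
qed

text \<open>At a common small argument T the modulus v satisfies n ln v = -c T A(n) + o(1) and m ln
  v = -c T A(m) + o(1). Eliminating ln v makes A(m) / A(n) behave like m / n.\<close>

lemma A_ratio:
  assumes m: "filterlim m at_top sequentially" and \<kappa>: "\<kappa> > 0"
    and lim: "(\<lambda>n. real (m n) / real n) \<longlonglongrightarrow> \<kappa>"
  shows "(\<lambda>n. A (m n) / A n) \<longlonglongrightarrow> \<kappa>"
proof -
  \<comment> \<open>The minimum keeps both rescaled arguments \<open>T n * A n\<close> and
    \<open>T n * A (m n)\<close> in (0, 1], where the convergence is uniform, and makes at least one
    of them equal to 1.\<close>
  define T where "T n = min (1 / A n) (1 / A (m n))" for n
  define s where "s n = T n * A n" for n
  define s' where "s' n = T n * A (m n)" for n
  define v where "v n = cmod (char D (T n))" for n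
  have T: "T n > 0" for n using A_pos[of n] A_pos[of "m n"] by (simp add: T_def)
  have s: "0 < s n" "s n \<le> 1" "0 < s' n" "s' n \<le> 1" "s n = 1 \<or> s' n = 1" for n
    using A_pos[of n] A_pos[of "m n"] T[of n] by (auto simp: s_def s'_def T_def min_def field_simps)
  have T1: "T n = s n / A n" and T2: "T n = s' n / A (m n)" for n
    using A_pos[of n] A_pos[of "m n"] by (auto simp: s_def s'_def)
  have key: "(\<lambda>n. real (k n) * ln (v n) + c * u n) \<longlonglongrightarrow> 0 \<and> (\<forall>\<^sub>F n in sequentially. v n > 0)"
    if k: "filterlim k at_top sequentially" and u: "\<And>n. 0 < u n \<and> u n \<le> 1" and Tk: "\<And>n. T n = u n / A (k n)" for k u
  proof -
    have "(\<lambda>n. v n ^ k n - exp (- c * u n)) \<longlonglongrightarrow> 0"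
      using modulus_tendsto[of u 1 k] k u by (simp add: v_def Tk abs_of_pos)
    \<comment> \<open>Multiplying by this bounded factor normalises the limit to 1, so that
      logarithms can be taken although \<open>u n\<close> need not converge.\<close>
    moreover have "(\<lambda>n. exp (c * u n)) \<in> O(\<lambda>_. 1)"
      using u c_pos by (intro bigoI[where c = "exp c"]) auto
    ultimately have "(\<lambda>n. (v n ^ k n - exp (- c * u n)) * exp (c * u n)) \<in> o(\<lambda>_. 1 * 1)"
      by (intro landau_o.small_big_mult) (auto intro: smalloI_tendsto)
    then have "(\<lambda>n. (v n ^ k n - exp (- c * u n)) * exp (c * u n)) \<longlonglongrightarrow> 0"
      by (auto dest: smalloD_tendsto)
    then have "(\<lambda>n. v n ^ k n * exp (c * u n) - 1) \<longlonglongrightarrow> 0"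
      by (simp add: algebra_simps flip: exp_add)
    then have l: "(\<lambda>n. v n ^ k n * exp (c * u n)) \<longlonglongrightarrow> 1"
      by (simp add: LIM_zero_iff)
    have "\<forall>\<^sub>F n in sequentially. v n ^ k n * exp (c * u n) > 0 \<and> k n > 0"
      using order_tendstoD(1)[OF l, of 0] filterlim_at_top[THEN iffD1, OF k, rule_format, of 1]
      by (auto elim: eventually_elim2)
    then have pos: "\<forall>\<^sub>F n in sequentially. v n > 0"
    proof eventually_elim
      case (elim n)
      then have "v n \<noteq> 0" by (auto simp: power_0_left)
      then show ?case by (simp add: v_def)
    qed
    have "(\<lambda>n. ln (v n ^ k n * exp (c * u n))) \<longlonglongrightarrow> ln 1"
      by (intro tendsto_ln l) auto
    moreover have "\<forall>\<^sub>F n in sequentially. ln (v n ^ k n * exp (c * u n)) = real (k n) * ln (v n) + c * u n"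
      using pos by eventually_elim (simp add: ln_mult ln_realpow)
    ultimately show ?thesis using pos by (auto dest: Lim_transform_eventually)
  qed
  have a: "(\<lambda>n. real n * ln (v n) + c * s n) \<longlonglongrightarrow> 0"
    using key[of "\<lambda>n. n" s] s T1 by (auto simp: filterlim_ident)
  have b: "(\<lambda>n. real (m n) * ln (v n) + c * s' n) \<longlonglongrightarrow> 0"
    using key[of m s'] s T2 m by auto
  have "(\<lambda>n. real (m n) / real n * (real n * ln (v n) + c * s n)) \<longlonglongrightarrow> \<kappa> * 0"
    by (intro tendsto_mult lim a)
  moreover have "(\<lambda>n. c * s n * (real (m n) / real n - \<kappa>)) \<longlonglongrightarrow> 0"
  proof (rule Lim_null_comparison)
    show "\<forall>\<^sub>F n in sequentially. norm (c * s n * (real (m n) / real n - \<kappa>)) \<le> c * \<bar>real (m n) / real n - \<kappa>\<bar>"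
    proof (intro always_eventually allI)
      fix n
      have "c * s n * \<bar>real (m n) / real n - \<kappa>\<bar> \<le> c * 1 * \<bar>real (m n) / real n - \<kappa>\<bar>"
        using s[of n] c_pos by (intro mult_right_mono mult_left_mono) auto
      then show "norm (c * s n * (real (m n) / real n - \<kappa>)) \<le> c * \<bar>real (m n) / real n - \<kappa>\<bar>"
        using s[of n] c_pos by (simp add: abs_mult)
    qed
    have "(\<lambda>n. c * \<bar>real (m n) / real n - \<kappa>\<bar>) \<longlonglongrightarrow> c * \<bar>\<kappa> - \<kappa>\<bar>"
      by (intro tendsto_intros lim)
    then show "(\<lambda>n. c * \<bar>real (m n) / real n - \<kappa>\<bar>) \<longlonglongrightarrow> 0" by simp
  qed
  \<comment> \<open>In this combination the terms with \<open>ln (v n)\<close> cancel, leaving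
    \<open>c * (s' n - \<kappa> * s n)\<close>.\<close>
  ultimately have "(\<lambda>n. real (m n) * ln (v n) + c * s' n - (real (m n) / real n * (real n * ln (v n) + c * s n)
      - c * s n * (real (m n) / real n - \<kappa>))) \<longlonglongrightarrow> 0 - (\<kappa> * 0 - 0)"
    by (intro tendsto_diff b) auto
  moreover have "\<forall>\<^sub>F n in sequentially. real (m n) * ln (v n) + c * s' n - (real (m n) / real n * (real n * ln (v n) + c * s n)
      - c * s n * (real (m n) / real n - \<kappa>)) = c * (s' n - \<kappa> * s n)"
    using eventually_gt_at_top[of 0] by eventually_elim (simp add: field_simps)
  ultimately have "(\<lambda>n. c * (s' n - \<kappa> * s n)) \<longlonglongrightarrow> 0"
    by (auto dest: Lim_transform_eventually)
  then have "(\<lambda>n. c * (s' n - \<kappa> * s n) * (1 / c)) \<longlonglongrightarrow> 0 * (1 / c)"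
    by (intro tendsto_mult_right)
  then have d: "(\<lambda>n. s' n - \<kappa> * s n) \<longlonglongrightarrow> 0" using c_pos by simp
  have "(\<lambda>n. A (m n) / A n - \<kappa>) \<longlonglongrightarrow> 0"
  proof (rule Lim_null_comparison)
    have "\<forall>\<^sub>F n in sequentially. \<bar>s' n - \<kappa> * s n\<bar> < 1 / 2"
      using order_tendstoD(2)[OF tendsto_rabs_zero[OF d], of "1/2"] by simp
    then show "\<forall>\<^sub>F n in sequentially. norm (A (m n) / A n - \<kappa>) \<le> \<bar>s' n - \<kappa> * s n\<bar> * max 1 (2 * \<kappa>)"
    proof eventually_elim
      case (elim n)
      have "A (m n) / A n - \<kappa> = (s' n - \<kappa> * s n) / s n"
        using T[of n] A_pos[of n] by (simp add: s_def s'_def field_simps)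
      \<comment> \<open>Either \<open>s n\<close> is 1, or \<open>s' n\<close> is 1 and the
        difference being below 1/2 forces \<open>\<kappa> * s n\<close> above 1/2.\<close>
      moreover have "1 / s n \<le> max 1 (2 * \<kappa>)"
      proof (cases "s n = 1")
        case False
        with s(5)[of n] have "s' n = 1" by simp
        with elim have "1 / 2 < \<kappa> * s n" unfolding abs_less_iff by simp
        with s(1)[of n] have "1 / s n \<le> 2 * \<kappa>" by (simp add: field_simps)
        then show ?thesis by simp
      qed simp
      then have "\<bar>s' n - \<kappa> * s n\<bar> * (1 / s n) \<le> \<bar>s' n - \<kappa> * s n\<bar> * max 1 (2 * \<kappa>)"
        by (intro mult_left_mono) auto
      ultimately show ?case using s(1)[of n] by simp
    qed
    have "(\<lambda>n. \<bar>s' n - \<kappa> * s n\<bar> * max 1 (2 * \<kappa>)) \<longlonglongrightarrow> \<bar>0\<bar> * max 1 (2 * \<kappa>)"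
      by (intro tendsto_intros d)
    then show "(\<lambda>n. \<bar>s' n - \<kappa> * s n\<bar> * max 1 (2 * \<kappa>)) \<longlonglongrightarrow> 0" by simp
  qed
  then show ?thesis by (simp add: LIM_zero_iff)
qed

text \<open>\<open>char D (t / A n) ^ (2 * n)\<close> has two limits: the square of the limit along
  \<open>n\<close>, and, because t / A(n) = t R(n) / A(2n) with R(n) tending to 2, the value of
  \<open>\<Phi>\<close> at \<open>2 * t\<close>. Uniformity on compacts absorbs the moving
  argument.\<close>

lemma Phi_double: "\<Phi> (2 * t) = \<Phi> t ^ 2"
proof -
  define R where "R n = A (2 * n) / A n" for n
  have R: "R \<longlonglongrightarrow> 2"
    unfolding R_def
  proof (rule A_ratio)
    show "filterlim (\<lambda>n::nat. 2 * n) at_top sequentially" by real_asymp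
    show "(\<lambda>n. real (2 * n) / real n) \<longlonglongrightarrow> 2" by real_asymp
  qed simp
  have "(\<lambda>n. char D (t / A n) ^ n - \<Phi> t) \<longlonglongrightarrow> 0"
  proof (rule LIMSEQ_I)
    fix e :: real assume "e > 0"
    then show "\<exists>N. \<forall>n\<ge>N. norm (char D (t / A n) ^ n - \<Phi> t - 0) < e"
      using char_lim[of "e/2" "\<bar>t\<bar>"] by (force simp: eventually_sequentially intro: le_less_trans[of _ "e/2"])
  qed
  then have "(\<lambda>n. char D (t / A n) ^ n) \<longlonglongrightarrow> \<Phi> t" by (simp add: LIM_zero_iff)
  then have 1: "(\<lambda>n. (char D (t / A n) ^ n) ^ 2) \<longlonglongrightarrow> \<Phi> t ^ 2" by (intro tendsto_intros)
  have "(\<lambda>n. char D (t * R n / A (2 * n)) ^ (2 * n) - \<Phi> (t * R n)) \<longlonglongrightarrow> 0"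
  proof (rule LIMSEQ_I)
    fix e :: real assume e: "e > 0"
    have b: "\<forall>\<^sub>F n in sequentially. \<bar>t * R n\<bar> < 2 * \<bar>t\<bar> + 1"
    proof (rule order_tendstoD)
      show "(\<lambda>n. \<bar>t * R n\<bar>) \<longlonglongrightarrow> \<bar>t * 2\<bar>" by (intro tendsto_intros R)
    qed (simp add: abs_mult)
    have "filterlim (\<lambda>n::nat. 2 * n) at_top sequentially" by real_asymp
    from filterlim_iff[THEN iffD1, OF this, rule_format, OF char_lim[of "e/2" "2 * \<bar>t\<bar> + 1"]] e
    have "\<forall>\<^sub>F n in sequentially. \<forall>s. \<bar>s\<bar> \<le> 2 * \<bar>t\<bar> + 1 \<longrightarrow> cmod (char D (s / A (2 * n)) ^ (2 * n) - \<Phi> s) \<le> e / 2"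
      by simp
    with b have "\<forall>\<^sub>F n in sequentially. cmod (char D (t * R n / A (2 * n)) ^ (2 * n) - \<Phi> (t * R n)) < e"
    proof eventually_elim
      case (elim n)
      then have "cmod (char D (t * R n / A (2 * n)) ^ (2 * n) - \<Phi> (t * R n)) \<le> e / 2" by auto
      with e show ?case by simp
    qed
    then show "\<exists>N. \<forall>n\<ge>N. norm (char D (t * R n / A (2 * n)) ^ (2 * n) - \<Phi> (t * R n) - 0) < e"
      by (simp add: eventually_sequentially)
  qed
  moreover have "t * R n / A (2 * n) = t / A n" for n
    using A_pos[of "2 * n"] by (simp add: R_def)
  ultimately have "(\<lambda>n. (char D (t / A n) ^ n) ^ 2 - \<Phi> (t * R n)) \<longlonglongrightarrow> 0"
    by (simp add: power_mult[symmetric] mult.commute)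
  from tendsto_diff[OF 1 this] have "(\<lambda>n. \<Phi> (t * R n)) \<longlonglongrightarrow> \<Phi> t ^ 2" by simp
  moreover have "(\<lambda>n. \<Phi> (t * R n)) \<longlonglongrightarrow> \<Phi> (2 * t)"
  proof (rule isCont_tendsto_compose[OF Phi_cont])
    have "(\<lambda>n. t * R n) \<longlonglongrightarrow> t * 2" by (intro tendsto_intros R)
    then show "(\<lambda>n. t * R n) \<longlonglongrightarrow> 2 * t" by (simp add: mult.commute)
  qed
  ultimately show ?thesis by (rule LIMSEQ_unique[rotated])
qed

text \<open>In the limit law, quadrupling the argument raises the modulus to the fourth power.
  Asking only for the square leaves a gap that absorbs the convergence error. Every small nonzero
  \<open>t\<close> is covered, because up to sign it equals x / A(n) with 1/2 \<le> x \<le> 1 for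
  some large n.\<close>

lemma char_quadruple:
  obtains \<eta> where "\<eta> > 0" "\<And>t. \<bar>t\<bar> \<le> \<eta> \<Longrightarrow> cmod (char D (4 * t)) \<le> cmod (char D t) ^ 2"
proof -
  \<comment> \<open>A lower bound of exp(-2cx) - exp(-4cx) on [1/2, 1]. With tolerance
    \<open>g / 4\<close> the squared power at \<open>t\<close> is off by at most g/2 and the power
    at \<open>4 * t\<close> by g/4, together less than \<open>g\<close>.\<close>
  define g where "g = exp (- 4 * c) * (exp c - 1)"
  have g: "g > 0" using c_pos by (simp add: g_def)
  have gap: "exp (- 4 * c * x) + g \<le> exp (- 2 * c * x)" if "1 / 2 \<le> x" "x \<le> 1" for x
  proof -
    have "exp (- 4 * c) * (exp c - 1) \<le> exp (- 4 * c * x) * (exp (2 * c * x) - 1)"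
      using that c_pos by (intro mult_mono) auto
    also have "\<dots> = exp (- 2 * c * x) - exp (- 4 * c * x)"
      by (simp add: algebra_simps flip: exp_add)
    finally show ?thesis by (simp add: g_def)
  qed
  have "(\<lambda>n. A (Suc n) / A n) \<longlonglongrightarrow> 1"
  proof (rule A_ratio)
    show "filterlim Suc at_top sequentially" by (rule filterlim_Suc)
    show "(\<lambda>n. real (Suc n) / real n) \<longlonglongrightarrow> 1" by real_asymp
  qed simp
  then have "\<forall>\<^sub>F n in sequentially. A (Suc n) / A n < 2" by (rule order_tendstoD) simp
  moreover have "\<forall>\<^sub>F n in sequentially. \<forall>s. \<bar>s\<bar> \<le> 4 \<longrightarrow> \<bar>cmod (char D (s / A n)) ^ n - exp (- c * \<bar>s\<bar>)\<bar> \<le> g / 4"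
    using g by (intro modulus_lim) simp
  ultimately have "\<forall>\<^sub>F n in sequentially. n > 0 \<and> A (Suc n) / A n < 2 \<and> (\<forall>s. \<bar>s\<bar> \<le> 4 \<longrightarrow> \<bar>cmod (char D (s / A n)) ^ n - exp (- c * \<bar>s\<bar>)\<bar> \<le> g / 4)"
    using eventually_gt_at_top[of 0] by eventually_elim auto
  then obtain N where N: "\<And>n. n \<ge> N \<Longrightarrow> n > 0" "\<And>n. n \<ge> N \<Longrightarrow> A (Suc n) < 2 * A n"
    "\<And>n s. n \<ge> N \<Longrightarrow> \<bar>s\<bar> \<le> 4 \<Longrightarrow> \<bar>cmod (char D (s / A n)) ^ n - exp (- c * \<bar>s\<bar>)\<bar> \<le> g / 4"
    using A_pos by (auto simp: eventually_sequentially divide_less_eq)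
  show ?thesis
  proof
    show "1 / A N > 0" using A_pos by simp
    fix t :: real assume t: "\<bar>t\<bar> \<le> 1 / A N"
    show "cmod (char D (4 * t)) \<le> cmod (char D t) ^ 2"
    proof (cases "t = 0")
      case True then show ?thesis by (simp add: char_zero)
    next
      case False
      \<comment> \<open>\<open>A\<close> need not be monotone, so \<open>n\<close> is the last index
        with \<open>A n \<le> 1 / \<bar>t\<bar>\<close>. The next norming constant exceeds this
        level and is less than twice \<open>A n\<close>.\<close>
      define S where "S = {n. A n \<le> 1 / \<bar>t\<bar>}"
      have "\<forall>\<^sub>F n in sequentially. A n > 1 / \<bar>t\<bar>"
        using A_at_top by (auto simp: filterlim_at_top_dense)
      then obtain n0 where "\<And>n. n \<ge> n0 \<Longrightarrow> A n > 1 / \<bar>t\<bar>" by (auto simp: eventually_sequentially)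
      then have "S \<subseteq> {..<n0}" by (force simp: S_def not_le[symmetric])
      then have fin: "finite S" by (rule finite_subset) simp
      have NS: "N \<in> S" using t False A_pos[of N] by (simp add: S_def field_simps)
      define n where "n = Max S"
      have nS: "n \<in> S" and nN: "N \<le> n" using fin NS by (auto simp: n_def intro: Max_in)
      have "Suc n \<notin> S" using Max_ge[OF fin, of "Suc n"] by (auto simp: n_def)
      then have nt: "1 / \<bar>t\<bar> < 2 * A n" using N(2)[OF nN] by (simp add: S_def)
      define x where "x = \<bar>t\<bar> * A n"
      have x: "1 / 2 \<le> x" "x \<le> 1" using nt nS False by (auto simp: x_def S_def field_simps)
      have x': "\<bar>t * A n\<bar> = x" using A_pos[of n] by (simp add: x_def abs_mult)
      have a: "\<bar>cmod (char D t) ^ n - exp (- c * x)\<bar> \<le> g / 4"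
        using N(3)[OF nN, of "t * A n"] x x' A_pos[of n] by simp
      have b: "\<bar>cmod (char D (4 * t)) ^ n - exp (- 4 * c * x)\<bar> \<le> g / 4"
      proof -
        have "\<bar>4 * (t * A n)\<bar> = 4 * x" using x' by (simp add: abs_mult)
        moreover have "4 * (t * A n) / A n = 4 * t" using A_pos[of n] by simp
        ultimately show ?thesis using N(3)[OF nN, of "4 * (t * A n)"] x by (simp add: mult_ac)
      qed
      have e1: "exp (- c * x) \<le> 1" "0 < exp (- c * x)" using c_pos x by auto
      have "exp (- c * x) ^ 2 - (cmod (char D t) ^ n) ^ 2 = (exp (- c * x) - cmod (char D t) ^ n) * (exp (- c * x) + cmod (char D t) ^ n)"
        by (simp add: power2_eq_square algebra_simps)
      also have "\<dots> \<le> \<bar>exp (- c * x) - cmod (char D t) ^ n\<bar> * 2"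
      proof (rule order_trans[OF abs_ge_self], unfold abs_mult, rule mult_left_mono)
        have "cmod (char D t) ^ n \<le> 1" by (intro power_le_one cmod_char_le_1) simp
        then show "\<bar>exp (- c * x) + cmod (char D t) ^ n\<bar> \<le> 2" using e1 zero_le_power[OF norm_ge_zero, of "char D t" n] by linarith
      qed simp
      also have "\<dots> \<le> g / 2" using a by (simp add: abs_minus_commute)
      finally have "exp (- 2 * c * x) - (cmod (char D t) ^ n) ^ 2 \<le> g / 2"
        by (simp add: power2_eq_square mult.assoc flip: exp_add)
      with gap[OF x] b g have "cmod (char D (4 * t)) ^ n \<le> (cmod (char D t) ^ n) ^ 2"
        unfolding abs_le_iff by linarith
      then have "cmod (char D (4 * t)) ^ n \<le> (cmod (char D t) ^ 2) ^ n" by (simp add: power_mult[symmetric] mult.commute)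
      then show ?thesis using N(1)[OF nN] by (simp add: power_mono_iff)
    qed
  qed
qed

text \<open>An integrable majorant uniform in \<open>k\<close>, for the dominated convergence in the
  local limit theorem. If |s| lies between 4^j and 4^(j+1), then \<open>j\<close> uses of
  \<open>char_quadruple\<close> reduce it to modulus between 1 and 4, where the k-th power is at
  most \<open>\<theta>\<close>, so the bound is \<theta>^(2^j).\<close>

lemma char_dominated:
  obtains \<eta> C J where "\<eta> > 0" "C > 0" "\<And>k s. k \<ge> J \<Longrightarrow> \<bar>s\<bar> \<le> \<eta> * A k \<Longrightarrow> cmod (char D (s / A k)) ^ k \<le> C / (1 + s\<^sup>2)"
proof -
  obtain \<eta> where \<eta>: "\<eta> > 0" "\<And>t. \<bar>t\<bar> \<le> \<eta> \<Longrightarrow> cmod (char D (4 * t)) \<le> cmod (char D t) ^ 2"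
    by (rule char_quadruple) blast
  have iter: "cmod (char D (4 ^ j * t)) \<le> cmod (char D t) ^ (2 ^ j)" if "4 ^ j * \<bar>t\<bar> \<le> \<eta>" for j t
    using that
  proof (induction j)
    case (Suc j)
    have le: "4 ^ j * \<bar>t\<bar> \<le> \<eta>" using Suc.prems mult_nonneg_nonneg[of "4 ^ j" "\<bar>t\<bar>", OF zero_le_power abs_ge_zero]
      unfolding power_Suc mult.assoc by linarith
    have "cmod (char D (4 ^ Suc j * t)) = cmod (char D (4 * (4 ^ j * t)))" by (simp add: mult.assoc)
    also have "\<dots> \<le> cmod (char D (4 ^ j * t)) ^ 2" using le by (intro \<eta>) (simp add: abs_mult)
    also have "\<dots> \<le> (cmod (char D t) ^ (2 ^ j)) ^ 2" using Suc.IH[OF le] by (intro power_mono) auto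
    finally show ?case by (simp add: power_mult[symmetric] mult.commute)
  qed simp
  define \<theta> where "\<theta> = (1 + exp (- c)) / 2"
  have \<theta>: "0 < \<theta>" "\<theta> < 1" using c_pos by (auto simp: \<theta>_def add_pos_pos)
  have "\<forall>\<^sub>F n in sequentially. \<forall>s. \<bar>s\<bar> \<le> 4 \<longrightarrow> \<bar>cmod (char D (s / A n)) ^ n - exp (- c * \<bar>s\<bar>)\<bar> \<le> (1 - exp (- c)) / 2"
    using c_pos by (intro modulus_lim) simp
  then obtain J where J: "\<And>n s. n \<ge> J \<Longrightarrow> \<bar>s\<bar> \<le> 4 \<Longrightarrow> \<bar>cmod (char D (s / A n)) ^ n - exp (- c * \<bar>s\<bar>)\<bar> \<le> (1 - exp (- c)) / 2"
    by (auto simp: eventually_sequentially)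
  have J': "cmod (char D (s / A n)) ^ n \<le> \<theta>" if "n \<ge> J" "1 \<le> \<bar>s\<bar>" "\<bar>s\<bar> \<le> 4" for n s
  proof -
    have "exp (- c * \<bar>s\<bar>) \<le> exp (- c)" using that c_pos by simp
    with J[OF that(1,3)] show ?thesis unfolding \<theta>_def abs_le_iff by argo
  qed
  \<comment> \<open>The exponent 4 is meant for n = 2^j: then n^4 = 16^j is the square of 4^j, hence
    comparable to s^2.\<close>
  have "(\<lambda>n. real n ^ 4 * \<theta> ^ n) \<longlonglongrightarrow> 0"
    using \<theta> by real_asymp
  then have "Bseq (\<lambda>n. real n ^ 4 * \<theta> ^ n)"
    by (intro convergent_imp_Bseq) (auto simp: convergent_def)
  then obtain B where B: "B > 0" "\<And>n. real n ^ 4 * \<theta> ^ n \<le> B"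
    by (auto simp: Bseq_def) (metis abs_le_D1 norm_power power_abs real_norm_def)
  show ?thesis
  proof
    show "\<eta> > 0" by (rule \<eta>)
    show "2 + 32 * B > 0" using B by simp
    fix k s assume k: "k \<ge> J" and s: "\<bar>s\<bar> \<le> \<eta> * A k"
    have Ak: "A k > 0" by (rule A_pos)
    show "cmod (char D (s / A k)) ^ k \<le> (2 + 32 * B) / (1 + s\<^sup>2)"
    proof (cases "\<bar>s\<bar> \<le> 1")
      case True
      then have "s\<^sup>2 \<le> 1" using abs_square_le_1 by blast
      then have "1 \<le> (2 + 32 * B) / (1 + s\<^sup>2)"
        using B(1) by (subst le_divide_eq_1_pos) (auto simp: add_pos_nonneg)
      moreover have "cmod (char D (s / A k)) ^ k \<le> 1" by (intro power_le_one cmod_char_le_1) simp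
      ultimately show ?thesis by simp
    next
      case False
      obtain j where j: "4 ^ j \<le> \<bar>s\<bar>" "\<bar>s\<bar> < 4 ^ (j + 1)"
      proof -
        define j where "j = (LEAST j. \<bar>s\<bar> < 4 ^ (j + 1))"
        obtain i where "\<bar>s\<bar> < 4 ^ i" using real_arch_pow[of 4 "\<bar>s\<bar>"] by auto
        then have "\<bar>s\<bar> < 4 ^ (i + 1)" by simp
        then have 1: "\<bar>s\<bar> < 4 ^ (j + 1)" unfolding j_def by (rule LeastI)
        have "4 ^ j \<le> \<bar>s\<bar>"
        proof (cases j)
          case (Suc l)
          then have "\<not> \<bar>s\<bar> < 4 ^ (l + 1)" using not_less_Least[of l "\<lambda>j. \<bar>s\<bar> < 4 ^ (j + 1)"] by (simp add: j_def)
          then show ?thesis using Suc by simp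
        qed (use False in simp)
        with 1 show ?thesis using that by blast
      qed
      define s' where "s' = s / 4 ^ j"
      have s': "1 \<le> \<bar>s'\<bar>" "\<bar>s'\<bar> \<le> 4" using j by (auto simp: s'_def field_simps)
      have ss: "s / A k = 4 ^ j * (s' / A k)" by (simp add: s'_def)
      have "cmod (char D (s / A k)) \<le> cmod (char D (s' / A k)) ^ (2 ^ j)"
        unfolding ss
      proof (rule iter)
        show "4 ^ j * \<bar>s' / A k\<bar> \<le> \<eta>" using s Ak by (simp add: s'_def abs_mult field_simps)
      qed
      then have "cmod (char D (s / A k)) ^ k \<le> (cmod (char D (s' / A k)) ^ (2 ^ j)) ^ k"
        by (intro power_mono) auto
      also have "\<dots> = (cmod (char D (s' / A k)) ^ k) ^ (2 ^ j)" by (simp add: power_mult[symmetric] mult.commute)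
      also have "\<dots> \<le> \<theta> ^ (2 ^ j)" using J'[OF k s'] by (intro power_mono) auto
      also have "\<dots> \<le> B / 16 ^ j"
      proof -
        have "real (2 ^ j) ^ 4 = 16 ^ j" by (simp add: power_mult[symmetric] mult.commute[of j], simp add: power_mult)
        with B(2)[of "2 ^ j"] show ?thesis by (simp add: field_simps)
      qed
      also have "\<dots> \<le> 32 * B / (1 + s\<^sup>2)"
      proof -
        have "s\<^sup>2 \<le> (4 ^ (j + 1))\<^sup>2" using j power_mono[of "\<bar>s\<bar>" "4 ^ (j + 1)" 2] by simp
        also have "\<dots> = 16 * 16 ^ j" by (simp add: power_mult[symmetric] power_mult_distrib mult.commute[of j], simp add: power_mult)
        finally have "1 + s\<^sup>2 \<le> 32 * 16 ^ j" using one_le_power[of "16::real" j] by linarith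
        then have "B * (1 + s\<^sup>2) \<le> B * (32 * 16 ^ j)" using B by (intro mult_left_mono) auto
        then show ?thesis by (simp add: field_simps add_pos_nonneg)
      qed
      also have "\<dots> \<le> (2 + 32 * B) / (1 + s\<^sup>2)" by (intro divide_right_mono) auto
      finally show ?thesis .
    qed
  qed
qed

end

subsection \<open>Local limit theorem\<close>

text \<open>The value \<open>\<pi>\<close> of this integral is not needed: the constant cancels when the local limit
  theorem and the density at 0 are computed with the same triangle kernel.\<close>

definition fejer_mass :: real where
  "fejer_mass = (\<integral>t. (1 - cos t) / t\<^sup>2 \<partial>lborel)"

section \<open>The kernel (1 - cos t) / t^2 and triangle functions\<close>

lemma one_minus_cos_le: "1 - cos v \<le> v\<^sup>2 / 2" for v :: real
proof -
  have "\<bar>sin (v / 2)\<bar> \<le> \<bar>v / 2\<bar>" by (rule abs_sin_x_le_abs_x)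
  then have "(sin (v / 2))\<^sup>2 \<le> (v / 2)\<^sup>2" by (rule abs_le_square_iff[THEN iffD1])
  moreover have "cos v = 1 - 2 * (sin (v / 2))\<^sup>2" using cos_double_sin[of "v / 2"] by simp
  ultimately show ?thesis by (simp add: power2_eq_square)
qed

lemma integrable_inverse_square: "integrable lborel (\<lambda>x::real. inverse (1 + x\<^sup>2))"
  using integrable_inverse_1_plus_square by (simp add: set_integrable_def)

lemma integrable_fejer: "integrable lborel (\<lambda>t::real. (1 - cos (u * t)) / t\<^sup>2)"
proof -
  have "integrable lborel (\<lambda>t::real. (1 - cos t) / t\<^sup>2)"
  proof (rule Bochner_Integration.integrable_bound)
    show "integrable lborel (\<lambda>x::real. 4 * inverse (1 + x\<^sup>2))" using integrable_inverse_square by simp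
    show "AE t::real in lborel. norm ((1 - cos t) / t\<^sup>2) \<le> norm (4 * inverse (1 + t\<^sup>2))"
    proof (rule AE_I2)
      fix t :: real
      show "norm ((1 - cos t) / t\<^sup>2) \<le> norm (4 * inverse (1 + t\<^sup>2))"
      proof (cases "t\<^sup>2 \<le> 1")
        case True
        have "(1 - cos t) / t\<^sup>2 \<le> 1 / 2" using one_minus_cos_le[of t] by (cases "t = 0") (auto simp: field_simps)
        also have "\<dots> \<le> 4 * inverse (1 + t\<^sup>2)" using True by (simp add: field_simps add_pos_nonneg)
        finally show ?thesis by (simp add: abs_of_nonneg add_nonneg_nonneg)
      next
        case False
        have "(1 - cos t) / t\<^sup>2 \<le> 2 / t\<^sup>2" using cos_ge_minus_one[of t] by (intro divide_right_mono) auto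
        also have "\<dots> = 4 / (t\<^sup>2 + t\<^sup>2)" by simp
        also have "\<dots> \<le> 4 / (1 + t\<^sup>2)" using False by (intro divide_left_mono) (auto intro!: mult_pos_pos add_pos_nonneg)
        also have "\<dots> = 4 * inverse (1 + t\<^sup>2)" by (simp add: field_simps)
        finally show ?thesis by (simp add: abs_of_nonneg add_nonneg_nonneg)
      qed
    qed
  qed simp
  from lborel_integrable_real_affine[OF this, of u 0]
  have "u \<noteq> 0 \<Longrightarrow> integrable lborel (\<lambda>t. u\<^sup>2 * ((1 - cos (u * t)) / (u * t)\<^sup>2))"
    unfolding add_0 by (intro integrable_mult_right)
  then show ?thesis by (cases "u = 0") (auto simp: power_mult_distrib)
qed

lemma integral_fejer: "(\<integral>t. (1 - cos (u * t)) / t\<^sup>2 \<partial>lborel) = \<bar>u\<bar> * fejer_mass"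
proof (cases "u = 0")
  case False
  have "fejer_mass = \<bar>u\<bar> * (\<integral>t. (1 - cos (u * t)) / (u * t)\<^sup>2 \<partial>lborel)"
    unfolding fejer_mass_def using lborel_integral_real_affine[OF False, of "\<lambda>t. (1 - cos t) / t\<^sup>2" 0] by simp
  also have "(\<lambda>t. (1 - cos (u * t)) / (u * t)\<^sup>2) = (\<lambda>t. 1 / u\<^sup>2 * ((1 - cos (u * t)) / t\<^sup>2))"
    by (auto simp: power_mult_distrib)
  finally have "fejer_mass = \<bar>u\<bar> * (1 / u\<^sup>2 * (\<integral>t. (1 - cos (u * t)) / t\<^sup>2 \<partial>lborel))"
    by (simp only: integral_mult_right_zero)
  moreover have "\<bar>u\<bar> * (\<bar>u\<bar> * (1 / u\<^sup>2 * z)) = z" for z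
    using False by (simp add: mult.assoc[symmetric] abs_mult_self_eq power2_eq_square)
  ultimately show ?thesis by metis
qed simp

lemma fejer_mass_pos: "fejer_mass > 0"
proof -
  have c: "cos 1 < (1::real)" using cos_monotone_0_pi[of 0 1] pi_gt3 by simp
  have "0 < (1 - cos 1) / 4 * measure lborel {1..2::real}" using c by simp
  also have "\<dots> = (\<integral>t. indicator {1..2::real} t * ((1 - cos 1) / 4) \<partial>lborel)" by simp
  also have "\<dots> \<le> fejer_mass"
    unfolding fejer_mass_def
  proof (rule integral_mono)
    show "integrable lborel (\<lambda>t::real. (1 - cos t) / t\<^sup>2)" using integrable_fejer[of 1] by simp
    have "integrable lborel (indicator {1..2::real} :: real \<Rightarrow> real)"
      by (intro integrable_real_indicator) auto
    then show "integrable lborel (\<lambda>t::real. indicator {1..2::real} t * ((1 - cos 1) / 4 :: real))"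
      by (intro integrable_mult_left)
    fix t :: real
    show "indicator {1..2::real} t * ((1 - cos 1) / 4) \<le> (1 - cos t) / t\<^sup>2"
    proof (cases "t \<in> {1..2}")
      case True
      have "cos t \<le> cos 1" using True pi_gt3 by (intro cos_monotone_0_pi_le) auto
      moreover have "t\<^sup>2 \<le> 2\<^sup>2" using True by (intro power_mono) auto
      ultimately have "(1 - cos 1) / 4 \<le> (1 - cos t) / t\<^sup>2" using True c by (intro frac_le) auto
      then show ?thesis using True by simp
    qed simp
  qed
  finally show ?thesis .
qed

text \<open>cos(yt) (1 - cos rt) is half a second difference, in y with step r, of 1 - cos(yt). The
  latter, divided by t^2, integrates to |y| times \<open>fejer_mass\<close>, and half the second
  difference of |y| is the triangle.\<close>

lemma triangle_fourier:
  assumes "r \<ge> 0"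
  shows "(\<integral>t. cos (y * t) * ((1 - cos (r * t)) / t\<^sup>2) \<partial>lborel) = fejer_mass * max 0 (r - \<bar>y\<bar>)"
proof -
  have "cos (y * t) * ((1 - cos (r * t)) / t\<^sup>2) = ((1 - cos ((y + r) * t)) / t\<^sup>2 + (1 - cos ((y - r) * t)) / t\<^sup>2) / 2 - (1 - cos (y * t)) / t\<^sup>2" for t
  proof -
    have "(1 - cos ((y + r) * t) + (1 - cos ((y - r) * t))) / 2 - (1 - cos (y * t)) = cos (y * t) * (1 - cos (r * t))"
      by (simp add: ring_distribs cos_add cos_diff diff_divide_distrib)
    then have "cos (y * t) * (1 - cos (r * t)) / t\<^sup>2 = ((1 - cos ((y + r) * t) + (1 - cos ((y - r) * t))) / 2 - (1 - cos (y * t))) / t\<^sup>2"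
      by simp
    then show ?thesis
      by (simp only: add_divide_distrib[symmetric] diff_divide_distrib[symmetric] times_divide_eq_right)
        (simp add: add_divide_distrib diff_divide_distrib)
  qed
  then have "(\<integral>t. cos (y * t) * ((1 - cos (r * t)) / t\<^sup>2) \<partial>lborel) =
     (\<bar>y + r\<bar> * fejer_mass + \<bar>y - r\<bar> * fejer_mass) / 2 - \<bar>y\<bar> * fejer_mass"
    using integrable_fejer by (simp add: integral_fejer)
  also have "\<dots> = fejer_mass * ((\<bar>y + r\<bar> + \<bar>y - r\<bar>) / 2 - \<bar>y\<bar>)" by (simp add: field_simps)
  also have "(\<bar>y + r\<bar> + \<bar>y - r\<bar>) / 2 - \<bar>y\<bar> = max 0 (r - \<bar>y\<bar>)" using assms by (auto simp: max_def abs_if)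
  finally show ?thesis .
qed

text \<open>A Parseval identity with a triangle as test function. Unlike that of an interval, its
  Fourier transform is absolutely integrable, so Fubini applies to every law, with or without a
  density.\<close>

lemma (in real_distribution) integral_triangle:
  assumes r: "r \<ge> 0"
  shows "fejer_mass * (\<integral>w. max 0 (r - \<bar>w - y\<bar>) \<partial>M) =
    (\<integral>t. (1 - cos (r * t)) / t\<^sup>2 * Re (iexp (- y * t) * char M t) \<partial>lborel)"
    (is "_ = (\<integral>t. ?k t * _ t \<partial>lborel)")
    and integrable_triangle: "integrable lborel (\<lambda>t. (1 - cos (r * t)) / t\<^sup>2 * Re (iexp (- y * t) * char M t))"
proof -
  interpret P: pair_sigma_finite lborel M ..
  have k: "\<bar>cos z * ?k t\<bar> \<le> ?k t" for z t
  proof -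
    have "\<bar>cos z\<bar> * ?k t \<le> 1 * ?k t" by (intro mult_right_mono) auto
    then show ?thesis by (simp add: abs_mult)
  qed
  have inner: "(\<integral>w. cos ((w - y) * t) * ?k t \<partial>M) = ?k t * Re (iexp (- y * t) * char M t)" for t
  proof -
    have i: "integrable M (\<lambda>x. iexp (t * x))" by (auto intro!: integrable_const_bound[where B = 1])
    have "iexp (- y * t) * char M t = (\<integral>w. iexp (- y * t) * iexp (t * w) \<partial>M)"
      unfolding char_def using i by simp
    also have "\<dots> = (\<integral>w. iexp ((w - y) * t) \<partial>M)"
      by (intro Bochner_Integration.integral_cong) (auto simp: algebra_simps simp flip: exp_add)
    finally have "Re (iexp (- y * t) * char M t) = (\<integral>w. Re (iexp ((w - y) * t)) \<partial>M)"
      by (subst integral_Re) (auto intro!: integrable_const_bound[where B = 1] simp del: of_real_mult of_real_diff)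
    then show ?thesis by (simp add: Re_exp)
  qed
  have meas: "(\<lambda>(t, w). cos ((w - y) * t) * ?k t) \<in> borel_measurable (lborel \<Otimes>\<^sub>M M)" by measurable
  have iw: "integrable M (\<lambda>w. cos ((w - y) * t) * ?k t)" for t
    using k by (intro integrable_const_bound[where B = "?k t"]) auto
  have int: "integrable (lborel \<Otimes>\<^sub>M M) (\<lambda>(t, w). cos ((w - y) * t) * ?k t)"
  proof (rule P.Fubini_integrable[OF meas])
    show "integrable lborel (\<lambda>t. \<integral>w. norm (case (t, w) of (t, w) \<Rightarrow> cos ((w - y) * t) * ?k t) \<partial>M)"
    proof (rule Bochner_Integration.integrable_bound[OF integrable_fejer[of r]])
      show "AE t in lborel. norm (\<integral>w. norm (case (t, w) of (t, w) \<Rightarrow> cos ((w - y) * t) * ?k t) \<partial>M) \<le> norm (?k t)"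
      proof (rule AE_I2)
        fix t
        have "(\<integral>w. \<bar>cos ((w - y) * t) * ?k t\<bar> \<partial>M) \<le> ?k t"
          using integrable_abs[OF iw[of t]] k by (intro integral_le_const) auto
        then show "norm (\<integral>w. norm (case (t, w) of (t, w) \<Rightarrow> cos ((w - y) * t) * ?k t) \<partial>M) \<le> norm (?k t)"
          by (simp add: abs_of_nonneg integral_nonneg_AE)
      qed
    qed (use meas in measurable)
  qed (use iw in auto)
  have "fejer_mass * (\<integral>w. max 0 (r - \<bar>w - y\<bar>) \<partial>M) = (\<integral>w. \<integral>t. cos ((w - y) * t) * ?k t \<partial>lborel \<partial>M)"
    by (simp only: triangle_fourier[OF r] integral_mult_right_zero)
  also have "\<dots> = (\<integral>t. \<integral>w. cos ((w - y) * t) * ?k t \<partial>M \<partial>lborel)"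
    using int by (rule P.Fubini_integral)
  finally show "fejer_mass * (\<integral>w. max 0 (r - \<bar>w - y\<bar>) \<partial>M) = (\<integral>t. ?k t * Re (iexp (- y * t) * char M t) \<partial>lborel)"
    unfolding inner .
  show "integrable lborel (\<lambda>t. ?k t * Re (iexp (- y * t) * char M t))"
    using P.integrable_fst[OF int] unfolding inner .
qed

text \<open>After factoring out r^2, the cap 1 serves as the dominating bound and the Taylor term
  \<open>r * \<bar>t\<bar>\<close> gives convergence to 0.\<close>

lemma triangle_kernel_diff:
  fixes r t :: real
  assumes "0 < r" "t \<noteq> 0"
  shows "\<bar>(1 - cos (r * t)) / t\<^sup>2 - r\<^sup>2 / 2\<bar> \<le> r\<^sup>2 * min 1 (r * \<bar>t\<bar>)"
    and "(1 - cos (r * t)) / t\<^sup>2 \<le> r\<^sup>2 / 2"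
proof -
  have t2: "t\<^sup>2 > 0" using assms by simp
  show le: "(1 - cos (r * t)) / t\<^sup>2 \<le> r\<^sup>2 / 2"
    using one_minus_cos_le[of "r * t"] t2 by (simp add: field_simps power_mult_distrib)
  have "0 \<le> (1 - cos (r * t)) / t\<^sup>2" by simp
  with le have 1: "\<bar>(1 - cos (r * t)) / t\<^sup>2 - r\<^sup>2 / 2\<bar> \<le> r\<^sup>2 * 1" 
    unfolding abs_le_iff using zero_le_power2[of r] by linarith
  have "\<bar>Re (iexp (r * t) - (\<Sum>k\<le>2. (\<i> * complex_of_real (r * t))^k / fact k))\<bar> \<le> \<bar>r * t\<bar> ^ 3 / 6"
    using order_trans[OF abs_Re_le_cmod iexp_approx1[of "r * t" 2]] by (simp add: eval_nat_numeral fact_numeral)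
  moreover have "Re (iexp (r * t) - (\<Sum>k\<le>2. (\<i> * complex_of_real (r * t))^k / fact k)) = cos (r * t) - 1 + (r * t)\<^sup>2 / 2"
    by (simp add: eval_nat_numeral Re_exp)
  ultimately have "\<bar>cos (r * t) - 1 + (r * t)\<^sup>2 / 2\<bar> \<le> \<bar>r * t\<bar> ^ 3 / 6" by simp
  then have "\<bar>cos (r * t) - 1 + (r * t)\<^sup>2 / 2\<bar> / t\<^sup>2 \<le> \<bar>r * t\<bar> ^ 3 / 6 / t\<^sup>2" using t2 by (intro divide_right_mono) auto
  also have "\<bar>r * t\<bar> ^ 3 / 6 / t\<^sup>2 = r\<^sup>2 * (r * \<bar>t\<bar> / 6)"
    using assms by (simp add: abs_mult power3_eq_cube power2_eq_square field_simps)
  also have "\<dots> \<le> r\<^sup>2 * (r * \<bar>t\<bar>)"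
    using assms by (intro mult_left_mono) auto
  also have "\<bar>cos (r * t) - 1 + (r * t)\<^sup>2 / 2\<bar> / t\<^sup>2 = \<bar>(1 - cos (r * t)) / t\<^sup>2 - r\<^sup>2 / 2\<bar>"
  proof -
    have "(1 - cos (r * t)) / t\<^sup>2 - r\<^sup>2 / 2 = - (cos (r * t) - 1 + (r * t)\<^sup>2 / 2) / t\<^sup>2"
      using assms by (simp add: field_simps power_mult_distrib)
    then show ?thesis by (simp only: abs_divide abs_minus_cancel abs_power2)
  qed
  finally show "\<bar>(1 - cos (r * t)) / t\<^sup>2 - r\<^sup>2 / 2\<bar> \<le> r\<^sup>2 * min 1 (r * \<bar>t\<bar>)" using 1 by (auto simp: min_def)
qed

section \<open>Laws of the walk as iterated convolutions, and their characteristic functions\<close>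

primrec walk_law :: "real measure \<Rightarrow> real measure \<Rightarrow> nat \<Rightarrow> real measure" where
  "walk_law D \<nu> 0 = \<nu>"
| "walk_law D \<nu> (Suc k) = convolution (walk_law D \<nu> k) D"

lemma real_distribution_convolution:
  assumes "real_distribution M" "real_distribution N"
  shows "real_distribution (convolution M N)"
proof -
  interpret M: real_distribution M by fact
  interpret N: real_distribution N by fact
  interpret P: pair_prob_space M N ..
  show ?thesis unfolding convolution_def by (intro P.real_distribution_distr) simp
qed

lemma integral_convolution:
  fixes f :: "real \<Rightarrow> 'b::{banach, second_countable_topology}"
  assumes "real_distribution M" "real_distribution N"
    and [measurable]: "f \<in> borel_measurable borel" and B: "\<And>x. norm (f x) \<le> B"
  shows "(\<integral>x. f x \<partial>(convolution M N)) = (\<integral>x. \<integral>y. f (x + y) \<partial>N \<partial>M)"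
proof -
  interpret M: real_distribution M by fact
  interpret N: real_distribution N by fact
  interpret P: pair_prob_space M N ..
  have "integrable (M \<Otimes>\<^sub>M N) (\<lambda>(x, y). f (x + y))"
    using B by (intro P.integrable_const_bound[where B = B]) auto
  from P.integral_fst[OF this] show ?thesis
    unfolding convolution_def by (subst integral_distr) (auto simp: case_prod_unfold)
qed

lemma real_distribution_walk_law:
  assumes "real_distribution D" "real_distribution \<nu>"
  shows "real_distribution (walk_law D \<nu> k)"
  by (induction k) (auto intro: real_distribution_convolution assms)

lemma char_convolution:
  assumes "real_distribution M" "real_distribution N"
  shows "char (convolution M N) t = char M t * char N t"
proof -
  interpret M: real_distribution M by fact
  interpret N: real_distribution N by fact
  have "char (convolution M N) t = (\<integral>x. \<integral>y. iexp (t * (x + y)) \<partial>N \<partial>M)"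
    unfolding char_def by (intro integral_convolution[where B = 1] assms) (auto simp del: of_real_mult)
  also have "(\<lambda>x y. iexp (t * (x + y))) = (\<lambda>x y. iexp (t * x) * iexp (t * y))"
    by (auto simp: algebra_simps exp_add)
  also have "(\<integral>x. \<integral>y. iexp (t * x) * iexp (t * y) \<partial>N \<partial>M) = char M t * char N t"
    by (simp add: char_def)
  finally show ?thesis .
qed

lemma char_walk_law:
  assumes "real_distribution D" "real_distribution \<nu>"
  shows "char (walk_law D \<nu> k) t = char \<nu> t * char D t ^ k"
  by (induction k) (auto simp: char_convolution assms real_distribution_walk_law)

context cauchy_domain
begin

text \<open>Fourier inversion at 0 for the limit law, with \<open>fejer_mass\<close> in place of
  pi.\<close>

definition local_density :: real where
  "local_density = (\<integral>s. Re (\<Phi> s) \<partial>lborel) / (2 * fejer_mass)"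

lemma Phi_measurable [measurable]: "\<Phi> \<in> borel_measurable borel"
  by (intro borel_measurable_continuous_onI continuous_at_imp_continuous_on) (auto intro: Phi_cont)

lemma Phi_bound:
  obtains C where "C > 0" "\<And>s. cmod (\<Phi> s) \<le> C * inverse (1 + s\<^sup>2)"
proof
  define C where "C = max 1 (2 / c\<^sup>2)"
  show C: "C > 0" by (simp add: C_def)
  fix s
  have "1 + s\<^sup>2 \<le> C * (1 + c\<^sup>2 * s\<^sup>2 / 2)"
  proof -
    have "2 / c\<^sup>2 * (c\<^sup>2 * s\<^sup>2 / 2) \<le> C * (c\<^sup>2 * s\<^sup>2 / 2)" by (intro mult_right_mono) (auto simp: C_def)
    moreover have "1 \<le> C" by (simp add: C_def)
    ultimately show ?thesis using c_pos by (simp add: ring_distribs)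
  qed
  also have "1 + c\<^sup>2 * s\<^sup>2 / 2 \<le> exp (c * \<bar>s\<bar>)"
  proof -
    have "1 + c * \<bar>s\<bar> + (c * \<bar>s\<bar>)\<^sup>2 / 2 \<le> exp (c * \<bar>s\<bar>)"
      using c_pos by (intro exp_lower_Taylor_quadratic) simp
    moreover have "0 \<le> c * \<bar>s\<bar>" using c_pos by simp
    ultimately show ?thesis by (simp only: power_mult_distrib power2_abs)
  qed
  finally have "1 + s\<^sup>2 \<le> C * exp (c * \<bar>s\<bar>)" using C by simp
  then show "cmod (\<Phi> s) \<le> C * inverse (1 + s\<^sup>2)"
    by (simp add: Phi_norm exp_minus field_simps add_pos_nonneg)
qed

lemma integrable_Phi: "integrable lborel \<Phi>"
proof -
  obtain C' where C': "C' > 0" "\<And>s. cmod (\<Phi> s) \<le> C' * inverse (1 + s\<^sup>2)" by (rule Phi_bound) blast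
  show ?thesis
  proof (rule Bochner_Integration.integrable_bound)
    show "integrable lborel (\<lambda>s. C' * inverse (1 + s\<^sup>2))" using integrable_inverse_square by simp
    show "AE x in lborel. norm (\<Phi> x) \<le> norm (C' * inverse (1 + x\<^sup>2))"
      using C' by (auto intro: order_trans)
  qed simp
qed

lemma integrable_Re_Phi: "integrable lborel (\<lambda>s. Re (\<Phi> s))"
  using integrable_Phi by (rule integrable_Re)

text \<open>Substitute t = s / A(k) in \<open>integral_triangle\<close>. Frequencies with |t| \<le>
  \<eta> give the main term by dominated convergence, the kernel being close to r^2 / 2 there. On
  the others the k-th power is at most \<open>\<rho> ^ k\<close> and the kernel has total mass
  \<open>r * fejer_mass\<close>, whence the second error. The bounds involve \<open>y\<close> only
  through |y| \<le> 1 and \<open>r\<close> only through r \<le> 1 and the displayed powers.\<close>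

lemma triangle_local_limit:
  assumes nu: "real_distribution \<nu>"
  obtains \<rho> where "0 < \<rho>" "\<rho> < 1"
    "\<And>\<delta>. \<delta> > 0 \<Longrightarrow> \<forall>\<^sub>F k in sequentially. \<forall>r y. 0 < r \<longrightarrow> r \<le> 1 \<longrightarrow> \<bar>y\<bar> \<le> 1 \<longrightarrow>
       \<bar>(\<integral>w. max 0 (r - \<bar>w - y\<bar>) \<partial>walk_law D \<nu> k) - r\<^sup>2 * local_density / A k\<bar> \<le> \<delta> * r\<^sup>2 / A k + r * \<rho> ^ k"
proof -
  interpret nu: real_distribution \<nu> by (rule nu)
  have D: "real_distribution D" ..
  obtain \<eta> C J where \<eta>: "\<eta> > 0" and C: "C > 0"
    and dom: "\<And>k s. k \<ge> J \<Longrightarrow> \<bar>s\<bar> \<le> \<eta> * A k \<Longrightarrow> cmod (char D (s / A k)) ^ k \<le> C / (1 + s\<^sup>2)"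
    by (rule char_dominated) blast
  obtain \<rho> where \<rho>: "0 < \<rho>" "\<rho> < 1" "\<And>t. \<bar>t\<bar> \<ge> \<eta> \<Longrightarrow> cmod (char D t) \<le> \<rho>"
    using char_bounded_away_from_1[OF cramer \<eta>] by auto
  obtain C' where C': "C' > 0" "\<And>s. cmod (\<Phi> s) \<le> C' * inverse (1 + s\<^sup>2)" by (rule Phi_bound) blast
  \<comment> \<open>Times r^2, the summands pay in turn for replacing the k-th power by
    \<open>\<Phi>\<close>, the kernel by r^2 / 2, and the factor coming from \<open>y\<close> and
    \<open>\<nu>\<close> by 1. The minima keep \<open>h\<close> below an integrable
    function.\<close>
  define h where "h k s = (if \<bar>s\<bar> \<le> \<eta> * A k
      then cmod (char D (s / A k) ^ k - \<Phi> s) / 2 + cmod (\<Phi> s) * (min 1 \<bar>s / A k\<bar> + min 2 (\<bar>s / A k\<bar> + cmod (char \<nu> (s / A k) - 1)) / 2)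
      else cmod (\<Phi> s) / 2)" for k s
  have h0: "h k s \<ge> 0" for k s by (auto simp: h_def)
  have [measurable]: "h k \<in> borel_measurable borel" for k unfolding h_def by measurable
  have hdom: "h k s \<le> (C + 3 * C') * inverse (1 + s\<^sup>2)" if "k \<ge> J" for k s
  proof (cases "\<bar>s\<bar> \<le> \<eta> * A k")
    case True
    have "h k s \<le> (cmod (char D (s / A k)) ^ k + cmod (\<Phi> s)) / 2 + cmod (\<Phi> s) * (1 + 2 / 2)"
      unfolding h_def using True norm_triangle_ineq4[of "char D (s / A k) ^ k" "\<Phi> s"]
      by (simp only: if_True) (intro add_mono mult_left_mono divide_right_mono, auto simp: norm_power)
    also have "\<dots> \<le> (C / (1 + s\<^sup>2) + C' * inverse (1 + s\<^sup>2)) / 2 + C' * inverse (1 + s\<^sup>2) * (1 + 2 / 2)"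
      using dom[OF that True] C'(2)[of s] by (intro add_mono divide_right_mono mult_right_mono) auto
    also have "\<dots> \<le> (C + 3 * C') * inverse (1 + s\<^sup>2)"
    proof -
      have "(C / (1 + s\<^sup>2) + C' * inverse (1 + s\<^sup>2)) / 2 + C' * inverse (1 + s\<^sup>2) * (1 + 2 / 2)
          = (C / 2 + 5 / 2 * C') * inverse (1 + s\<^sup>2)"
        unfolding divide_inverse by (simp add: algebra_simps)
      also have "\<dots> \<le> (C + 3 * C') * inverse (1 + s\<^sup>2)" using C C' by (intro mult_right_mono) auto
      finally show ?thesis .
    qed
    finally show ?thesis .
  next
    case False
    have "cmod (\<Phi> s) / 2 \<le> cmod (\<Phi> s)" by simp
    also have "\<dots> \<le> C' * inverse (1 + s\<^sup>2)" by (rule C')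
    also have "\<dots> \<le> (C + 3 * C') * inverse (1 + s\<^sup>2)" using C C' by (intro mult_right_mono) (auto simp: add_nonneg_nonneg)
    finally show ?thesis using False by (simp add: h_def)
  qed
  have hlim: "(\<lambda>k. h k s) \<longlonglongrightarrow> 0" for s
  proof -
    have t: "(\<lambda>k. s / A k) \<longlonglongrightarrow> 0"
      by (rule tendsto_divide_0[OF tendsto_const filterlim_at_top_imp_at_infinity[OF A_at_top]])
    have p: "(\<lambda>k. char D (s / A k) ^ k - \<Phi> s) \<longlonglongrightarrow> 0"
    proof (rule LIMSEQ_I)
      fix e :: real assume "e > 0"
      then show "\<exists>N. \<forall>n\<ge>N. norm (char D (s / A n) ^ n - \<Phi> s - 0) < e"
        using char_lim[of "e/2" "\<bar>s\<bar>"] by (force simp: eventually_sequentially intro: le_less_trans[of _ "e/2"])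
    qed
    have n: "(\<lambda>k. char \<nu> (s / A k)) \<longlonglongrightarrow> char \<nu> 0"
      by (rule isCont_tendsto_compose[OF nu.isCont_char t])
    have "(\<lambda>k. cmod (char D (s / A k) ^ k - \<Phi> s) / 2 + cmod (\<Phi> s) * (min 1 \<bar>s / A k\<bar> + min 2 (\<bar>s / A k\<bar> + cmod (char \<nu> (s / A k) - 1)) / 2))
       \<longlonglongrightarrow> cmod 0 / 2 + cmod (\<Phi> s) * (min 1 \<bar>0\<bar> + min 2 (\<bar>0\<bar> + cmod (char \<nu> 0 - 1)) / 2)"
      by (intro tendsto_intros t p n) auto
    then have "(\<lambda>k. cmod (char D (s / A k) ^ k - \<Phi> s) / 2 + cmod (\<Phi> s) * (min 1 \<bar>s / A k\<bar> + min 2 (\<bar>s / A k\<bar> + cmod (char \<nu> (s / A k) - 1)) / 2))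
       \<longlonglongrightarrow> 0" by (simp add: nu.char_zero)
    moreover have "\<forall>\<^sub>F k in sequentially. \<bar>s\<bar> / \<eta> \<le> A k" using A_at_top by (auto simp: filterlim_at_top)
    then have "\<forall>\<^sub>F k in sequentially. cmod (char D (s / A k) ^ k - \<Phi> s) / 2 + cmod (\<Phi> s) * (min 1 \<bar>s / A k\<bar> + min 2 (\<bar>s / A k\<bar> + cmod (char \<nu> (s / A k) - 1)) / 2) = h k s"
      by eventually_elim (use \<eta> in \<open>simp add: h_def field_simps\<close>)
    ultimately show ?thesis by (rule Lim_transform_eventually)
  qed
  have idom: "integrable lborel (\<lambda>s. (C + 3 * C') * inverse (1 + s\<^sup>2))"
    using integrable_inverse_square by simp
  have hint: "integrable lborel (h k)" if "k \<ge> J" for k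
    by (rule Bochner_Integration.integrable_bound[OF idom]) (use hdom[OF that] h0 in \<open>auto simp: abs_of_nonneg intro: order_trans[OF _ abs_ge_self]\<close>)
  have "(\<lambda>k. \<integral>s. h (k + J) s \<partial>lborel) \<longlonglongrightarrow> (\<integral>s. 0 \<partial>(lborel :: real measure))"
  proof (rule integral_dominated_convergence[OF _ _ idom])
    show "AE x in lborel. (\<lambda>i. h (i + J) x) \<longlonglongrightarrow> 0" 
      by (intro AE_I2 LIMSEQ_ignore_initial_segment hlim)
    show "AE x in lborel. norm (h (i + J) x) \<le> (C + 3 * C') * inverse (1 + x\<^sup>2)" for i
      using hdom h0 by (auto simp: abs_of_nonneg)
  qed auto
  then have hl: "(\<lambda>k. \<integral>s. h k s \<partial>lborel) \<longlonglongrightarrow> 0" by (auto intro: LIMSEQ_offset)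
  note iPhi = integrable_Re_Phi
  show ?thesis
  proof
    show "0 < \<rho>" "\<rho> < 1" by fact+
    fix \<delta> :: real assume \<delta>: "\<delta> > 0"
    have "\<forall>\<^sub>F k in sequentially. (\<integral>s. h k s \<partial>lborel) < \<delta> * fejer_mass"
      using \<delta> fejer_mass_pos by (intro order_tendstoD[OF hl]) simp
    then show "\<forall>\<^sub>F k in sequentially. \<forall>r y. 0 < r \<longrightarrow> r \<le> 1 \<longrightarrow> \<bar>y\<bar> \<le> 1 \<longrightarrow>
       \<bar>(\<integral>w. max 0 (r - \<bar>w - y\<bar>) \<partial>walk_law D \<nu> k) - r\<^sup>2 * local_density / A k\<bar> \<le> \<delta> * r\<^sup>2 / A k + r * \<rho> ^ k"
      using eventually_ge_at_top[of J]
    proof eventually_elim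
      case (elim k)
      show ?case
      proof safe
        fix r y :: real assume r: "0 < r" "r \<le> 1" and y: "\<bar>y\<bar> \<le> 1"
        interpret L: real_distribution "walk_law D \<nu> k" by (rule real_distribution_walk_law[OF D nu])
        have Ak: "A k > 0" by (rule A_pos)
        define K where "K t = (1 - cos (r * t)) / t\<^sup>2" for t
        define g where "g t = K t * Re (iexp (- y * t) * char (walk_law D \<nu> k) t)" for t
        have gi: "integrable lborel (\<lambda>s. g (s / A k))"
          using lborel_integrable_real_affine[of g "1 / A k" 0] L.integrable_triangle[of r y] Ak r
          by (simp add: g_def[abs_def] K_def)
        have Ki: "integrable lborel (\<lambda>s. K (s / A k))"
          using lborel_integrable_real_affine[of K "1 / A k" 0] integrable_fejer[of r] Ak
          by (simp add: K_def[abs_def])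
        have K0: "K t \<ge> 0" for t by (simp add: K_def)
        have KI: "(\<integral>s. K (s / A k) \<partial>lborel) = A k * (r * fejer_mass)"
          using lborel_integral_real_affine[of "1 / A k" K 0] integral_fejer[of r] Ak r
          by (simp add: K_def[abs_def] field_simps)
        define T where "T = (\<integral>w. max 0 (r - \<bar>w - y\<bar>) \<partial>walk_law D \<nu> k)"
        have "fejer_mass * T = (\<integral>t. g t \<partial>lborel)"
          unfolding T_def g_def K_def using r by (intro L.integral_triangle) simp
        also have "\<dots> = (1 / A k) * (\<integral>s. g (s / A k) \<partial>lborel)"
          using lborel_integral_real_affine[of "1 / A k" g 0] Ak by simp
        finally have T: "fejer_mass * T * A k = (\<integral>s. g (s / A k) \<partial>lborel)" using Ak by simp
        have pt: "\<bar>g (s / A k) - r\<^sup>2 / 2 * Re (\<Phi> s)\<bar> \<le> r\<^sup>2 * h k s + \<rho> ^ k * K (s / A k)" if s: "s \<noteq> 0" for s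
        proof (cases "\<bar>s\<bar> \<le> \<eta> * A k")
          case False
          define t where "t = s / A k"
          have "\<bar>t\<bar> \<ge> \<eta>" using False Ak by (simp add: t_def field_simps)
          then have "cmod (char D t) ^ k \<le> \<rho> ^ k" by (intro power_mono \<rho>) auto
          then have "cmod (iexp (- y * t) * char (walk_law D \<nu> k) t) \<le> 1 * (1 * \<rho> ^ k)"
            unfolding norm_mult char_walk_law[OF D nu] norm_power
            by (intro mult_mono nu.cmod_char_le_1) (auto simp del: of_real_mult of_real_minus)
          then have "\<bar>Re (iexp (- y * t) * char (walk_law D \<nu> k) t)\<bar> \<le> \<rho> ^ k"
            using abs_Re_le_cmod order_trans by fastforce
          then have "K t * \<bar>Re (iexp (- y * t) * char (walk_law D \<nu> k) t)\<bar> \<le> K t * \<rho> ^ k"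
            using K0 by (intro mult_left_mono) auto
          then have "\<bar>g t\<bar> \<le> \<rho> ^ k * K t" using K0[of t] by (simp add: g_def abs_mult mult.commute)
          moreover have "\<bar>r\<^sup>2 / 2 * Re (\<Phi> s)\<bar> \<le> r\<^sup>2 * h k s"
            using False abs_Re_le_cmod[of "\<Phi> s"] by (simp add: h_def abs_mult mult_left_mono)
          ultimately show ?thesis unfolding t_def by linarith
        next
          case True
          define t where "t = s / A k"
          have t0: "t \<noteq> 0" using s Ak by (simp add: t_def)
          \<comment> \<open>\<open>E * f\<close> is the characteristic function of the walk at time
            \<open>k\<close> seen from \<open>y\<close>. \<open>E\<close> collects the start and the
            centre, and tends to 1 at frequency 0.\<close>
          define E where "E = iexp (- y * t) * char \<nu> t"
          define f where "f = char D t ^ k"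
          have "cmod E \<le> 1 * 1" unfolding E_def norm_mult
            by (intro mult_mono nu.cmod_char_le_1) (auto simp del: of_real_mult of_real_minus)
          then have E1: "cmod E \<le> 1" by simp
          have "E - 1 = iexp (- y * t) * (char \<nu> t - 1) + (iexp (- y * t) - 1)" by (simp add: E_def algebra_simps)
          then have "cmod (E - 1) \<le> cmod (iexp (- y * t) * (char \<nu> t - 1)) + cmod (iexp (- y * t) - 1)"
            by (simp only:) (rule norm_triangle_ineq)
          also have "cmod (iexp (- y * t) * (char \<nu> t - 1)) = cmod (char \<nu> t - 1)"
            by (simp add: norm_mult del: of_real_mult of_real_minus)
          also have "cmod (iexp (- y * t) - 1) \<le> \<bar>- y * t\<bar>" using iexp_approx1[of "- y * t" 0] by simp
          also have "\<bar>- y * t\<bar> \<le> \<bar>t\<bar>" using mult_right_mono[OF y, of "\<bar>t\<bar>"] by (simp add: abs_mult)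
          finally have "cmod (E - 1) \<le> \<bar>t\<bar> + cmod (char \<nu> t - 1)" by simp
          moreover have "cmod (E - 1) \<le> 2" using norm_triangle_ineq4[of E 1] E1 by simp
          ultimately have E2: "cmod (E - 1) \<le> min 2 (\<bar>t\<bar> + cmod (char \<nu> t - 1))" by simp
          have "E * f - \<Phi> s = E * (f - \<Phi> s) + (E - 1) * \<Phi> s" by (simp add: algebra_simps)
          then have "cmod (E * f - \<Phi> s) \<le> cmod E * cmod (f - \<Phi> s) + cmod (E - 1) * cmod (\<Phi> s)"
            by (metis norm_mult norm_triangle_ineq)
          also have "\<dots> \<le> 1 * cmod (f - \<Phi> s) + min 2 (\<bar>t\<bar> + cmod (char \<nu> t - 1)) * cmod (\<Phi> s)"
            using E1 E2 by (intro add_mono mult_right_mono) auto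
          finally have EF: "cmod (E * f - \<Phi> s) \<le> cmod (f - \<Phi> s) + min 2 (\<bar>t\<bar> + cmod (char \<nu> t - 1)) * cmod (\<Phi> s)" by simp
          note kd = triangle_kernel_diff[OF r(1) t0, folded K_def]
          have "r * \<bar>t\<bar> \<le> 1 * \<bar>t\<bar>" using r by (intro mult_right_mono) auto
          then have "min 1 (r * \<bar>t\<bar>) \<le> min 1 \<bar>t\<bar>" by linarith
          then have "r\<^sup>2 * min 1 (r * \<bar>t\<bar>) \<le> r\<^sup>2 * min 1 \<bar>t\<bar>" by (intro mult_left_mono) auto
          then have kd': "\<bar>K t - r\<^sup>2 / 2\<bar> \<le> r\<^sup>2 * min 1 \<bar>t\<bar>" using kd(1) by linarith
          have "g t - r\<^sup>2 / 2 * Re (\<Phi> s) = K t * Re (E * f - \<Phi> s) + (K t - r\<^sup>2 / 2) * Re (\<Phi> s)"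
            by (simp add: g_def char_walk_law[OF D nu] E_def f_def algebra_simps)
          also have "\<bar>\<dots>\<bar> \<le> K t * \<bar>Re (E * f - \<Phi> s)\<bar> + \<bar>K t - r\<^sup>2 / 2\<bar> * \<bar>Re (\<Phi> s)\<bar>"
            using K0[of t] by (intro order_trans[OF abs_triangle_ineq]) (simp add: abs_mult)
          also have "\<dots> \<le> r\<^sup>2 / 2 * (cmod (f - \<Phi> s) + min 2 (\<bar>t\<bar> + cmod (char \<nu> t - 1)) * cmod (\<Phi> s))
              + r\<^sup>2 * min 1 \<bar>t\<bar> * cmod (\<Phi> s)"
            by (rule add_mono[OF mult_mono[OF kd(2) order_trans[OF abs_Re_le_cmod EF]] mult_mono[OF kd' abs_Re_le_cmod]]) simp_all
          also have "\<dots> = r\<^sup>2 * h k s" using True by (simp add: h_def f_def t_def algebra_simps)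
          also have "\<dots> \<le> r\<^sup>2 * h k s + \<rho> ^ k * K t" using \<rho> K0 by simp
          finally show ?thesis by (simp add: t_def)
        qed
        have "fejer_mass * T * A k - r\<^sup>2 / 2 * (\<integral>s. Re (\<Phi> s) \<partial>lborel) = (\<integral>s. g (s / A k) - r\<^sup>2 / 2 * Re (\<Phi> s) \<partial>lborel)"
          using gi iPhi T by simp
        also have "\<bar>\<dots>\<bar> \<le> (\<integral>s. \<bar>g (s / A k) - r\<^sup>2 / 2 * Re (\<Phi> s)\<bar> \<partial>lborel)" by (rule integral_abs_bound)
        also have "\<dots> \<le> (\<integral>s. r\<^sup>2 * h k s + \<rho> ^ k * K (s / A k) \<partial>lborel)"
        proof (rule integral_mono_AE)
          show "AE s in lborel. \<bar>g (s / A k) - r\<^sup>2 / 2 * Re (\<Phi> s)\<bar> \<le> r\<^sup>2 * h k s + \<rho> ^ k * K (s / A k)"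
            using AE_lborel_singleton[of 0] pt by (auto elim: eventually_mono)
        qed (use gi iPhi hint[OF elim(2)] Ki in auto)
        also have "\<dots> = r\<^sup>2 * (\<integral>s. h k s \<partial>lborel) + \<rho> ^ k * (A k * (r * fejer_mass))"
          using hint[OF elim(2)] Ki by (simp add: KI)
        also have "\<dots> \<le> r\<^sup>2 * (\<delta> * fejer_mass) + \<rho> ^ k * (A k * (r * fejer_mass))"
          using elim by (intro add_right_mono mult_left_mono) auto
        also have "\<dots> = (\<delta> * r\<^sup>2 / A k + r * \<rho> ^ k) * (fejer_mass * A k)"
          using Ak by (simp add: field_simps)
        also have "fejer_mass * T * A k - r\<^sup>2 / 2 * (\<integral>s. Re (\<Phi> s) \<partial>lborel) = (T - r\<^sup>2 * local_density / A k) * (fejer_mass * A k)"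
          using Ak fejer_mass_pos by (simp add: local_density_def field_simps)
        finally show "\<bar>T - r\<^sup>2 * local_density / A k\<bar> \<le> \<delta> * r\<^sup>2 / A k + r * \<rho> ^ k"
          using Ak fejer_mass_pos by (simp add: abs_mult)
      qed
    qed
  qed
qed

end

section \<open>Value and positivity of the limit density at 0, and the local limit theorem for
  intervals\<close>

lemma integral_triangle_lborel:
  fixes r :: real
  assumes "r > 0"
  shows "(\<integral>w. max 0 (r - \<bar>w\<bar>) \<partial>lborel) = r\<^sup>2"
    and "integrable lborel (\<lambda>w. max 0 (r - \<bar>w\<bar>))"
proof -
  have a: "has_bochner_integral lborel (\<lambda>w. (r - w) * indicator {0..r} w) ((r * r - r\<^sup>2 / 2) - (r * 0 - 0\<^sup>2 / 2))"
    using assms by (intro has_bochner_integral_FTC_Icc_nonneg[where F = "\<lambda>w. r * w - w\<^sup>2 / 2"]) (auto intro!: derivative_eq_intros)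
  have b: "has_bochner_integral lborel (\<lambda>w. (r + w) * indicator {-r..0} w) ((r * 0 + 0\<^sup>2 / 2) - (r * (-r) + (-r)\<^sup>2 / 2))"
    using assms by (intro has_bochner_integral_FTC_Icc_nonneg[where F = "\<lambda>w. r * w + w\<^sup>2 / 2"]) (auto intro!: derivative_eq_intros)
  have ae: "AE w in lborel. (r - w) * indicator {0..r} w + (r + w) * indicator {-r..0} w = max 0 (r - \<bar>w\<bar>)"
    using AE_lborel_singleton[of "0::real"] by eventually_elim (auto simp: indicator_def max_def)
  from has_bochner_integral_add[OF a b]
  have "has_bochner_integral lborel (\<lambda>w. (r - w) * indicator {0..r} w + (r + w) * indicator {-r..0} w) (r\<^sup>2)"
    by (simp add: power2_eq_square)
  then have "has_bochner_integral lborel (\<lambda>w. max 0 (r - \<bar>w\<bar>)) (r\<^sup>2)"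
    by (subst (asm) has_bochner_integral_cong_AE[OF _ _ ae]) auto
  then show "(\<integral>w. max 0 (r - \<bar>w\<bar>) \<partial>lborel) = r\<^sup>2" "integrable lborel (\<lambda>w. max 0 (r - \<bar>w\<bar>))"
    by (auto simp: has_bochner_integral_iff)
qed

lemma integral_exp_abs_cos:
  fixes c m :: real
  assumes c: "c > 0" and int: "integrable lborel (\<lambda>t. exp (- c * \<bar>t\<bar>) * cos (m * t))"
  shows "(\<integral>t. exp (- c * \<bar>t\<bar>) * cos (m * t) \<partial>lborel) = 2 * c / (c\<^sup>2 + m\<^sup>2)"
proof -
  define q where "q = c\<^sup>2 + m\<^sup>2"
  have q: "q > 0" using c by (simp add: q_def add_pos_nonneg)
  \<comment> \<open>The real part of the antiderivative of exp((-c + i m) x).\<close>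
  define F where "F x = exp (- c * x) * (m * sin (m * x) - c * cos (m * x)) / q" for x
  define g where "g x = exp (- c * x) * cos (m * x)" for x
  have F: "(F has_real_derivative g x) (at x)" for x
  proof -
    have "(F has_real_derivative (exp (- c * x) * (- c) * (m * sin (m * x) - c * cos (m * x))
        + exp (- c * x) * (m * (cos (m * x) * m) + c * (sin (m * x) * m))) / q) (at x)"
      unfolding F_def using q by (auto intro!: derivative_eq_intros)
    moreover have "exp (- c * x) * (- c) * (m * sin (m * x) - c * cos (m * x))
        + exp (- c * x) * (m * (cos (m * x) * m) + c * (sin (m * x) * m)) = g x * q"
      by (simp add: g_def q_def power2_eq_square algebra_simps)
    ultimately show ?thesis using q by simp
  qed
  let ?f = "\<lambda>t. exp (- c * \<bar>t\<bar>) * cos (m * t)"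
  have half: "(\<integral>t. indicator {0<..} t * ?f t \<partial>lborel) = c / q"
  proof -
    have "(LBINT x=0..\<infinity>. ?f x) = 0 - (- c / q)"
    proof (rule interval_integral_FTC_integrable[where F = F])
      fix x :: real assume "0 < ereal x"
      then have x: "x > 0" by simp
      show "isCont ?f x" by (intro continuous_intros)
      from F[of x] show "(F has_vector_derivative ?f x) (at x)"
        using x by (simp add: g_def has_real_derivative_iff_has_vector_derivative)
    next
      show "set_integrable lborel (einterval 0 \<infinity>) ?f"
        unfolding set_integrable_def using int by (intro integrable_mult_indicator) auto
      have "(F \<longlongrightarrow> F 0) (at_right 0)"
        using DERIV_isCont[OF F, of 0] by (simp add: isCont_def filterlim_at_split)
      moreover have "F 0 = - c / q" by (simp add: F_def)
      ultimately show "((F \<circ> real_of_ereal) \<longlongrightarrow> - c / q) (at_right 0)"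
        by (simp add: ereal_tendsto_simps1 zero_ereal_def)
      have "(F \<longlongrightarrow> 0) at_top"
      proof (rule Lim_null_comparison)
        have "\<bar>m * sin (m * x) - c * cos (m * x)\<bar> \<le> \<bar>m\<bar> + c" for x
        proof -
          have "\<bar>m\<bar> * \<bar>sin (m * x)\<bar> \<le> \<bar>m\<bar> * 1" "\<bar>c\<bar> * \<bar>cos (m * x)\<bar> \<le> \<bar>c\<bar> * 1"
            by (rule mult_left_mono; simp)+
          moreover have "\<bar>m * sin (m * x) - c * cos (m * x)\<bar> \<le> \<bar>m\<bar> * \<bar>sin (m * x)\<bar> + \<bar>c\<bar> * \<bar>cos (m * x)\<bar>"
            unfolding abs_mult[symmetric] by (rule abs_triangle_ineq4)
          ultimately show ?thesis using c by linarith
        qed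
        then show "\<forall>\<^sub>F x in at_top. norm (F x) \<le> exp (- c * x) * (\<bar>m\<bar> + c) / q"
          using q by (intro always_eventually allI) (auto simp: F_def abs_mult intro!: divide_right_mono mult_left_mono)
        show "((\<lambda>x. exp (- c * x) * (\<bar>m\<bar> + c) / q) \<longlongrightarrow> 0) at_top"
        proof -
          have "((\<lambda>x. exp (- c * x)) \<longlongrightarrow> 0) at_top" using c by real_asymp
          from tendsto_mult_right[OF this, of "(\<bar>m\<bar> + c) / q"] show ?thesis by simp
        qed
      qed
      then show "((F \<circ> real_of_ereal) \<longlongrightarrow> 0) (at_left \<infinity>)"
        by (simp add: ereal_tendsto_simps1)
    qed auto
    then show ?thesis
      by (simp add: interval_lebesgue_integral_def set_lebesgue_integral_def einterval_def greaterThan_def)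
  qed
  have half': "(\<integral>t. indicator {..<0} t * ?f t \<partial>lborel) = c / q"
  proof -
    have "(\<integral>t. indicator {..<0} t * ?f t \<partial>lborel) = (\<integral>t. indicator {..<0} (- t) * ?f (- t) \<partial>lborel)"
      using lborel_integral_real_affine[of "-1" "\<lambda>t. indicator {..<0} t * ?f t" 0] by simp
    also have "(\<lambda>t. indicator {..<0} (- t) * ?f (- t)) = (\<lambda>t. indicator {0<..} t * ?f t)"
      by (auto simp: indicator_def)
    finally show ?thesis using half by simp
  qed
  have ii: "integrable lborel (\<lambda>t. indicator S t * ?f t)" if "S \<in> sets borel" for S
    using integrable_mult_indicator[OF _ int, of S] that by simp
  have "(\<integral>t. ?f t \<partial>lborel) = (\<integral>t. indicator {0<..} t * ?f t + indicator {..<0} t * ?f t \<partial>lborel)"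
  proof (rule integral_cong_AE)
    show "AE t in lborel. ?f t = indicator {0<..} t * ?f t + indicator {..<0} t * ?f t"
      using AE_lborel_singleton[of "0::real"] by eventually_elim (auto simp: indicator_def)
  qed auto
  also have "\<dots> = 2 * c / q" using half half' ii by (subst Bochner_Integration.integral_add) auto
  finally show ?thesis by (simp add: q_def)
qed

context cauchy_domain
begin

text \<open>Both numbers are limits of the triangle means \<open>T n / (r n)\<^sup>2\<close>:
  continuity of \<open>f\<close> yields \<open>f 0\<close>, and \<open>integral_triangle\<close>
  with dominated convergence yields the Fourier integral.\<close>

lemma density_at_0:
  assumes mu: "real_distribution \<mu>" and char: "\<And>s. char \<mu> s = \<Phi> s"
    and dens: "\<mu> = density lborel (\<lambda>y. ennreal (f y))"
    and f_nonneg: "\<And>y. f y \<ge> 0" and f_cont: "continuous_on UNIV f"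
  shows "f 0 = local_density"
proof -
  interpret mu: real_distribution \<mu> by (rule mu)
  have [measurable]: "f \<in> borel_measurable borel" using f_cont by (rule borel_measurable_continuous_onI)
  define r where "r n = 1 / real (Suc n)" for n
  have r: "r n > 0" for n by (simp add: r_def)
  have r0: "r \<longlonglongrightarrow> 0" unfolding r_def by (rule LIMSEQ_Suc[OF lim_1_over_n])
  define T where "T n = (\<integral>w. max 0 (r n - \<bar>w\<bar>) \<partial>\<mu>)" for n
  have Tf: "T n = (\<integral>w. f w * max 0 (r n - \<bar>w\<bar>) \<partial>lborel)" for n
    unfolding T_def dens using f_nonneg by (subst integral_density) auto
  have fi: "integrable lborel (\<lambda>w. f w * max 0 (r n - \<bar>w\<bar>))" for n
  proof -
    have "integrable \<mu> (\<lambda>w. max 0 (r n - \<bar>w\<bar>))"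
      using r[of n] by (intro mu.integrable_const_bound[where B = "r n"]) auto
    then show ?thesis unfolding dens using f_nonneg by (subst (asm) integrable_density) auto
  qed
  have "(\<lambda>n. T n / (r n)\<^sup>2) \<longlonglongrightarrow> f 0"
  proof (rule LIMSEQ_I)
    fix e :: real assume e: "e > 0"
    have "\<exists>d>0. \<forall>w\<in>UNIV. dist w 0 < d \<longrightarrow> dist (f w) (f 0) < e / 2"
      using e by (intro f_cont[unfolded continuous_on_iff, rule_format]) simp_all
    then obtain d where d: "d > 0" "\<And>w. \<bar>w\<bar> < d \<Longrightarrow> \<bar>f w - f 0\<bar> < e / 2"
      by (auto simp: dist_real_def)
    have "\<forall>\<^sub>F n in sequentially. r n < d" by (rule order_tendstoD(2)[OF r0 d(1)])
    then have "\<forall>\<^sub>F n in sequentially. norm (T n / (r n)\<^sup>2 - f 0) < e"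
    proof eventually_elim
      case (elim n)
      note ti = integral_triangle_lborel[OF r[of n]]
      have eq: "T n - f 0 * (r n)\<^sup>2 = (\<integral>w. f w * max 0 (r n - \<bar>w\<bar>) - f 0 * max 0 (r n - \<bar>w\<bar>) \<partial>lborel)"
        unfolding Tf using fi ti by simp
      have "\<bar>T n - f 0 * (r n)\<^sup>2\<bar> \<le> (\<integral>w. \<bar>f w * max 0 (r n - \<bar>w\<bar>) - f 0 * max 0 (r n - \<bar>w\<bar>)\<bar> \<partial>lborel)"
        unfolding eq by (rule integral_abs_bound)
      also have "\<dots> \<le> (\<integral>w. e / 2 * max 0 (r n - \<bar>w\<bar>) \<partial>lborel)"
      proof (rule integral_mono)
        fix w
        define z where "z = max 0 (r n - \<bar>w\<bar>)"
        have z: "z \<ge> 0" by (simp add: z_def)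
        have "\<bar>f w * z - f 0 * z\<bar> = \<bar>f w - f 0\<bar> * z"
          using z by (metis abs_mult abs_of_nonneg left_diff_distrib)
        also have "\<dots> \<le> e / 2 * z"
        proof (cases "\<bar>w\<bar> < r n")
          case True
          then have "\<bar>w\<bar> < d" using elim by linarith
          from d(2)[OF this] show ?thesis using z by (intro mult_right_mono) linarith+
        next
          case False
          then have "z = 0" by (simp add: z_def)
          then show ?thesis by simp
        qed
        finally show "\<bar>f w * max 0 (r n - \<bar>w\<bar>) - f 0 * max 0 (r n - \<bar>w\<bar>)\<bar> \<le> e / 2 * max 0 (r n - \<bar>w\<bar>)"
          unfolding z_def .
      qed (use fi ti in auto)
      also have "\<dots> = e / 2 * (r n)\<^sup>2" using ti by simp
      finally have b: "\<bar>T n - f 0 * (r n)\<^sup>2\<bar> \<le> e / 2 * (r n)\<^sup>2" .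
      have "T n / (r n)\<^sup>2 - f 0 = (T n - f 0 * (r n)\<^sup>2) / (r n)\<^sup>2"
        using r[of n] by (simp add: field_simps)
      then have "\<bar>T n / (r n)\<^sup>2 - f 0\<bar> = \<bar>T n - f 0 * (r n)\<^sup>2\<bar> / (r n)\<^sup>2"
        by (simp only: abs_divide abs_power2)
      also have "\<dots> \<le> e / 2" using b r[of n] by (simp add: field_simps)
      finally show ?case using e by simp
    qed
    then show "\<exists>N. \<forall>n\<ge>N. norm (T n / (r n)\<^sup>2 - f 0) < e" by (simp add: eventually_sequentially)
  qed
  moreover have "(\<lambda>n. T n / (r n)\<^sup>2) \<longlonglongrightarrow> local_density"
  proof -
    define K where "K n t = (1 - cos (r n * t)) / t\<^sup>2 / (r n)\<^sup>2" for n t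
    have "(\<lambda>n. \<integral>t. K n t * Re (\<Phi> t) \<partial>lborel) \<longlonglongrightarrow> (\<integral>t. 1 / 2 * Re (\<Phi> t) \<partial>lborel)"
    proof (rule integral_dominated_convergence)
      show "integrable lborel (\<lambda>t. cmod (\<Phi> t))" using integrable_Phi by (rule integrable_norm)
      show "AE t in lborel. (\<lambda>n. K n t * Re (\<Phi> t)) \<longlonglongrightarrow> 1 / 2 * Re (\<Phi> t)"
        using AE_lborel_singleton[of "0::real"]
      proof eventually_elim
        case (elim t)
        have "(\<lambda>n. K n t - 1 / 2) \<longlonglongrightarrow> 0"
        proof (rule Lim_null_comparison)
          show "\<forall>\<^sub>F n in sequentially. norm (K n t - 1 / 2) \<le> r n * \<bar>t\<bar>"
          proof (intro always_eventually allI)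
            fix n
            have "\<bar>(1 - cos (r n * t)) / t\<^sup>2 - (r n)\<^sup>2 / 2\<bar> \<le> (r n)\<^sup>2 * (r n * \<bar>t\<bar>)"
              by (rule order_trans[OF triangle_kernel_diff(1)[OF r elim]]) (auto intro!: mult_left_mono)
            moreover have "K n t - 1 / 2 = ((1 - cos (r n * t)) / t\<^sup>2 - (r n)\<^sup>2 / 2) / (r n)\<^sup>2"
              using r[of n] by (simp add: K_def diff_divide_distrib)
            ultimately have "\<bar>K n t - 1 / 2\<bar> \<le> (r n)\<^sup>2 * (r n * \<bar>t\<bar>) / (r n)\<^sup>2"
              by (simp only: abs_divide abs_power2) (rule divide_right_mono, auto)
            then show "norm (K n t - 1 / 2) \<le> r n * \<bar>t\<bar>" using r[of n] by simp
          qed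
          have "(\<lambda>n. r n * \<bar>t\<bar>) \<longlonglongrightarrow> 0 * \<bar>t\<bar>" by (intro tendsto_intros r0)
          then show "(\<lambda>n. r n * \<bar>t\<bar>) \<longlonglongrightarrow> 0" by simp
        qed
        then have "(\<lambda>n. K n t) \<longlonglongrightarrow> 1 / 2" by (simp add: LIM_zero_iff)
        then show ?case by (intro tendsto_intros)
      qed
      show "AE t in lborel. norm (K n t * Re (\<Phi> t)) \<le> cmod (\<Phi> t)" for n
        using AE_lborel_singleton[of "0::real"]
      proof eventually_elim
        case (elim t)
        have "(1 - cos (r n * t)) / t\<^sup>2 \<le> (r n)\<^sup>2"
          by (rule order_trans[OF triangle_kernel_diff(2)[OF r elim]]) simp
        then have "K n t \<le> 1" unfolding K_def using r[of n] by (subst divide_le_eq_1_pos) simp_all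
        moreover have "0 \<le> K n t" by (simp add: K_def)
        ultimately have "\<bar>K n t\<bar> * \<bar>Re (\<Phi> t)\<bar> \<le> 1 * cmod (\<Phi> t)"
          by (intro mult_mono abs_Re_le_cmod) auto
        then show ?case by (simp add: abs_mult)
      qed
    qed (auto simp: K_def)
    moreover have "(\<integral>t. K n t * Re (\<Phi> t) \<partial>lborel) = fejer_mass * (T n / (r n)\<^sup>2)" for n
    proof -
      have "fejer_mass * T n = (\<integral>t. (1 - cos (r n * t)) / t\<^sup>2 * Re (\<Phi> t) \<partial>lborel)"
        using mu.integral_triangle[of "r n" 0] r[of n] by (simp add: T_def char)
      then have "fejer_mass * T n / (r n)\<^sup>2 = (\<integral>t. (1 - cos (r n * t)) / t\<^sup>2 * Re (\<Phi> t) / (r n)\<^sup>2 \<partial>lborel)"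
        by (simp only: integral_divide_zero)
      then show ?thesis by (simp add: K_def mult_ac)
    qed
    ultimately have "(\<lambda>n. fejer_mass * (T n / (r n)\<^sup>2)) \<longlonglongrightarrow> (\<integral>t. Re (\<Phi> t) \<partial>lborel) / 2" by simp
    then have "(\<lambda>n. fejer_mass * (T n / (r n)\<^sup>2) / fejer_mass) \<longlonglongrightarrow> (\<integral>t. Re (\<Phi> t) \<partial>lborel) / 2 / fejer_mass"
      using fejer_mass_pos by (intro tendsto_intros) auto
    then show ?thesis using fejer_mass_pos by (simp add: local_density_def)
  qed
  ultimately show ?thesis by (rule LIMSEQ_unique)
qed

text \<open>Up to a positive factor this is a Cauchy density shifted by \<open>m\<close>, which
  vanishes nowhere. The drift is thus harmless, and only the skewness has to be excluded
  beforehand.\<close>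

lemma local_density_pos:
  assumes Phi: "\<And>s. \<Phi> s = exp (complex_of_real (- c * \<bar>s\<bar>) + \<i> * complex_of_real (m * s))"
  shows "local_density > 0"
proof -
  have re: "Re (\<Phi> s) = exp (- c * \<bar>s\<bar>) * cos (m * s)" for s by (simp add: Phi Re_exp)
  have "(\<integral>s. Re (\<Phi> s) \<partial>lborel) = 2 * c / (c\<^sup>2 + m\<^sup>2)"
    using integral_exp_abs_cos[OF c_pos] integrable_Re_Phi unfolding re by blast
  then show ?thesis using c_pos fejer_mass_pos by (simp add: local_density_def add_pos_nonneg)
qed

text \<open>The indicator of the interval lies between difference quotients of triangles of radii
  \<eta> (1 - d), \<eta> and \<eta> (1 + d). Dividing by d \<eta> produces the main term 2 \<eta>
  f(0) / A(k), but cancels the factor r in front of \<rho>^k: the geometric error no longer shrinks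
  with \<eta>, and its constant depends on \<delta>.\<close>

lemma interval_local_limit:
  assumes nu: "real_distribution \<nu>"
  obtains \<rho> where "0 < \<rho>" "\<rho> < 1"
    "\<And>\<delta>. \<delta> > 0 \<Longrightarrow> \<exists>C\<ge>0. \<forall>\<^sub>F k in sequentially. \<forall>\<eta> y. 0 < \<eta> \<longrightarrow> \<eta> \<le> 1 / 2 \<longrightarrow> \<bar>y\<bar> \<le> 1 \<longrightarrow>
       \<bar>measure (walk_law D \<nu> k) {w. \<bar>w - y\<bar> < \<eta>} - 2 * \<eta> * local_density / A k\<bar> \<le> \<delta> * \<eta> / A k + C * \<rho> ^ k"
proof -
  have D: "real_distribution D" ..
  obtain \<rho> where \<rho>: "0 < \<rho>" "\<rho> < 1"
    "\<And>\<delta>. \<delta> > 0 \<Longrightarrow> \<forall>\<^sub>F k in sequentially. \<forall>r y. 0 < r \<longrightarrow> r \<le> 1 \<longrightarrow> \<bar>y\<bar> \<le> 1 \<longrightarrow>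
       \<bar>(\<integral>w. max 0 (r - \<bar>w - y\<bar>) \<partial>walk_law D \<nu> k) - r\<^sup>2 * local_density / A k\<bar> \<le> \<delta> * r\<^sup>2 / A k + r * \<rho> ^ k"
    by (rule triangle_local_limit[OF nu]) blast
  show ?thesis
  proof (rule that[OF \<rho>(1,2)])
    fix \<delta> :: real assume \<delta>: "\<delta> > 0"
    define f0 where "f0 = local_density"
    \<comment> \<open>Since (1 + d)^2 - 1 = 2 d + d^2, the excess over the main term is d^2 |f0|.
      The second bound on \<open>d\<close> makes it at most d \<delta> / 2, half of the admissible
      error.\<close>
    define d where "d = min (1 / 2) (\<delta> / (2 * (\<bar>f0\<bar> + 1)))"
    have d: "0 < d" using \<delta> by (simp add: d_def)
    moreover have "d \<le> 1 / 2" unfolding d_def by (rule min.cobounded1)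
    ultimately have d: "0 < d" "d \<le> 1 / 2" .
    have "d \<le> \<delta> / (2 * (\<bar>f0\<bar> + 1))" unfolding d_def by (rule min.cobounded2)
    then have "d * (2 * (\<bar>f0\<bar> + 1)) \<le> \<delta>" by (subst (asm) pos_le_divide_eq) auto
    then have df: "d * \<bar>f0\<bar> \<le> \<delta> / 2" using d by (simp add: algebra_simps)
    \<comment> \<open>The two triangle errors cost at most 5 \<delta>' \<eta>^2 / A(k), which is the
      remaining half, \<delta> \<eta> / (2 A(k)), times d \<eta>.\<close>
    define \<delta>' where "\<delta>' = d * \<delta> / 10"
    have \<delta>': "\<delta>' > 0" using d \<delta> by (simp add: \<delta>'_def)
    have "\<forall>\<^sub>F k in sequentially. \<forall>\<eta> y. 0 < \<eta> \<longrightarrow> \<eta> \<le> 1 / 2 \<longrightarrow> \<bar>y\<bar> \<le> 1 \<longrightarrow>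
       \<bar>measure (walk_law D \<nu> k) {w. \<bar>w - y\<bar> < \<eta>} - 2 * \<eta> * f0 / A k\<bar> \<le> \<delta> * \<eta> / A k + 3 / d * \<rho> ^ k"
      using \<rho>(3)[OF \<delta>']
    proof eventually_elim
      case (elim k)
      show ?case
      proof safe
        fix \<eta> y :: real assume \<eta>: "0 < \<eta>" "\<eta> \<le> 1 / 2" and y: "\<bar>y\<bar> \<le> 1"
        interpret L: real_distribution "walk_law D \<nu> k" by (rule real_distribution_walk_law[OF D nu])
        define T where "T r = (\<integral>w. max 0 (r - \<bar>w - y\<bar>) \<partial>walk_law D \<nu> k)" for r
        define P where "P = measure (walk_law D \<nu> k) {w. \<bar>w - y\<bar> < \<eta>}"
        define a where "a = 1 / A k"
        have a: "a > 0" using A_pos by (simp add: a_def)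
        have pk: "\<rho> ^ k > 0" using \<rho> by simp
        have T: "\<bar>T r - r\<^sup>2 * f0 * a\<bar> \<le> \<delta>' * r\<^sup>2 * a + r * \<rho> ^ k" if "0 < r" "r \<le> 1" for r
          using elim that y by (auto simp: T_def f0_def a_def)
        have Ti: "integrable (walk_law D \<nu> k) (\<lambda>w. max 0 (r - \<bar>w - y\<bar>))" for r
          by (rule L.integrable_const_bound[where B = "\<bar>r\<bar>"]) auto
        have [measurable]: "{w. \<bar>w - y\<bar> < \<eta>} \<in> sets borel" by measurable
        have P: "P = (\<integral>w. indicator {w. \<bar>w - y\<bar> < \<eta>} w \<partial>walk_law D \<nu> k)"
          by (simp add: P_def)
        have up: "P * (d * \<eta>) \<le> T (\<eta> * (1 + d)) - T \<eta>"
        proof -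
          have "P * (d * \<eta>) = (\<integral>w. indicator {w. \<bar>w - y\<bar> < \<eta>} w * (d * \<eta>) \<partial>walk_law D \<nu> k)"
            by (simp add: P)
          also have "\<dots> \<le> (\<integral>w. max 0 (\<eta> * (1 + d) - \<bar>w - y\<bar>) - max 0 (\<eta> - \<bar>w - y\<bar>) \<partial>walk_law D \<nu> k)"
          proof (rule integral_mono)
            fix w
            have "0 < \<eta> * d" using \<eta> d by simp
            then show "indicator {w. \<bar>w - y\<bar> < \<eta>} w * (d * \<eta>) \<le> max 0 (\<eta> * (1 + d) - \<bar>w - y\<bar>) - max 0 (\<eta> - \<bar>w - y\<bar>)"
              by (auto simp: indicator_def ring_distribs mult.commute max_def)
          qed (use Ti in \<open>auto intro!: integrable_real_indicator simp: less_top[symmetric]\<close>)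
          also have "\<dots> = T (\<eta> * (1 + d)) - T \<eta>" using Ti by (simp add: T_def)
          finally show ?thesis .
        qed
        have lo: "T \<eta> - T (\<eta> * (1 - d)) \<le> P * (d * \<eta>)"
        proof -
          have "T \<eta> - T (\<eta> * (1 - d)) = (\<integral>w. max 0 (\<eta> - \<bar>w - y\<bar>) - max 0 (\<eta> * (1 - d) - \<bar>w - y\<bar>) \<partial>walk_law D \<nu> k)"
            using Ti by (simp add: T_def)
          also have "\<dots> \<le> (\<integral>w. indicator {w. \<bar>w - y\<bar> < \<eta>} w * (d * \<eta>) \<partial>walk_law D \<nu> k)"
          proof (rule integral_mono)
            fix w
            have "0 < \<eta> * d" using \<eta> d by simp
            then show "max 0 (\<eta> - \<bar>w - y\<bar>) - max 0 (\<eta> * (1 - d) - \<bar>w - y\<bar>) \<le> indicator {w. \<bar>w - y\<bar> < \<eta>} w * (d * \<eta>)"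
              by (auto simp: indicator_def ring_distribs mult.commute max_def)
          qed (use Ti in \<open>auto intro!: integrable_real_indicator simp: less_top[symmetric]\<close>)
          also have "\<dots> = P * (d * \<eta>)" by (simp add: P)
          finally show ?thesis .
        qed
        have rr: "0 < \<eta> * (1 + d)" "\<eta> * (1 + d) \<le> 1" "0 < \<eta> * (1 - d)" "\<eta> * (1 - d) \<le> 1"
          using \<eta> d mult_mono[of \<eta> "1/2" "1 + d" 2] mult_mono[of \<eta> "1/2" "1 - d" 1] by auto
        have dd: "(1 + d)\<^sup>2 + 1 \<le> 5" "(1 - d)\<^sup>2 + 1 \<le> 5"
          using d power_mono[of "1 + d" 2 2] power_mono[of "1 - d" 1 2] by auto
        have fa: "\<bar>\<eta>\<^sup>2 * d\<^sup>2 * f0 * a\<bar> \<le> \<eta>\<^sup>2 * d * (\<delta> / 2) * a"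
        proof -
          have "\<eta>\<^sup>2 * d * a * (d * \<bar>f0\<bar>) \<le> \<eta>\<^sup>2 * d * a * (\<delta> / 2)"
            using df d a by (intro mult_left_mono) auto
          also have "\<eta>\<^sup>2 * d * a * (d * \<bar>f0\<bar>) = \<bar>\<eta>\<^sup>2 * d\<^sup>2 * f0 * a\<bar>"
            using a by (simp add: abs_mult power2_eq_square mult_ac)
          finally show ?thesis by (simp add: mult_ac)
        qed
        have fin: "(\<delta> * \<eta> * a + 3 / d * \<rho> ^ k) * (d * \<eta>) = \<eta>\<^sup>2 * d * (\<delta> / 2) * a + \<delta>' * 5 * \<eta>\<^sup>2 * a + 3 * \<eta> * \<rho> ^ k"
          using d by (simp add: \<delta>'_def power2_eq_square field_simps)
        have e1: "\<delta>' * \<eta>\<^sup>2 * a * ((1 + d)\<^sup>2 + 1) \<le> \<delta>' * \<eta>\<^sup>2 * a * 5"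
             "\<delta>' * \<eta>\<^sup>2 * a * ((1 - d)\<^sup>2 + 1) \<le> \<delta>' * \<eta>\<^sup>2 * a * 5"
          using dd \<delta>' a by (auto intro!: mult_left_mono)
        have e2: "\<eta> * (2 + d) * \<rho> ^ k \<le> 3 * \<eta> * \<rho> ^ k" "\<eta> * (2 - d) * \<rho> ^ k \<le> 3 * \<eta> * \<rho> ^ k"
          using d \<eta> pk by (auto intro!: mult_right_mono)
        have "(P - 2 * \<eta> * f0 * a) * (d * \<eta>) \<le> (\<delta> * \<eta> * a + 3 / d * \<rho> ^ k) * (d * \<eta>)"
        proof -
          have "T (\<eta> * (1 + d)) - T \<eta> \<le> ((\<eta> * (1 + d))\<^sup>2 - \<eta>\<^sup>2) * f0 * a + \<delta>' * \<eta>\<^sup>2 * a * ((1 + d)\<^sup>2 + 1) + \<eta> * (2 + d) * \<rho> ^ k"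
          proof -
            have "\<delta>' * (\<eta> * (1 + d))\<^sup>2 * a + \<delta>' * \<eta>\<^sup>2 * a = \<delta>' * \<eta>\<^sup>2 * a * ((1 + d)\<^sup>2 + 1)"
              unfolding power_mult_distrib by (simp add: distrib_left[of _ "(1 + d)\<^sup>2"])
            moreover have "\<eta> * (1 + d) * \<rho> ^ k + \<eta> * \<rho> ^ k = \<eta> * (2 + d) * \<rho> ^ k" by (simp add: ring_distribs)
            moreover have "((\<eta> * (1 + d))\<^sup>2 - \<eta>\<^sup>2) * f0 * a = (\<eta> * (1 + d))\<^sup>2 * f0 * a - \<eta>\<^sup>2 * f0 * a"
              by (simp only: left_diff_distrib)
            ultimately show ?thesis using T[OF rr(1,2)] T[of \<eta>] \<eta> unfolding abs_le_iff by linarith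
          qed
          moreover have "((\<eta> * (1 + d))\<^sup>2 - \<eta>\<^sup>2) * f0 * a = 2 * \<eta> * f0 * a * (d * \<eta>) + \<eta>\<^sup>2 * d\<^sup>2 * f0 * a"
            by (simp add: power2_eq_square algebra_simps)
          ultimately show ?thesis
            using up fa e1(1) e2(1) unfolding fin abs_le_iff left_diff_distrib by (simp only: mult_ac) linarith
        qed
        then have u: "P - 2 * \<eta> * f0 * a \<le> \<delta> * \<eta> * a + 3 / d * \<rho> ^ k" using d \<eta> by (simp add: mult_le_cancel_right)
        have "(2 * \<eta> * f0 * a - P) * (d * \<eta>) \<le> (\<delta> * \<eta> * a + 3 / d * \<rho> ^ k) * (d * \<eta>)"
        proof -
          have "T \<eta> - T (\<eta> * (1 - d)) \<ge> (\<eta>\<^sup>2 - (\<eta> * (1 - d))\<^sup>2) * f0 * a - \<delta>' * \<eta>\<^sup>2 * a * ((1 - d)\<^sup>2 + 1) - \<eta> * (2 - d) * \<rho> ^ k"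
          proof -
            have "\<delta>' * (\<eta> * (1 - d))\<^sup>2 * a + \<delta>' * \<eta>\<^sup>2 * a = \<delta>' * \<eta>\<^sup>2 * a * ((1 - d)\<^sup>2 + 1)"
              unfolding power_mult_distrib by (simp add: distrib_left[of _ "(1 - d)\<^sup>2"])
            moreover have "\<eta> * (1 - d) * \<rho> ^ k + \<eta> * \<rho> ^ k = \<eta> * (2 - d) * \<rho> ^ k" by (simp add: ring_distribs)
            moreover have "(\<eta>\<^sup>2 - (\<eta> * (1 - d))\<^sup>2) * f0 * a = \<eta>\<^sup>2 * f0 * a - (\<eta> * (1 - d))\<^sup>2 * f0 * a"
              by (simp only: left_diff_distrib)
            ultimately show ?thesis using T[OF rr(3,4)] T[of \<eta>] \<eta> unfolding abs_le_iff by linarith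
          qed
          moreover have "(\<eta>\<^sup>2 - (\<eta> * (1 - d))\<^sup>2) * f0 * a = 2 * \<eta> * f0 * a * (d * \<eta>) - \<eta>\<^sup>2 * d\<^sup>2 * f0 * a"
            by (simp add: power2_eq_square algebra_simps)
          ultimately show ?thesis
            using lo fa e1(2) e2(2) unfolding fin abs_le_iff left_diff_distrib by (simp only: mult_ac) linarith
        qed
        then have l: "2 * \<eta> * f0 * a - P \<le> \<delta> * \<eta> * a + 3 / d * \<rho> ^ k" using d \<eta> by (simp add: mult_le_cancel_right)
        from u l show "\<bar>P - 2 * \<eta> * f0 / A k\<bar> \<le> \<delta> * \<eta> / A k + 3 / d * \<rho> ^ k"
          by (simp add: a_def abs_le_iff)
      qed
    qed
    then show "\<exists>C\<ge>0. \<forall>\<^sub>F k in sequentially. \<forall>\<eta> y. 0 < \<eta> \<longrightarrow> \<eta> \<le> 1 / 2 \<longrightarrow> \<bar>y\<bar> \<le> 1 \<longrightarrow>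
       \<bar>measure (walk_law D \<nu> k) {w. \<bar>w - y\<bar> < \<eta>} - 2 * \<eta> * local_density / A k\<bar> \<le> \<delta> * \<eta> / A k + C * \<rho> ^ k"
      unfolding f0_def using d by (intro exI[of _ "3 / d"]) simp
  qed
qed

end

subsection \<open>Last-exit decomposition\<close>

text \<open>Only the times 1 to \<open>n\<close> are tested, not the start: for \<open>y\<close> in
  \<open>B\<close> this is the probability that a visit at \<open>y\<close> is followed by
  \<open>n\<close> steps without another.\<close>

primrec avoid :: "real measure \<Rightarrow> real set \<Rightarrow> nat \<Rightarrow> real \<Rightarrow> real" where
  "avoid D B 0 y = 1"
| "avoid D B (Suc n) y = (\<integral>x. indicator (- B) (y + x) * avoid D B n (y + x) \<partial>D)"

context real_distribution
begin

lemma avoid_measurable [measurable]: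
  assumes [measurable]: "B \<in> sets borel"
  shows "avoid M B n \<in> borel_measurable borel"
  by (induction n) (auto intro!: borel_measurable_lebesgue_integral simp: case_prod_unfold)

lemma avoid_bounds:
  assumes [measurable]: "B \<in> sets borel"
  shows "0 \<le> avoid M B n y \<and> avoid M B n y \<le> 1"
proof (induction n arbitrary: y)
  case (Suc n)
  then show ?case
    by (auto intro!: integral_nonneg_AE integral_le_const integrable_const_bound[where B = 1] simp: indicator_def)
qed simp

lemma avoid_nonneg: "B \<in> sets borel \<Longrightarrow> 0 \<le> avoid M B n y"
  and avoid_le_1: "B \<in> sets borel \<Longrightarrow> avoid M B n y \<le> 1"
  using avoid_bounds by auto

lemma avoid_integrable:
  assumes [measurable]: "B \<in> sets borel" "C \<in> sets borel"
  shows "integrable M (\<lambda>x. indicator C (y + x) * avoid M B n (y + x))"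
  using avoid_bounds[of B n] by (auto intro!: integrable_const_bound[where B = 1] simp: indicator_def)

lemma avoid_decreasing:
  assumes B: "B \<in> sets borel"
  shows "avoid M B (Suc n) y \<le> avoid M B n y"
proof (induction n arbitrary: y)
  case 0 then show ?case using avoid_le_1[OF B, of "Suc 0" y] by simp
next
  case (Suc n)
  show ?case unfolding avoid.simps(2)[of M B "Suc n" y] avoid.simps(2)[of M B n y]
    using B Suc by (intro integral_mono mult_left_mono avoid_integrable) (auto simp del: avoid.simps)
qed

lemma avoid_antimono: "B \<in> sets borel \<Longrightarrow> m \<le> n \<Longrightarrow> avoid M B n y \<le> avoid M B m y"
  by (rule lift_Suc_antimono_le[of "\<lambda>n. avoid M B n y"]) (auto intro: avoid_decreasing simp del: avoid.simps)

text \<open>Run both walks with the same steps: whenever the one from \<open>y\<close> is in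
  \<open>B\<close>, the shifted one is in \<open>B'\<close>.\<close>

lemma avoid_shift_mono:
  assumes B: "B \<in> sets borel" "B' \<in> sets borel" and sub: "\<And>u. u \<in> B \<Longrightarrow> u + z \<in> B'"
  shows "avoid M B' n (y + z) \<le> avoid M B n y"
proof (induction n arbitrary: y)
  case (Suc n)
  show ?case unfolding avoid.simps
  proof (intro integral_mono mult_mono)
    fix x
    show "indicator (- B') (y + z + x) \<le> (indicator (- B) (y + x) :: real)"
      using sub[of "y + x"] by (auto simp: indicator_def add_ac)
    show "avoid M B' n (y + z + x) \<le> avoid M B n (y + x)"
      using Suc[of "y + x"] by (simp add: add_ac)
  qed (use B avoid_nonneg in \<open>auto intro!: avoid_integrable\<close>)
qed simp

text \<open>In the proof \<open>a k\<close> is the probability of no visit at times k + 1 to n.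
  Passing to k + 1 adds exactly the event that the last visit happens at time k + 1, so the sum
  telescopes to \<open>a n\<close>, which is 1.\<close>

lemma last_exit_decomposition:
  assumes nu: "real_distribution \<nu>" and [measurable]: "B \<in> sets borel"
  shows "(\<integral>y. avoid M B n y \<partial>\<nu>)
    + (\<Sum>k=1..n. \<integral>y. indicator B y * avoid M B (n - k) y \<partial>walk_law M \<nu> k) = 1"
proof -
  have D: "real_distribution M" ..
  define a where "a k = (\<integral>y. avoid M B (n - k) y \<partial>walk_law M \<nu> k)" for k
  have step: "a k + (\<integral>y. indicator B y * avoid M B (n - Suc k) y \<partial>walk_law M \<nu> (Suc k)) = a (Suc k)" if "k < n" for k
  proof -
    interpret L: real_distribution "walk_law M \<nu> (Suc k)" by (rule real_distribution_walk_law[OF D nu])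
    have nk: "n - k = Suc (n - Suc k)" using that by simp
    have i: "integrable (walk_law M \<nu> (Suc k)) (\<lambda>y. indicator C y * avoid M B (n - Suc k) y)" if [measurable]: "C \<in> sets borel" for C
      using avoid_bounds[of B "n - Suc k"]
      by (intro L.integrable_const_bound[where B = 1]) (auto simp: indicator_def simp del: walk_law.simps)
    have "a k = (\<integral>y. \<integral>x. indicator (- B) (y + x) * avoid M B (n - Suc k) (y + x) \<partial>M \<partial>walk_law M \<nu> k)"
      unfolding a_def nk by (intro Bochner_Integration.integral_cong refl avoid.simps(2))
    also have "\<dots> = (\<integral>y. indicator (- B) y * avoid M B (n - Suc k) y \<partial>walk_law M \<nu> (Suc k))"
      unfolding walk_law.simps using avoid_bounds[of B "n - Suc k"]
      by (intro integral_convolution[symmetric, where B = 1] real_distribution_walk_law D nu) (auto simp: indicator_def)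
    finally have "a k + (\<integral>y. indicator B y * avoid M B (n - Suc k) y \<partial>walk_law M \<nu> (Suc k)) =
      (\<integral>y. indicator (- B) y * avoid M B (n - Suc k) y + indicator B y * avoid M B (n - Suc k) y \<partial>walk_law M \<nu> (Suc k))"
      using i by (simp del: walk_law.simps)
    also have "\<dots> = a (Suc k)"
      unfolding a_def by (intro Bochner_Integration.integral_cong) (auto simp: indicator_def)
    finally show ?thesis .
  qed
  have "a 0 + (\<Sum>k=1..j. \<integral>y. indicator B y * avoid M B (n - k) y \<partial>walk_law M \<nu> k) = a j" if "j \<le> n" for j
    using that
  proof (induction j)
    case (Suc j)
    then show ?case using step[of j] by (simp del: walk_law.simps)
  qed simp
  from this[of n] interpret L: real_distribution "walk_law M \<nu> n" by (intro real_distribution_walk_law[OF D nu])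
  show ?thesis using \<open>\<And>j. j \<le> n \<Longrightarrow> a 0 + _ j = a j\<close>[of n] L.prob_space by (simp add: a_def)
qed

end

section \<open>Uniform perturbation of the start\<close>

definition unif :: "real \<Rightarrow> real measure" where
  "unif \<eta> = density lborel (\<lambda>z. ennreal (indicator {-\<eta><..<\<eta>} z / (2 * \<eta>)))"

lemma integral_unif:
  fixes f :: "real \<Rightarrow> real"
  assumes "\<eta> > 0" and [measurable]: "f \<in> borel_measurable borel"
  shows "(\<integral>z. f z \<partial>unif \<eta>) = (\<integral>z. indicator {-\<eta><..<\<eta>} z * f z \<partial>lborel) / (2 * \<eta>)"
proof -
  have "(\<integral>z. f z \<partial>unif \<eta>) = (\<integral>z. indicator {-\<eta><..<\<eta>} z / (2 * \<eta>) * f z \<partial>lborel)"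
    unfolding unif_def using assms by (subst integral_density) auto
  also have "\<dots> = (\<integral>z. indicator {-\<eta><..<\<eta>} z * f z / (2 * \<eta>) \<partial>lborel)"
    by simp
  finally show ?thesis by simp
qed

lemma real_distribution_unif:
  assumes "\<eta> > 0"
  shows "real_distribution (unif \<eta>)"
proof -
  have "emeasure (unif \<eta>) (space (unif \<eta>)) = (\<integral>\<^sup>+z. ennreal (indicator {-\<eta><..<\<eta>} z / (2 * \<eta>)) \<partial>lborel)"
    unfolding unif_def by (subst emeasure_density) (auto intro!: nn_integral_cong)
  also have "\<dots> = ennreal (\<integral>z. indicator {-\<eta><..<\<eta>} z / (2 * \<eta>) \<partial>lborel)"
    using assms by (intro nn_integral_eq_integral) (auto intro!: integrable_divide integrable_real_indicator)
  also have "\<dots> = 1" using assms by simp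
  finally have "prob_space (unif \<eta>)" by (rule prob_spaceI)
  then show ?thesis
    unfolding real_distribution_def real_distribution_axioms_def by (auto simp: unif_def)
qed

text \<open>Convolutions commute, so perturbing the start amounts to perturbing the position at time
  \<open>k\<close>, which is the form needed to exhibit a density at that time.\<close>

lemma walk_law_convolution:
  assumes "real_distribution D" "real_distribution \<nu>" "real_distribution U"
  shows "walk_law D (convolution \<nu> U) k = convolution (walk_law D \<nu> k) U"
proof (induction k)
  case (Suc k)
  interpret D: real_distribution D by fact
  interpret U: real_distribution U by fact
  interpret L: real_distribution "walk_law D \<nu> k" by (rule real_distribution_walk_law) fact+
  have fin: "finite_measure D" "finite_measure U" "finite_measure (walk_law D \<nu> k)"
    by (rule D.finite_measure_axioms U.finite_measure_axioms L.finite_measure_axioms)+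
  have "walk_law D (convolution \<nu> U) (Suc k) = convolution (convolution (walk_law D \<nu> k) U) D"
    by (simp add: Suc)
  also have "\<dots> = convolution (walk_law D \<nu> k) (convolution U D)"
    using fin by (intro convolution_associative[symmetric]) auto
  also have "convolution U D = convolution D U" using fin by (intro convolution_commutative) auto
  also have "convolution (walk_law D \<nu> k) (convolution D U) = convolution (convolution (walk_law D \<nu> k) D) U"
    using fin by (intro convolution_associative) auto
  finally show ?case by simp
qed simp

text \<open>At \<open>y\<close>, the density of \<open>M\<close> convolved with the uniform law is
  the mass of the interval of radius \<eta> around \<open>y\<close> divided by 2 \<eta>, the very
  quantity that \<open>interval_local_limit\<close> estimates.\<close>

lemma (in real_distribution) integral_convolution_unif:
  fixes F :: "real \<Rightarrow> real"
  assumes \<eta>: "\<eta> > 0" and r: "r > 0" and [measurable]: "F \<in> borel_measurable borel"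
    and F: "\<And>y. 0 \<le> F y" "\<And>y. F y \<le> 1"
  shows "(\<integral>y. indicator {-r<..<r} y * F y \<partial>convolution M (unif \<eta>)) =
    (\<integral>y. indicator {-r<..<r} y * F y * measure M {w. \<bar>w - y\<bar> < \<eta>} \<partial>lborel) / (2 * \<eta>)"
proof -
  have D: "real_distribution M" ..
  interpret P: pair_sigma_finite lborel M ..
  define H where "H y = indicator {-r<..<r} y * F y" for y
  have [measurable]: "H \<in> borel_measurable borel" unfolding H_def by measurable
  have H: "0 \<le> H y" "H y \<le> 1" "H y \<le> indicator {-r<..<r} y" for y using F by (auto simp: H_def indicator_def)
  define g where "g y w = H y * indicator {w. \<bar>w - y\<bar> < \<eta>} w" for y w
  have meas [measurable]: "(\<lambda>(y, w). g y w) \<in> borel_measurable (lborel \<Otimes>\<^sub>M M)"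
    unfolding g_def indicator_def by measurable
  have [measurable]: "(\<lambda>w. g y w) \<in> borel_measurable borel" "(\<lambda>y. g y w) \<in> borel_measurable borel" for y w
    unfolding g_def indicator_def by measurable
  have g: "0 \<le> g y w" "g y w \<le> H y" "g y w \<le> 1" for y w using H[of y] by (auto simp: g_def indicator_def)
  have iw: "integrable M (g y)" for y
    using g by (intro integrable_const_bound[where B = 1]) auto
  have gi: "(\<integral>w. g y w \<partial>M) = H y * measure M {w. \<bar>w - y\<bar> < \<eta>}" for y
    unfolding g_def by simp
  have int: "integrable (lborel \<Otimes>\<^sub>M M) (\<lambda>(y, w). g y w)"
  proof (rule P.Fubini_integrable[OF meas])
    have "integrable lborel (\<lambda>y. H y * measure M {w. \<bar>w - y\<bar> < \<eta>})"
    proof (rule Bochner_Integration.integrable_bound)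
      show "integrable lborel (indicator {-r<..<r} :: real \<Rightarrow> real)"
        using r by (intro integrable_real_indicator) auto
      show "AE y in lborel. norm (H y * measure M {w. \<bar>w - y\<bar> < \<eta>}) \<le> norm (indicator {-r<..<r} y :: real)"
      proof (rule AE_I2)
        fix y
        have "H y * measure M {w. \<bar>w - y\<bar> < \<eta>} \<le> indicator {-r<..<r} y * 1"
          using H[of y] prob_le_1 by (intro mult_mono) auto
        then show "norm (H y * measure M {w. \<bar>w - y\<bar> < \<eta>}) \<le> norm (indicator {-r<..<r} y :: real)"
          using H[of y] by (simp add: abs_mult)
      qed
      have "(\<lambda>y. \<integral>w. g y w \<partial>M) \<in> borel_measurable lborel"
        using meas by (intro borel_measurable_lebesgue_integral) simp
      then show "(\<lambda>y. H y * measure M {w. \<bar>w - y\<bar> < \<eta>}) \<in> borel_measurable lborel" unfolding gi .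
    qed
    then show "integrable lborel (\<lambda>y. \<integral>w. norm (case (y, w) of (y, w) \<Rightarrow> g y w) \<partial>M)"
      using g by (simp add: gi)
  qed (use iw in auto)
  have "(\<integral>y. H y \<partial>convolution M (unif \<eta>)) = (\<integral>w. \<integral>z. H (w + z) \<partial>unif \<eta> \<partial>M)"
    using H by (intro integral_convolution[where B = 1] D real_distribution_unif \<eta>) auto
  also have "(\<lambda>w. \<integral>z. H (w + z) \<partial>unif \<eta>) = (\<lambda>w. (\<integral>y. g y w \<partial>lborel) / (2 * \<eta>))"
  proof
    fix w
    have "(\<integral>y. g y w \<partial>lborel) = (\<integral>z. g (w + 1 * z) w \<partial>lborel)"
      using lborel_integral_real_affine[of 1 "\<lambda>y. g y w" w] by simp
    also have "\<dots> = (\<integral>z. indicator {-\<eta><..<\<eta>} z * H (w + z) \<partial>lborel)"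
      by (intro Bochner_Integration.integral_cong) (auto simp: g_def indicator_def)
    finally show "(\<integral>z. H (w + z) \<partial>unif \<eta>) = (\<integral>y. g y w \<partial>lborel) / (2 * \<eta>)"
      using \<eta> by (subst integral_unif) auto
  qed
  also have "(\<integral>w. (\<integral>y. g y w \<partial>lborel) / (2 * \<eta>) \<partial>M) = (\<integral>w. \<integral>y. g y w \<partial>lborel \<partial>M) / (2 * \<eta>)"
    by simp
  also have "(\<integral>w. \<integral>y. g y w \<partial>lborel \<partial>M) = (\<integral>y. \<integral>w. g y w \<partial>M \<partial>lborel)"
    using int by (rule P.Fubini_integral)
  finally show ?thesis unfolding gi by (simp add: H_def)
qed

subsection \<open>Smeared starting points\<close>

text \<open>The numerators up to some \<open>N\<close> contribute a bounded amount, which the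
  diverging denominator swamps; beyond \<open>N\<close> each one is at most e/2 times its
  weight.\<close>

lemma stolz_cesaro_0:
  fixes b c :: "nat \<Rightarrow> real"
  assumes b: "\<And>k. b k > 0" and lim: "(\<lambda>k. c k / b k) \<longlonglongrightarrow> 0"
    and top: "filterlim (\<lambda>n. \<Sum>k=1..n. b k) at_top sequentially"
  shows "(\<lambda>n. (\<Sum>k=1..n. c k) / (\<Sum>k=1..n. b k)) \<longlonglongrightarrow> 0"
proof (rule LIMSEQ_I)
  fix e :: real assume e: "e > 0"
  have "\<forall>\<^sub>F k in sequentially. \<bar>c k / b k\<bar> < e / 2"
    using order_tendstoD(2)[OF tendsto_rabs_zero[OF lim], of "e / 2"] e by simp
  then obtain N where N: "\<And>k. k \<ge> N \<Longrightarrow> \<bar>c k\<bar> \<le> e / 2 * b k"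
    using b by (force simp: eventually_sequentially abs_divide divide_less_eq abs_of_pos intro: less_imp_le)
  define C where "C = (\<Sum>k=1..N. \<bar>c k\<bar>)"
  have le: "\<bar>\<Sum>k=1..n. c k\<bar> \<le> C + e / 2 * (\<Sum>k=1..n. b k)" for n
  proof -
    have "\<bar>\<Sum>k=1..n. c k\<bar> \<le> (\<Sum>k=1..n. \<bar>c k\<bar>)" by (rule sum_abs)
    also have "\<dots> \<le> (\<Sum>k=1..n. (if k \<le> N then \<bar>c k\<bar> else 0) + e / 2 * b k)"
      using N b e by (intro sum_mono) (auto simp: less_imp_le)
    also have "\<dots> = (\<Sum>k=1..n. if k \<le> N then \<bar>c k\<bar> else 0) + e / 2 * (\<Sum>k=1..n. b k)"
      by (simp add: sum.distrib sum_distrib_left)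
    also have "(\<Sum>k=1..n. if k \<le> N then \<bar>c k\<bar> else 0) = (\<Sum>k\<in>{1..n} \<inter> {k. k \<le> N}. \<bar>c k\<bar>)"
      by (simp add: sum.inter_restrict)
    also have "\<dots> \<le> C" unfolding C_def by (intro sum_mono2) auto
    finally show ?thesis by simp
  qed
  have "\<forall>\<^sub>F n in sequentially. (\<Sum>k=1..n. b k) > max 0 (2 * C / e)"
    using top[unfolded filterlim_at_top_dense] by blast
  then have "\<forall>\<^sub>F n in sequentially. norm ((\<Sum>k=1..n. c k) / (\<Sum>k=1..n. b k)) < e"
  proof eventually_elim
    case (elim n)
    define B where "B = (\<Sum>k=1..n. b k)"
    have B: "B > 0" "2 * C < e * B" using elim e by (auto simp: B_def field_simps)
    have "\<bar>\<Sum>k=1..n. c k\<bar> < e * B" using le[of n] B by (simp add: B_def)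
    then show ?case unfolding B_def[symmetric] real_norm_def abs_divide using B by (simp add: divide_less_eq)
  qed
  then show "\<exists>N. \<forall>n\<ge>N. norm ((\<Sum>k=1..n. c k) / (\<Sum>k=1..n. b k) - 0) < e"
    by (simp add: eventually_sequentially)
qed

text \<open>The centre is removed because an atom there survives the limit and is counted
  separately.\<close>

lemma (in real_distribution) punctured_interval_tendsto_0:
  "((\<lambda>s. measure M {w. 0 < \<bar>w\<bar> \<and> \<bar>w\<bar> < s}) \<longlongrightarrow> 0) (at_right 0)"
proof (rule tendsto_at_right_sequentially[of 0 1])
  fix S :: "nat \<Rightarrow> real" assume S: "\<And>n. 0 < S n" "decseq S" "S \<longlonglongrightarrow> 0"
  have "(\<lambda>n. measure M {w. 0 < \<bar>w\<bar> \<and> \<bar>w\<bar> < S n}) \<longlonglongrightarrow> measure M (\<Inter>n. {w. 0 < \<bar>w\<bar> \<and> \<bar>w\<bar> < S n})"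
  proof (rule finite_Lim_measure_decseq)
    show "decseq (\<lambda>n. {w. 0 < \<bar>w\<bar> \<and> \<bar>w\<bar> < S n})"
      using S(2) by (fastforce simp: decseq_def)
  qed auto
  moreover have "(\<Inter>n. {w. 0 < \<bar>w\<bar> \<and> \<bar>w\<bar> < S n}) = {}"
  proof safe
    fix w assume w: "w \<in> (\<Inter>n. {w. 0 < \<bar>w\<bar> \<and> \<bar>w\<bar> < S n})"
    then have "0 < \<bar>w\<bar>" by auto
    then have "\<forall>\<^sub>F n in sequentially. S n < \<bar>w\<bar>" by (rule order_tendstoD(2)[OF S(3)])
    then obtain n where "S n < \<bar>w\<bar>" by (auto simp: eventually_sequentially)
    moreover have "\<bar>w\<bar> < S n" using w by blast
    ultimately show "w \<in> {}" by simp
  qed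
  ultimately show "(\<lambda>n. measure M {w. 0 < \<bar>w\<bar> \<and> \<bar>w\<bar> < S n}) \<longlonglongrightarrow> 0" by simp
qed simp

text \<open>The walk started from \<open>\<nu> \<star> unif \<eta>\<close> avoiding the interval of radius \<open>r\<close>; the uniform
  perturbation gives the law at time \<open>k\<close> a density, which the local limit theorem controls.\<close>

definition smeared_avoid :: "real measure \<Rightarrow> real measure \<Rightarrow> real \<Rightarrow> real \<Rightarrow> nat \<Rightarrow> real" where
  "smeared_avoid D \<nu> r \<eta> n = (\<integral>y. avoid D {-r<..<r} n y \<partial>convolution \<nu> (unif \<eta>))"

text \<open>In the renewal identity \<eta> \<le> r, so the start lies inside the interval and this
  describes the walk right after a visit: q for \<eta> = a \<epsilon>, and Q for \<eta> = r.\<close>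

definition unif_avoid :: "real measure \<Rightarrow> real \<Rightarrow> real \<Rightarrow> nat \<Rightarrow> real" where
  "unif_avoid D r \<eta> n = (\<integral>y. avoid D {-r<..<r} n y \<partial>unif \<eta>)"

text \<open>A visit at time \<open>k\<close> followed by \<open>m\<close> steps without one. The two
  times are separate parameters so that the remaining time n - k can be replaced by n.\<close>

definition visit_term :: "real measure \<Rightarrow> real measure \<Rightarrow> real \<Rightarrow> real \<Rightarrow> nat \<Rightarrow> nat \<Rightarrow> real" where
  "visit_term D \<nu> r \<eta> k m =
    (\<integral>y. indicator {-r<..<r} y * avoid D {-r<..<r} m y \<partial>convolution (walk_law D \<nu> k) (unif \<eta>))"

text \<open>For a start at the centre the probability of no visit is itself one of the unknowns q
  and Q, which makes the renewal identity solvable.\<close>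

lemma smeared_avoid_return_0:
  assumes D: "real_distribution D" and \<eta>: "\<eta> > 0"
  shows "smeared_avoid D (return borel 0) r \<eta> n = unif_avoid D r \<eta> n"
proof -
  interpret D: real_distribution D by (rule D)
  have R: "real_distribution (return borel (0::real))"
    unfolding real_distribution_def real_distribution_axioms_def by (simp add: prob_space_return)
  interpret U: real_distribution "unif \<eta>" by (rule real_distribution_unif[OF \<eta>])
  have "smeared_avoid D (return borel 0) r \<eta> n = (\<integral>x. \<integral>y. avoid D {-r<..<r} n (x + y) \<partial>unif \<eta> \<partial>return borel 0)"
    unfolding smeared_avoid_def using D.avoid_bounds[of "{-r<..<r}" n]
    by (intro integral_convolution[where B = 1] R U.real_distribution_axioms) auto
  also have "\<dots> = unif_avoid D r \<eta> n"
    unfolding unif_avoid_def by (subst integral_return) (auto intro!: U.borel_measurable_lebesgue_integral simp: case_prod_unfold)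
  finally show ?thesis .
qed

context real_distribution
begin

context
  fixes \<nu> :: "real measure" and r \<eta> :: real
  assumes nu: "real_distribution \<nu>" and r: "r > 0" and \<eta>: "\<eta> > 0"
begin

private abbreviation "I \<equiv> {-r<..<r}"

lemma real_distribution_smeared: "real_distribution (convolution (walk_law M \<nu> k) (unif \<eta>))"
  by (intro real_distribution_convolution real_distribution_walk_law nu real_distribution_unif \<eta> real_distribution_axioms)

lemma visit_term_integrable:
  "integrable (convolution (walk_law M \<nu> k) (unif \<eta>)) (\<lambda>y. indicator I y * avoid M I m y)"
proof -
  interpret C: real_distribution "convolution (walk_law M \<nu> k) (unif \<eta>)" by (rule real_distribution_smeared)
  show ?thesis using avoid_bounds[of I m]
    by (intro C.integrable_const_bound[where B = 1]) (auto simp: indicator_def)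
qed

lemma visit_term_antimono: "m \<le> m' \<Longrightarrow> visit_term M \<nu> r \<eta> k m' \<le> visit_term M \<nu> r \<eta> k m"
  unfolding visit_term_def
  by (intro integral_mono visit_term_integrable mult_left_mono avoid_antimono) auto

lemma smeared_renewal: "smeared_avoid M \<nu> r \<eta> n + (\<Sum>k=1..n. visit_term M \<nu> r \<eta> k (n - k)) = 1"
  using last_exit_decomposition[of "convolution \<nu> (unif \<eta>)" I n]
    real_distribution_convolution[OF nu real_distribution_unif[OF \<eta>]]
    walk_law_convolution[OF real_distribution_axioms nu real_distribution_unif[OF \<eta>]]
  by (simp add: smeared_avoid_def visit_term_def)

lemma smeared_avoid_antimono: "m \<le> m' \<Longrightarrow> smeared_avoid M \<nu> r \<eta> m' \<le> smeared_avoid M \<nu> r \<eta> m"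
proof -
  interpret C: real_distribution "convolution (walk_law M \<nu> 0) (unif \<eta>)" by (rule real_distribution_smeared)
  show "m \<le> m' \<Longrightarrow> smeared_avoid M \<nu> r \<eta> m' \<le> smeared_avoid M \<nu> r \<eta> m"
    unfolding smeared_avoid_def using avoid_bounds[of I]
    by (intro integral_mono avoid_antimono C.integrable_const_bound[where B = 1, simplified]) auto
qed

text \<open>Lengthening the remaining time from n - k to n only lowers the visit terms.\<close>

lemma smeared_renewal_lower: "smeared_avoid M \<nu> r \<eta> n + (\<Sum>k=1..n. visit_term M \<nu> r \<eta> k n) \<le> 1"
proof -
  have "(\<Sum>k=1..n. visit_term M \<nu> r \<eta> k n) \<le> (\<Sum>k=1..n. visit_term M \<nu> r \<eta> k (n - k))"
    by (intro sum_mono visit_term_antimono) auto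
  then show ?thesis using smeared_renewal[of n] by simp
qed

text \<open>Running the walk up to time \<open>2n\<close> leaves at least \<open>n\<close> steps after every visit before time \<open>n\<close>.\<close>

lemma smeared_renewal_upper:
  "1 \<le> smeared_avoid M \<nu> r \<eta> n + (\<Sum>k=1..n. visit_term M \<nu> r \<eta> k n) + (\<Sum>k=Suc n..2*n. visit_term M \<nu> r \<eta> k 0)"
proof -
  have split: "{1..2*n} = {1..n} \<union> {Suc n..2*n}" by auto
  have "1 = smeared_avoid M \<nu> r \<eta> (2*n) + (\<Sum>k=1..2*n. visit_term M \<nu> r \<eta> k (2*n - k))"
    using smeared_renewal[of "2*n"] by simp
  also have "\<dots> = smeared_avoid M \<nu> r \<eta> (2*n) + (\<Sum>k=1..n. visit_term M \<nu> r \<eta> k (2*n - k)) + (\<Sum>k=Suc n..2*n. visit_term M \<nu> r \<eta> k (2*n - k))"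
    unfolding split by (subst sum.union_disjoint) auto
  also have "\<dots> \<le> smeared_avoid M \<nu> r \<eta> n + (\<Sum>k=1..n. visit_term M \<nu> r \<eta> k n) + (\<Sum>k=Suc n..2*n. visit_term M \<nu> r \<eta> k 0)"
    by (intro add_mono sum_mono visit_term_antimono smeared_avoid_antimono) auto
  finally show ?thesis .
qed

text \<open>The estimate for bounded times. A walk exactly at 0 is spread uniformly over (-\<eta>,
  \<eta>), which lies in the interval as \<eta> \<le> r, and gives the atom term. Any other position
  from which the perturbation can reach the interval has modulus below r + \<eta>.\<close>

lemma visit_term_atom:
  assumes "\<eta> \<le> r"
  shows "measure (walk_law M \<nu> k) {0} * unif_avoid M r \<eta> m \<le> visit_term M \<nu> r \<eta> k m"
    and "visit_term M \<nu> r \<eta> k m \<le> measure (walk_law M \<nu> k) {0} * unif_avoid M r \<eta> m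
      + measure (walk_law M \<nu> k) {w. 0 < \<bar>w\<bar> \<and> \<bar>w\<bar> < r + \<eta>}"
proof -
  interpret L: real_distribution "walk_law M \<nu> k" by (rule real_distribution_walk_law[OF real_distribution_axioms nu])
  interpret U: real_distribution "unif \<eta>" by (rule real_distribution_unif[OF \<eta>])
  define H where "H y = indicator I y * avoid M I m y" for y
  have [measurable]: "H \<in> borel_measurable borel" unfolding H_def by measurable
  have H: "0 \<le> H y" "H y \<le> 1" for y using avoid_bounds[of I m] by (auto simp: H_def indicator_def)
  define F where "F w = (\<integral>z. H (w + z) \<partial>unif \<eta>)" for w
  have [measurable]: "F \<in> borel_measurable borel"
    unfolding F_def by (intro U.borel_measurable_lebesgue_integral) (simp add: case_prod_unfold)
  have iH: "integrable (unif \<eta>) (\<lambda>z. H (w + z))" for w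
    using H by (intro U.integrable_const_bound[where B = 1]) auto
  have F01: "0 \<le> F w" "F w \<le> 1" for w
    unfolding F_def using H iH by (auto intro!: integral_nonneg_AE U.integral_le_const)
  have Fu: "F w = (\<integral>z. indicator {-\<eta><..<\<eta>} z * H (w + z) \<partial>lborel) / (2 * \<eta>)" for w
    unfolding F_def by (rule integral_unif[OF \<eta>]) measurable
  have F0: "F 0 = unif_avoid M r \<eta> m"
  proof -
    have "unif_avoid M r \<eta> m = (\<integral>z. indicator {-\<eta><..<\<eta>} z * avoid M I m z \<partial>lborel) / (2 * \<eta>)"
      unfolding unif_avoid_def by (rule integral_unif[OF \<eta>]) simp
    also have "(\<lambda>z. indicator {-\<eta><..<\<eta>} z * avoid M I m z) = (\<lambda>z. indicator {-\<eta><..<\<eta>} z * H (0 + z))"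
      using assms by (auto simp: H_def indicator_def)
    finally show ?thesis unfolding Fu ..
  qed
  have Fz: "F w = 0" if "r + \<eta> \<le> \<bar>w\<bar>" for w
  proof -
    have "w + z \<notin> I" if "z \<in> {-\<eta><..<\<eta>}" for z
      using that \<open>r + \<eta> \<le> \<bar>w\<bar>\<close> by (auto simp: abs_if split: if_splits)
    then have "indicator {-\<eta><..<\<eta>} z * H (w + z) = 0" for z
      by (cases "z \<in> {-\<eta><..<\<eta>}") (auto simp: H_def)
    then show ?thesis unfolding Fu by (simp only: integral_zero div_0)
  qed
  have vt: "visit_term M \<nu> r \<eta> k m = (\<integral>w. F w \<partial>walk_law M \<nu> k)"
    unfolding visit_term_def H_def[symmetric] F_def using H
    by (intro integral_convolution[where B = 1] L.real_distribution_axioms U.real_distribution_axioms) auto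
  have iF: "integrable (walk_law M \<nu> k) F"
    using F01 by (intro L.integrable_const_bound[where B = 1]) auto
  have ii: "integrable (walk_law M \<nu> k) (\<lambda>w. indicator {0} w * F 0)"
     "integrable (walk_law M \<nu> k) (indicator {w. 0 < \<bar>w\<bar> \<and> \<bar>w\<bar> < r + \<eta>} :: real \<Rightarrow> real)"
    by (auto intro!: integrable_real_indicator simp: less_top[symmetric])
  have "measure (walk_law M \<nu> k) {0} * F 0 = (\<integral>w. indicator {0} w * F 0 \<partial>walk_law M \<nu> k)" by simp
  also have "\<dots> \<le> (\<integral>w. F w \<partial>walk_law M \<nu> k)"
    using ii iF F01 by (intro integral_mono) (auto simp: indicator_def)
  finally show "measure (walk_law M \<nu> k) {0} * unif_avoid M r \<eta> m \<le> visit_term M \<nu> r \<eta> k m"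
    unfolding vt F0 .
  have "(\<integral>w. F w \<partial>walk_law M \<nu> k) \<le> (\<integral>w. indicator {0} w * F 0 + indicator {w. 0 < \<bar>w\<bar> \<and> \<bar>w\<bar> < r + \<eta>} w \<partial>walk_law M \<nu> k)"
  proof (rule integral_mono)
    show "F w \<le> indicator {0} w * F 0 + indicator {w. 0 < \<bar>w\<bar> \<and> \<bar>w\<bar> < r + \<eta>} w" for w
      using F01 Fz[of w] by (auto simp: indicator_def)
  qed (rule iF, rule Bochner_Integration.integrable_add[OF ii])
  also have "\<dots> = measure (walk_law M \<nu> k) {0} * F 0 + measure (walk_law M \<nu> k) {w. 0 < \<bar>w\<bar> \<and> \<bar>w\<bar> < r + \<eta>}"
    using ii by simp
  finally show "visit_term M \<nu> r \<eta> k m \<le> measure (walk_law M \<nu> k) {0} * unif_avoid M r \<eta> m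
      + measure (walk_law M \<nu> k) {w. 0 < \<bar>w\<bar> \<and> \<bar>w\<bar> < r + \<eta>}"
    unfolding vt F0 .
qed

text \<open>The estimate for large times, with f(0) / A(k) as \<open>h\<close>. The density of the
  perturbed walk is nearly \<open>h\<close> throughout the interval, so the place of the visit is
  nearly uniform on (-r, r), whatever the perturbation radius.\<close>

lemma visit_term_density:
  assumes E: "\<And>y. \<bar>y\<bar> < r \<Longrightarrow> \<bar>measure (walk_law M \<nu> k) {w. \<bar>w - y\<bar> < \<eta>} - 2 * \<eta> * h\<bar> \<le> E"
  shows "\<bar>visit_term M \<nu> r \<eta> k m - 2 * r * h * unif_avoid M r r m\<bar> \<le> r / \<eta> * E"
proof -
  interpret L: real_distribution "walk_law M \<nu> k" by (rule real_distribution_walk_law[OF real_distribution_axioms nu])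
  define p where "p y = measure (walk_law M \<nu> k) {w. \<bar>w - y\<bar> < \<eta>}" for y
  have "p = (\<lambda>y. \<integral>w. indicator {w. \<bar>w - y\<bar> < \<eta>} w \<partial>walk_law M \<nu> k)"
    unfolding p_def by simp
  also have "\<dots> \<in> borel_measurable borel"
    by (intro L.borel_measurable_lebesgue_integral) (simp add: case_prod_unfold indicator_def)
  finally have [measurable]: "p \<in> borel_measurable borel" .
  have p: "0 \<le> p y" "p y \<le> 1" for y by (auto simp: p_def)
  have E0: "E \<ge> 0" using E[of 0] r by force
  have iI: "integrable lborel (indicator I :: real \<Rightarrow> real)" using r by (intro integrable_real_indicator) auto
  have bdd: "integrable lborel (\<lambda>y. indicator I y * avoid M I m y * g y)"
    if [measurable]: "g \<in> borel_measurable borel" and g: "\<And>y. \<bar>g y\<bar> \<le> 1" for g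
  proof (rule Bochner_Integration.integrable_bound[OF iI])
    show "AE y in lborel. norm (indicator I y * avoid M I m y * g y) \<le> norm (indicator I y :: real)"
    proof (rule AE_I2)
      fix y
      have "\<bar>avoid M I m y * g y\<bar> \<le> 1 * 1" unfolding abs_mult
        using avoid_bounds[of I m y] g[of y] by (intro mult_mono) auto
      then show "norm (indicator I y * avoid M I m y * g y) \<le> norm (indicator I y :: real)"
        by (auto simp: indicator_def)
    qed
  qed simp
  have q: "2 * r * unif_avoid M r r m = (\<integral>y. indicator I y * avoid M I m y * 1 \<partial>lborel)"
    unfolding unif_avoid_def using r by (subst integral_unif) auto
  have "2 * \<eta> * visit_term M \<nu> r \<eta> k m = (\<integral>y. indicator I y * avoid M I m y * p y \<partial>lborel)"
    unfolding visit_term_def p_def using \<eta> r avoid_bounds[of I m]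
    by (subst L.integral_convolution_unif) auto
  then have "2 * \<eta> * (visit_term M \<nu> r \<eta> k m - 2 * r * h * unif_avoid M r r m)
     = (\<integral>y. indicator I y * avoid M I m y * p y \<partial>lborel) - 2 * \<eta> * h * (\<integral>y. indicator I y * avoid M I m y * 1 \<partial>lborel)"
    unfolding q[symmetric] by (simp add: algebra_simps)
  also have "\<dots> = (\<integral>y. indicator I y * avoid M I m y * p y - 2 * \<eta> * h * (indicator I y * avoid M I m y * 1) \<partial>lborel)"
    using bdd[of p] bdd[of "\<lambda>_. 1"] p by simp
  finally have eq: "2 * \<eta> * (visit_term M \<nu> r \<eta> k m - 2 * r * h * unif_avoid M r r m) =
     (\<integral>y. indicator I y * avoid M I m y * p y - 2 * \<eta> * h * (indicator I y * avoid M I m y * 1) \<partial>lborel)" .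
  have "\<bar>2 * \<eta> * (visit_term M \<nu> r \<eta> k m - 2 * r * h * unif_avoid M r r m)\<bar> \<le>
     (\<integral>y. \<bar>indicator I y * avoid M I m y * p y - 2 * \<eta> * h * (indicator I y * avoid M I m y * 1)\<bar> \<partial>lborel)"
    unfolding eq by (rule integral_abs_bound)
  also have "\<dots> \<le> (\<integral>y. indicator I y * E \<partial>lborel)"
  proof (rule integral_mono)
    fix y
    show "\<bar>indicator I y * avoid M I m y * p y - 2 * \<eta> * h * (indicator I y * avoid M I m y * 1)\<bar> \<le> indicator I y * E"
    proof (cases "y \<in> I")
      case True
      then have "\<bar>p y - 2 * \<eta> * h\<bar> \<le> E" using E[of y] by (auto simp: p_def)
      then have "avoid M I m y * \<bar>p y - 2 * \<eta> * h\<bar> \<le> 1 * E"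
        using avoid_bounds[of I m y] by (intro mult_mono) auto
      moreover have "avoid M I m y * p y - 2 * \<eta> * h * avoid M I m y = avoid M I m y * (p y - 2 * \<eta> * h)"
        by (simp add: algebra_simps)
      ultimately show ?thesis using True avoid_bounds[of I m y] by (simp add: abs_mult)
    qed simp
  qed (use bdd[of p] bdd[of "\<lambda>_. 1"] p iI in auto)
  also have "\<dots> = 2 * r * E" using r by simp
  finally have "2 * \<eta> * \<bar>visit_term M \<nu> r \<eta> k m - 2 * r * h * unif_avoid M r r m\<bar> \<le> 2 * r * E"
    using \<eta> by (simp add: abs_mult)
  then show ?thesis using \<eta> by (simp add: field_simps)
qed

lemma unif_avoid_bounds: "0 \<le> unif_avoid M r \<eta> m" "unif_avoid M r \<eta> m \<le> 1"
proof -
  interpret U: real_distribution "unif \<eta>" by (rule real_distribution_unif[OF \<eta>])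
  have "integrable (unif \<eta>) (avoid M I m)"
    using avoid_bounds[of I m] by (intro U.integrable_const_bound[where B = 1]) auto
  then show "0 \<le> unif_avoid M r \<eta> m" "unif_avoid M r \<eta> m \<le> 1"
    unfolding unif_avoid_def using avoid_bounds[of I m]
    by (auto intro!: integral_nonneg_AE U.integral_le_const)
qed

end

end

lemma real_distribution_return: "real_distribution (return borel (x::real))"
  unfolding real_distribution_def real_distribution_axioms_def by (simp add: prob_space_return)

section \<open>Norming sums and the limiting renewal identity\<close>

context cauchy_domain
begin

definition G :: "nat \<Rightarrow> real" where
  "G n = (\<Sum>k=1..n. 1 / A k)"

lemma G_nonneg: "0 \<le> G n"
  unfolding G_def using A_pos by (auto intro!: sum_nonneg simp: less_imp_le)

text \<open>G(2n) - G(n) is the sum of the \<open>c k\<close>, which compare 1/A(2k-1) + 1/A(2k)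
  with 1/A(k). By \<open>A_ratio\<close> both members of the pair are asymptotic to 1/(2 A(k)), so
  \<open>c k\<close> is o(1/A(k)), and Stolz-Cesaro applies.\<close>

lemma G_double:
  assumes top: "filterlim G at_top sequentially"
  shows "(\<lambda>n. (G (2 * n) - G n) / G n) \<longlonglongrightarrow> 0"
proof -
  define c where "c k = 1 / A (2 * k - 1) + 1 / A (2 * k) - 1 / A k" for k
  have eq: "G (2 * n) - G n = (\<Sum>k=1..n. c k)" for n
    by (induction n) (auto simp: G_def c_def)
  have r: "(\<lambda>n. A (m n) / A n) \<longlonglongrightarrow> 2"
    if "filterlim m at_top sequentially" "(\<lambda>n. real (m n) / real n) \<longlonglongrightarrow> 2" for m
    using that by (intro A_ratio) auto
  have 1: "(\<lambda>k. A (2 * k) / A k) \<longlonglongrightarrow> 2" by (intro r; real_asymp)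
  have 2: "(\<lambda>k. A (2 * k - 1) / A k) \<longlonglongrightarrow> 2"
  proof (rule r)
    show "filterlim (\<lambda>n::nat. 2 * n - 1) at_top sequentially"
    proof (rule filterlim_at_top_mono[OF filterlim_ident])
      show "\<forall>\<^sub>F n::nat in sequentially. n \<le> 2 * n - 1"
        using eventually_ge_at_top[of 1] by eventually_elim simp
    qed
    have "\<forall>\<^sub>F n in sequentially. (2 * real n - 1) / real n = real (2 * n - 1) / real n"
      using eventually_ge_at_top[of 1] by eventually_elim (simp add: of_nat_diff)
    moreover have "(\<lambda>n. (2 * real n - 1) / real n) \<longlonglongrightarrow> 2" by real_asymp
    ultimately show "(\<lambda>n. real (2 * n - 1) / real n) \<longlonglongrightarrow> 2" by (rule Lim_transform_eventually[rotated])
  qed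
  have "(\<lambda>k. 1 / (A (2 * k - 1) / A k) + 1 / (A (2 * k) / A k) - 1) \<longlonglongrightarrow> 1 / 2 + 1 / 2 - 1"
    by (intro tendsto_intros 1 2) auto
  moreover have "1 / (A (2 * k - 1) / A k) + 1 / (A (2 * k) / A k) - 1 = c k / (1 / A k)" for k
    using A_pos[of k] by (simp add: c_def ring_distribs)
  ultimately have "(\<lambda>k. c k / (1 / A k)) \<longlonglongrightarrow> 0" by simp
  then have "(\<lambda>n. (\<Sum>k=1..n. c k) / (\<Sum>k=1..n. 1 / A k)) \<longlonglongrightarrow> 0"
    using A_pos top by (intro stolz_cesaro_0) (auto simp: G_def[abs_def])
  then show ?thesis unfolding eq unfolding G_def .
qed

text \<open>If the 1/A(k) were summable, the local limit theorem with \<eta> = 1/2 would make the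
  probabilities of (-1/2, 1/2) summable as well. Recurrence provides the hypothesis
  \<open>ns\<close> through Borel-Cantelli.\<close>

lemma G_at_top:
  assumes nu: "real_distribution \<nu>"
    and ns: "\<not> summable (\<lambda>k. measure (walk_law D \<nu> k) {w. \<bar>w\<bar> < 1 / 2})"
  shows "filterlim G at_top sequentially"
proof -
  obtain \<rho> where \<rho>: "0 < \<rho>" "\<rho> < 1"
    "\<And>\<delta>. \<delta> > 0 \<Longrightarrow> \<exists>C\<ge>0. \<forall>\<^sub>F k in sequentially. \<forall>\<eta> y. 0 < \<eta> \<longrightarrow> \<eta> \<le> 1 / 2 \<longrightarrow> \<bar>y\<bar> \<le> 1 \<longrightarrow>
       \<bar>measure (walk_law D \<nu> k) {w. \<bar>w - y\<bar> < \<eta>} - 2 * \<eta> * local_density / A k\<bar> \<le> \<delta> * \<eta> / A k + C * \<rho> ^ k"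
    by (rule interval_local_limit[OF nu]) blast
  from \<rho>(3)[of 2] obtain C where C: "\<forall>\<^sub>F k in sequentially. \<forall>\<eta> y. 0 < \<eta> \<longrightarrow> \<eta> \<le> 1 / 2 \<longrightarrow> \<bar>y\<bar> \<le> 1 \<longrightarrow>
       \<bar>measure (walk_law D \<nu> k) {w. \<bar>w - y\<bar> < \<eta>} - 2 * \<eta> * local_density / A k\<bar> \<le> 2 * \<eta> / A k + C * \<rho> ^ k"
    by auto
  have "\<not> summable (\<lambda>k. 1 / A k)"
  proof
    assume s: "summable (\<lambda>k. 1 / A k)"
    have "summable (\<lambda>k. (local_density + 1) * (1 / A k) + C * \<rho> ^ k)"
      using s \<rho> by (intro summable_add summable_mult summable_geometric) auto
    moreover have "\<forall>\<^sub>F k in sequentially. norm (measure (walk_law D \<nu> k) {w. \<bar>w\<bar> < 1 / 2}) \<le> (local_density + 1) * (1 / A k) + C * \<rho> ^ k"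
      using C
    proof eventually_elim
      case (elim k)
      from elim[rule_format, of "1/2" 0]
      have "\<bar>measure (walk_law D \<nu> k) {w. \<bar>w\<bar> < 1 / 2} - local_density / A k\<bar> \<le> 1 / A k + C * \<rho> ^ k" by simp
      moreover have "(local_density + 1) * (1 / A k) = local_density / A k + 1 / A k" by (simp add: add_divide_distrib)
      ultimately show ?case unfolding real_norm_def abs_of_nonneg[OF measure_nonneg] by linarith
    qed
    ultimately have "summable (\<lambda>k. measure (walk_law D \<nu> k) {w. \<bar>w\<bar> < 1 / 2})"
      by (rule summable_comparison_test_ev[rotated])
    with ns show False ..
  qed
  then have ns': "\<not> summable (\<lambda>k. 1 / A (Suc k))" by (subst summable_Suc_iff)
  have "G = (\<lambda>n. \<Sum>k<n. 1 / A (Suc k))"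
    unfolding G_def by (simp add: sum.atLeast1_atMost_eq)
  moreover have "filterlim (\<lambda>n. \<Sum>k<n. 1 / A (Suc k)) at_top sequentially"
  proof -
    have "\<not> bdd_above (range (\<lambda>n. \<Sum>k<n. 1 / A (Suc k)))"
    proof
      assume "bdd_above (range (\<lambda>n. \<Sum>k<n. 1 / A (Suc k)))"
      then obtain B where B: "\<And>n. (\<Sum>k<n. 1 / A (Suc k)) \<le> B" by (auto simp: bdd_above_def)
      have "summable (\<lambda>k. 1 / A (Suc k))"
      proof (rule bounded_imp_summable)
        show "(\<Sum>k\<le>n. 1 / A (Suc k)) \<le> B" for n
          using B[of "Suc n"] by (simp only: lessThan_Suc_atMost)
      qed (use A_pos in \<open>simp add: less_imp_le\<close>)
      with ns' show False ..
    qed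
    then have unb: "\<exists>n. (\<Sum>k<n. 1 / A (Suc k)) > Z" for Z by (auto simp: bdd_above_def not_le)
    show ?thesis
      unfolding filterlim_at_top
    proof
      fix Z
      from unb[of Z] obtain n where n: "(\<Sum>k<n. 1 / A (Suc k)) > Z" by auto
      show "\<forall>\<^sub>F n in sequentially. Z \<le> (\<Sum>k<n. 1 / A (Suc k))"
        using eventually_ge_at_top[of n]
      proof eventually_elim
        case (elim m)
        have "(\<Sum>k<n. 1 / A (Suc k)) \<le> (\<Sum>k<m. 1 / A (Suc k))"
          using elim A_pos by (intro sum_mono2) (auto simp: less_imp_le)
        with n show ?case by simp
      qed
    qed
  qed
  ultimately show ?thesis by simp
qed

text \<open>Letting the interval shrink to its centre removes everything from the local limit
  theorem except the geometric error, which therefore bounds the atom.\<close>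

lemma atoms_summable:
  assumes nu: "real_distribution \<nu>"
  shows "summable (\<lambda>k. measure (walk_law D \<nu> k) {0})"
proof -
  obtain \<rho> where \<rho>: "0 < \<rho>" "\<rho> < 1"
    "\<And>\<delta>. \<delta> > 0 \<Longrightarrow> \<exists>C\<ge>0. \<forall>\<^sub>F k in sequentially. \<forall>\<eta> y. 0 < \<eta> \<longrightarrow> \<eta> \<le> 1 / 2 \<longrightarrow> \<bar>y\<bar> \<le> 1 \<longrightarrow>
       \<bar>measure (walk_law D \<nu> k) {w. \<bar>w - y\<bar> < \<eta>} - 2 * \<eta> * local_density / A k\<bar> \<le> \<delta> * \<eta> / A k + C * \<rho> ^ k"
    by (rule interval_local_limit[OF nu]) blast
  from \<rho>(3)[of 1] obtain C where C: "\<forall>\<^sub>F k in sequentially. \<forall>\<eta> y. 0 < \<eta> \<longrightarrow> \<eta> \<le> 1 / 2 \<longrightarrow> \<bar>y\<bar> \<le> 1 \<longrightarrow>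
       \<bar>measure (walk_law D \<nu> k) {w. \<bar>w - y\<bar> < \<eta>} - 2 * \<eta> * local_density / A k\<bar> \<le> 1 * \<eta> / A k + C * \<rho> ^ k"
    by auto
  have "\<forall>\<^sub>F k in sequentially. norm (measure (walk_law D \<nu> k) {0}) \<le> C * \<rho> ^ k"
    using C
  proof eventually_elim
    case (elim k)
    interpret L: real_distribution "walk_law D \<nu> k" by (rule real_distribution_walk_law[OF real_distribution_axioms nu])
    have "((\<lambda>\<eta>. \<eta> * (2 * local_density / A k + 1 / A k) + C * \<rho> ^ k) \<longlongrightarrow> 0 * (2 * local_density / A k + 1 / A k) + C * \<rho> ^ k) (at_right 0)"
      by (intro tendsto_intros)
    moreover have "\<forall>\<^sub>F \<eta> in at_right 0. measure (walk_law D \<nu> k) {0} \<le> \<eta> * (2 * local_density / A k + 1 / A k) + C * \<rho> ^ k"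
      unfolding eventually_at_right_field
    proof (intro exI[of _ "1/2"] conjI allI impI)
      fix \<eta> :: real assume \<eta>: "0 < \<eta>" "\<eta> < 1 / 2"
      have "measure (walk_law D \<nu> k) {0} \<le> measure (walk_law D \<nu> k) {w. \<bar>w\<bar> < \<eta>}"
        using \<eta> by (intro L.finite_measure_mono) auto
      also have "\<dots> \<le> \<eta> * (2 * local_density / A k + 1 / A k) + C * \<rho> ^ k"
        using elim[rule_format, of \<eta> 0] \<eta> by (simp add: abs_le_iff algebra_simps)
      finally show "measure (walk_law D \<nu> k) {0} \<le> \<eta> * (2 * local_density / A k + 1 / A k) + C * \<rho> ^ k" .
    qed simp
    ultimately have "measure (walk_law D \<nu> k) {0} \<le> 0 * (2 * local_density / A k + 1 / A k) + C * \<rho> ^ k"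
      by (intro tendsto_lowerbound[where F = "at_right (0::real)"]) auto
    then show ?case by simp
  qed
  then show ?thesis
    by (rule summable_comparison_test_ev) (use \<rho>(1,2) in \<open>intro summable_mult summable_geometric, simp\<close>)
qed

text \<open>Visits up to a time \<open>J\<close> are governed by the atoms, those from
  \<open>J\<close> to n by the local limit theorem, and those from n to 2n are negligible by
  \<open>G_double\<close>. \<open>J\<close> depends on the tolerance alone and is fixed before
  \<epsilon> tends to 0.\<close>

lemma smeared_renewal_limit:
  assumes nu: "real_distribution \<nu>" and ab: "0 < a" "a \<le> b"
    and f0: "local_density \<ge> 0" and Gtop: "filterlim G at_top sequentially"
    and N: "filterlim N sequentially (at_right 0)"
    and lim: "((\<lambda>\<epsilon>. \<epsilon> * G (N \<epsilon>)) \<longlongrightarrow> s) (at_right 0)"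
  shows "((\<lambda>\<epsilon>. smeared_avoid D \<nu> (b * \<epsilon>) (a * \<epsilon>) (N \<epsilon>)
      + (\<Sum>k. measure (walk_law D \<nu> (Suc k)) {0}) * unif_avoid D (b * \<epsilon>) (a * \<epsilon>) (N \<epsilon>)
      + 2 * b * local_density * (\<epsilon> * G (N \<epsilon>)) * unif_avoid D (b * \<epsilon>) (b * \<epsilon>) (N \<epsilon>)) \<longlongrightarrow> 1) (at_right 0)"
proof (rule tendstoI)
  fix e :: real assume e: "e > 0"
  define e' where "e' = e / 10"
  have e': "e' > 0" using e by (simp add: e'_def)
  have D: "real_distribution D" ..
  define f where "f = local_density"
  define p where "p k = measure (walk_law D \<nu> k) {0}" for k
  define \<alpha> where "\<alpha> = (\<Sum>k. p (Suc k))"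
  have p0: "p k \<ge> 0" for k by (simp add: p_def)
  have psum: "summable p" using atoms_summable[OF nu] by (simp add: p_def[abs_def])
  then have psum': "summable (\<lambda>k. p (Suc k))" by (simp add: summable_Suc_iff)
  define K where "K = \<bar>s\<bar> + 1"
  have K: "K > 0" by (simp add: K_def add_nonneg_pos)
  \<comment> \<open>Keeps the accumulated relative error r \<delta> G(n) below \<open>e'\<close>,
    since \<epsilon> G(n) is eventually less than \<open>K\<close>.\<close>
  define \<delta> where "\<delta> = e' / (b * K)"
  have \<delta>: "\<delta> > 0" using e' ab K by (simp add: \<delta>_def)
  obtain \<rho> where \<rho>: "0 < \<rho>" "\<rho> < 1"
    "\<And>\<delta>. \<delta> > 0 \<Longrightarrow> \<exists>C\<ge>0. \<forall>\<^sub>F k in sequentially. \<forall>\<eta> y. 0 < \<eta> \<longrightarrow> \<eta> \<le> 1 / 2 \<longrightarrow> \<bar>y\<bar> \<le> 1 \<longrightarrow>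
       \<bar>measure (walk_law D \<nu> k) {w. \<bar>w - y\<bar> < \<eta>} - 2 * \<eta> * local_density / A k\<bar> \<le> \<delta> * \<eta> / A k + C * \<rho> ^ k"
    by (rule interval_local_limit[OF nu]) blast
  from \<rho>(3)[OF \<delta>] obtain C J1 where C: "C \<ge> 0" and J1: "\<And>k \<eta> y. k \<ge> J1 \<Longrightarrow> 0 < \<eta> \<Longrightarrow> \<eta> \<le> 1 / 2 \<Longrightarrow> \<bar>y\<bar> \<le> 1 \<Longrightarrow>
       \<bar>measure (walk_law D \<nu> k) {w. \<bar>w - y\<bar> < \<eta>} - 2 * \<eta> * f / A k\<bar> \<le> \<delta> * \<eta> / A k + C * \<rho> ^ k"
    unfolding eventually_sequentially f_def by blast
  \<comment> \<open>The factor b / a is r / \<eta>. Both radii are proportional to \<epsilon>, so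
    \<open>w\<close> does not involve \<epsilon> and its tail is small uniformly.\<close>
  define w where "w k = b / a * C * \<rho> ^ k" for k
  have w0: "w k \<ge> 0" for k using ab C \<rho> by (simp add: w_def)
  have wsum: "summable w" unfolding w_def using \<rho> by (intro summable_mult summable_geometric) simp
  have "summable (\<lambda>k. w k + p k)" using wsum psum by (rule summable_add)
  from summable_Cauchy[THEN iffD1, OF this, rule_format, OF e']
  obtain J2 where J2: "\<And>m n. m \<ge> J2 \<Longrightarrow> norm (sum (\<lambda>k. w k + p k) {m..<n}) < e'" by blast
  define J where "J = max J1 J2"
  have tail: "(\<Sum>k=Suc J..n. w k) \<le> e'" "(\<Sum>k=Suc J..n. p k) \<le> e'" for n
  proof -
    have "(\<Sum>k=Suc J..n. w k + p k) \<le> e'"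
    proof -
      have "J2 \<le> Suc J" by (simp add: J_def)
      from J2[OF this, of "Suc n"] show ?thesis
        unfolding atLeastLessThanSuc_atLeastAtMost real_norm_def by linarith
    qed
    moreover have "(\<Sum>k=Suc J..n. w k) \<ge> 0" "(\<Sum>k=Suc J..n. p k) \<ge> 0" using w0 p0 by (auto intro: sum_nonneg)
    ultimately show "(\<Sum>k=Suc J..n. w k) \<le> e'" "(\<Sum>k=Suc J..n. p k) \<le> e'" by (auto simp: sum.distrib)
  qed
  have wtail: "(\<Sum>k=Suc n..m. w k) \<le> e'" if "n \<ge> J" for n m
    by (rule order_trans[OF _ tail(1)[of m]]) (use that w0 in \<open>auto intro!: sum_mono2\<close>)
  have \<alpha>1: "(\<Sum>k=1..J. p k) \<le> \<alpha>"
  proof -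
    have "(\<Sum>k=1..J. p k) = (\<Sum>k<J. p (Suc k))" by (simp add: sum.atLeast1_atMost_eq)
    also have "\<dots> \<le> \<alpha>" unfolding \<alpha>_def using psum' p0 by (intro sum_le_suminf) auto
    finally show ?thesis .
  qed
  have \<alpha>2: "\<alpha> \<le> (\<Sum>k=1..J. p k) + e'"
    unfolding \<alpha>_def
  proof (rule suminf_le_const[OF psum'])
    fix n
    have "(\<Sum>k<n. p (Suc k)) = (\<Sum>k=1..n. p k)" by (simp add: sum.atLeast1_atMost_eq)
    also have "\<dots> \<le> (\<Sum>k\<in>{1..J} \<union> {Suc J..n}. p k)" using p0 by (intro sum_mono2) auto
    also have "\<dots> = (\<Sum>k=1..J. p k) + (\<Sum>k=Suc J..n. p k)" by (subst sum.union_disjoint) auto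
    finally show "(\<Sum>k<n. p (Suc k)) \<le> (\<Sum>k=1..J. p k) + e'" using tail(2)[of n] by simp
  qed
  define sm where "sm \<epsilon> = (\<Sum>k=1..J. measure (walk_law D \<nu> k) {w. 0 < \<bar>w\<bar> \<and> \<bar>w\<bar> < b * \<epsilon> + a * \<epsilon>})" for \<epsilon>
  have "(sm \<longlongrightarrow> (\<Sum>k=1..J. 0)) (at_right 0)"
    unfolding sm_def
  proof (intro tendsto_sum)
    fix k
    interpret L: real_distribution "walk_law D \<nu> k" by (rule real_distribution_walk_law[OF D nu])
    have "filterlim (\<lambda>\<epsilon>. b * \<epsilon> + a * \<epsilon>) (at_right 0) (at_right 0)"
      using ab by real_asymp
    from filterlim_compose[OF L.punctured_interval_tendsto_0 this]
    show "((\<lambda>\<epsilon>. measure (walk_law D \<nu> k) {w. 0 < \<bar>w\<bar> \<and> \<bar>w\<bar> < b * \<epsilon> + a * \<epsilon>}) \<longlongrightarrow> 0) (at_right 0)" .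
  qed
  then have ev1: "\<forall>\<^sub>F \<epsilon> in at_right 0. sm \<epsilon> < e'" using e' order_tendstoD(2)[of sm 0 "at_right 0" e'] by simp
  have "((\<lambda>\<epsilon>. 2 * b * f * G J * \<epsilon>) \<longlongrightarrow> 2 * b * f * G J * 0) (at_right 0)" by (intro tendsto_intros)
  then have ev2: "\<forall>\<^sub>F \<epsilon> in at_right 0. 2 * b * f * G J * \<epsilon> < e'" using e' by (intro order_tendstoD(2)[of _ 0]) auto
  have ev3: "\<forall>\<^sub>F \<epsilon> in at_right 0. \<epsilon> * G (N \<epsilon>) < K"
    using lim by (rule order_tendstoD) (simp add: K_def)
  have ev4: "\<forall>\<^sub>F \<epsilon> in at_right 0. J \<le> N \<epsilon>" using N by (auto simp: filterlim_at_top)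
  \<comment> \<open>The cost of the times between n and 2n: a convergent factor times the relative
    growth of \<open>G\<close>, which tends to 0.\<close>
  have "((\<lambda>\<epsilon>. b * (2 * f + \<delta>) * (\<epsilon> * G (N \<epsilon>)) * ((G (2 * N \<epsilon>) - G (N \<epsilon>)) / G (N \<epsilon>))) \<longlongrightarrow> b * (2 * f + \<delta>) * s * 0) (at_right 0)"
    by (intro tendsto_intros lim filterlim_compose[OF G_double[OF Gtop] N])
  then have ev5: "\<forall>\<^sub>F \<epsilon> in at_right 0. b * (2 * f + \<delta>) * (\<epsilon> * G (N \<epsilon>)) * ((G (2 * N \<epsilon>) - G (N \<epsilon>)) / G (N \<epsilon>)) < e'"
    using e' by (intro order_tendstoD(2)[of _ 0]) auto
  have ev6: "\<forall>\<^sub>F \<epsilon> in at_right 0. G (N \<epsilon>) > 0"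
    using filterlim_compose[OF Gtop N] by (auto simp: filterlim_at_top_dense)
  have ev7: "\<forall>\<^sub>F \<epsilon> in at_right 0. 0 < \<epsilon> \<and> \<epsilon> < 1 / (2 * b)"
    using ab by (auto simp: eventually_at_right_field intro!: exI[of _ "1 / (2 * b)"])
  show "\<forall>\<^sub>F \<epsilon> in at_right 0. dist (smeared_avoid D \<nu> (b * \<epsilon>) (a * \<epsilon>) (N \<epsilon>)
      + (\<Sum>k. measure (walk_law D \<nu> (Suc k)) {0}) * unif_avoid D (b * \<epsilon>) (a * \<epsilon>) (N \<epsilon>)
      + 2 * b * local_density * (\<epsilon> * G (N \<epsilon>)) * unif_avoid D (b * \<epsilon>) (b * \<epsilon>) (N \<epsilon>)) 1 < e"
    using ev1 ev2 ev3 ev4 ev5 ev6 ev7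
  proof eventually_elim
    case (elim \<epsilon>)
    define r where "r = b * \<epsilon>"
    define \<eta> where "\<eta> = a * \<epsilon>"
    define n where "n = N \<epsilon>"
    define g where "g = G n"
    have \<epsilon>: "0 < \<epsilon>" "\<epsilon> < 1 / (2 * b)" using elim by auto
    have r: "r > 0" "r \<le> 1 / 2" using \<epsilon> ab by (auto simp: r_def field_simps)
    have "\<eta> > 0" "\<eta> \<le> r" using \<epsilon> ab by (auto simp: r_def \<eta>_def)
    with r have \<eta>: "\<eta> > 0" "\<eta> \<le> r" "\<eta> \<le> 1 / 2" by linarith+
    have nJ: "J \<le> n" using elim by (simp add: n_def)
    define q where "q = unif_avoid D r \<eta> n"
    define Q where "Q = unif_avoid D r r n"
    have q: "0 \<le> q" "q \<le> 1" and Q: "0 \<le> Q" "Q \<le> 1"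
      using unif_avoid_bounds[OF nu r(1) \<eta>(1)] unif_avoid_bounds[OF nu r(1) r(1)] by (auto simp: q_def Q_def)
    define T where "T k m = visit_term D \<nu> r \<eta> k m" for k m
    have dens: "\<bar>T k m - 2 * r * (f / A k) * unif_avoid D r r m\<bar> \<le> r * \<delta> * (1 / A k) + w k" if "k > J" for k m
    proof -
      have "\<bar>T k m - 2 * r * (f / A k) * unif_avoid D r r m\<bar> \<le> r / \<eta> * (\<delta> * \<eta> / A k + C * \<rho> ^ k)"
        unfolding T_def
      proof (rule visit_term_density[OF nu r(1) \<eta>(1)])
        fix y assume "\<bar>y\<bar> < r"
        then have "\<bar>y\<bar> \<le> 1" using r by simp
        then show "\<bar>measure (walk_law D \<nu> k) {w. \<bar>w - y\<bar> < \<eta>} - 2 * \<eta> * (f / A k)\<bar> \<le> \<delta> * \<eta> / A k + C * \<rho> ^ k"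
          using J1[of k \<eta> y] that \<eta> by (simp add: J_def)
      qed
      also have "\<dots> = r * \<delta> * (1 / A k) + w k"
        using \<eta> \<epsilon> ab by (simp add: w_def r_def \<eta>_def field_simps)
      finally show ?thesis .
    qed
    have atom: "p k * q \<le> T k n" "T k n \<le> p k * q + measure (walk_law D \<nu> k) {w. 0 < \<bar>w\<bar> \<and> \<bar>w\<bar> < b * \<epsilon> + a * \<epsilon>}" for k
      using visit_term_atom[OF nu r(1) \<eta>(1,2), of k n] by (auto simp: p_def q_def T_def r_def \<eta>_def)
    have GJ: "(\<Sum>k=Suc J..n. 1 / A k) = g - G J"
    proof -
      have "{1..n} = {1..J} \<union> {Suc J..n}" using nJ by auto
      then have "g = (\<Sum>k\<in>{1..J} \<union> {Suc J..n}. 1 / A k)" by (simp add: g_def G_def)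
      also have "\<dots> = G J + (\<Sum>k=Suc J..n. 1 / A k)" unfolding G_def by (subst sum.union_disjoint) auto
      finally show ?thesis by simp
    qed
    have G2: "(\<Sum>k=Suc n..2*n. 1 / A k) = G (2 * n) - g"
    proof -
      have "{1..2*n} = {1..n} \<union> {Suc n..2*n}" by auto
      then have "G (2 * n) = (\<Sum>k\<in>{1..n} \<union> {Suc n..2*n}. 1 / A k)" by (simp add: G_def)
      also have "\<dots> = g + (\<Sum>k=Suc n..2*n. 1 / A k)" unfolding G_def g_def by (subst sum.union_disjoint) auto
      finally show ?thesis by simp
    qed
    define \<Theta> where "\<Theta> = (\<Sum>k=1..n. T k n)"
    have \<Theta>: "\<Theta> = (\<Sum>k=1..J. T k n) + (\<Sum>k=Suc J..n. T k n)"
    proof -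
      have "{1..n} = {1..J} \<union> {Suc J..n}" using nJ by auto
      then show ?thesis unfolding \<Theta>_def by (simp only:) (subst sum.union_disjoint; auto)
    qed
    have rg: "r * \<delta> * g \<le> e'"
    proof -
      have "\<epsilon> * g \<le> K" using elim by (simp add: g_def n_def)
      then have "b * \<delta> * (\<epsilon> * g) \<le> b * \<delta> * K" using ab \<delta> by (intro mult_left_mono) auto
      also have "\<dots> = e'" using ab K by (simp add: \<delta>_def)
      finally show ?thesis by (simp add: r_def mult_ac)
    qed
    have GJ0: "0 \<le> G J" by (rule G_nonneg)
    have rgJ: "2 * r * f * G J * Q \<le> e'" 
    proof -
      have "2 * r * f * G J * Q \<le> 2 * r * f * G J * 1"
        using Q r f0 GJ0 by (intro mult_left_mono) (auto simp: f_def)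
      also have "\<dots> \<le> e'" using elim by (simp add: r_def mult_ac)
      finally show ?thesis .
    qed
    have rgJ0: "0 \<le> r * \<delta> * G J" "0 \<le> 2 * r * f * G J * Q" using r \<delta> GJ0 Q f0 by (auto simp: f_def)
    have up1: "(\<Sum>k=1..J. T k n) \<le> \<alpha> * q + e'"
    proof -
      have "(\<Sum>k=1..J. T k n) \<le> (\<Sum>k=1..J. p k * q + measure (walk_law D \<nu> k) {w. 0 < \<bar>w\<bar> \<and> \<bar>w\<bar> < b * \<epsilon> + a * \<epsilon>})"
        by (intro sum_mono atom)
      also have "\<dots> = (\<Sum>k=1..J. p k) * q + sm \<epsilon>" by (simp add: sum.distrib sm_def sum_distrib_right)
      also have "\<dots> \<le> \<alpha> * q + e'" using \<alpha>1 q elim by (intro add_mono mult_right_mono) auto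
      finally show ?thesis .
    qed
    have lo1: "\<alpha> * q - e' \<le> (\<Sum>k=1..J. T k n)"
    proof -
      have "(\<alpha> - e') * q \<le> (\<Sum>k=1..J. p k) * q" using \<alpha>2 q by (intro mult_right_mono) auto
      also have "\<dots> \<le> (\<Sum>k=1..J. T k n)" unfolding sum_distrib_right by (intro sum_mono atom)
      finally have "(\<alpha> - e') * q \<le> (\<Sum>k=1..J. T k n)" .
      moreover have "e' * q \<le> e' * 1" using e' q by (intro mult_left_mono) auto
      ultimately show ?thesis by (simp add: left_diff_distrib)
    qed
    have mid: "\<bar>(\<Sum>k=Suc J..n. T k n) - 2 * r * f * (g - G J) * Q\<bar> \<le> r * \<delta> * (g - G J) + e'"
    proof -
      have "(\<Sum>k=Suc J..n. T k n) - 2 * r * f * (g - G J) * Q = (\<Sum>k=Suc J..n. T k n - 2 * r * (f / A k) * Q)"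
        unfolding GJ[symmetric] by (simp add: sum_subtractf sum_distrib_left sum_distrib_right)
      then have "\<bar>(\<Sum>k=Suc J..n. T k n) - 2 * r * f * (g - G J) * Q\<bar> \<le> (\<Sum>k=Suc J..n. \<bar>T k n - 2 * r * (f / A k) * Q\<bar>)"
        by (simp only: sum_abs)
      also have "\<dots> \<le> (\<Sum>k=Suc J..n. r * \<delta> * (1 / A k) + w k)"
        using dens by (intro sum_mono) (auto simp: Q_def)
      also have "(\<Sum>k=Suc J..n. r * \<delta> * (1 / A k) + w k) = r * \<delta> * (\<Sum>k=Suc J..n. 1 / A k) + (\<Sum>k=Suc J..n. w k)"
        by (simp only: sum.distrib sum_distrib_left)
      also have "(\<Sum>k=Suc J..n. 1 / A k) = g - G J" by (rule GJ)
      also have "r * \<delta> * (g - G J) + (\<Sum>k=Suc J..n. w k) \<le> r * \<delta> * (g - G J) + e'" using tail(1)[of n] by simp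
      finally show ?thesis .
    qed
    have last: "(\<Sum>k=Suc n..2*n. T k 0) \<le> 2 * e'"
    proof -
      have "T k 0 \<le> r * (2 * f + \<delta>) * (1 / A k) + w k" if "k \<ge> Suc n" for k
      proof -
        have "2 * r * (f / A k) * unif_avoid D r r 0 \<le> 2 * r * (f / A k) * 1"
          using unif_avoid_bounds[OF nu r(1) r(1)] r f0 A_pos[of k] by (intro mult_left_mono) (auto simp: f_def)
        moreover have "T k 0 \<le> 2 * r * (f / A k) * unif_avoid D r r 0 + (r * \<delta> * (1 / A k) + w k)"
          using dens[of k 0] that nJ by (simp add: abs_le_iff)
        moreover have "r * (2 * f + \<delta>) * (1 / A k) = 2 * r * (f / A k) * 1 + r * \<delta> * (1 / A k)"
          by (simp add: ring_distribs add_divide_distrib)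
        ultimately show ?thesis by linarith
      qed
      then have "(\<Sum>k=Suc n..2*n. T k 0) \<le> (\<Sum>k=Suc n..2*n. r * (2 * f + \<delta>) * (1 / A k) + w k)"
        by (intro sum_mono) auto
      also have "(\<Sum>k=Suc n..2*n. r * (2 * f + \<delta>) * (1 / A k) + w k)
          = r * (2 * f + \<delta>) * (\<Sum>k=Suc n..2*n. 1 / A k) + (\<Sum>k=Suc n..2*n. w k)"
        by (simp only: sum.distrib sum_distrib_left)
      also have "(\<Sum>k=Suc n..2*n. 1 / A k) = G (2 * n) - g" by (rule G2)
      also have "r * (2 * f + \<delta>) * (G (2 * n) - g) = b * (2 * f + \<delta>) * (\<epsilon> * g) * ((G (2 * n) - g) / g)"
        using elim by (simp add: r_def g_def n_def)
      also have "b * (2 * f + \<delta>) * (\<epsilon> * g) * ((G (2 * n) - g) / g) + (\<Sum>k=Suc n..2*n. w k) \<le> e' + e'"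
        using elim wtail[OF nJ, of "2 * n"] by (intro add_mono) (auto simp: g_def n_def)
      finally show ?thesis by simp
    qed
    define S where "S = smeared_avoid D \<nu> r \<eta> n"
    have lo: "S + \<Theta> \<le> 1" unfolding S_def \<Theta>_def T_def by (rule smeared_renewal_lower[OF nu r(1) \<eta>(1)])
    have up: "1 \<le> S + \<Theta> + (\<Sum>k=Suc n..2*n. T k 0)"
      unfolding S_def \<Theta>_def T_def by (rule smeared_renewal_upper[OF nu r(1) \<eta>(1)])
    have d1: "2 * r * f * (g - G J) * Q = 2 * r * f * g * Q - 2 * r * f * G J * Q" by (simp add: algebra_simps)
    have d2: "r * \<delta> * (g - G J) = r * \<delta> * g - r * \<delta> * G J" by (simp add: algebra_simps)
    have "\<bar>S + \<alpha> * q + 2 * r * f * g * Q - 1\<bar> \<le> 9 * e'"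
      using lo up \<Theta> up1 lo1 mid last rg rgJ rgJ0 e' unfolding d1 d2 abs_le_iff by linarith
    also have "\<dots> < e" using e by (simp add: e'_def)
    finally show ?case
      by (simp add: dist_real_def S_def \<alpha>_def p_def q_def Q_def r_def \<eta>_def n_def g_def f_def mult_ac)
  qed
qed

end

text \<open>A perturbation smaller than \<eta> carries the interval of radius r into that of radius
  r + \<eta>. Undoing it carries the interval of radius r - \<eta> into that of radius r.\<close>

lemma (in real_distribution) avoid_sandwich:
  assumes nu: "real_distribution \<nu>" and \<eta>: "0 < \<eta>"
  shows "smeared_avoid M \<nu> (r + \<eta>) \<eta> n \<le> (\<integral>y. avoid M {-r<..<r} n y \<partial>\<nu>)"
    and "(\<integral>y. avoid M {-r<..<r} n y \<partial>\<nu>) \<le> smeared_avoid M \<nu> (r - \<eta>) \<eta> n"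
proof -
  interpret nu: real_distribution \<nu> by (rule nu)
  interpret U: real_distribution "unif \<eta>" by (rule real_distribution_unif[OF \<eta>])
  have sa: "smeared_avoid M \<nu> s \<eta> n = (\<integral>y. \<integral>z. avoid M {-s<..<s} n (y + z) \<partial>unif \<eta> \<partial>\<nu>)" for s
    unfolding smeared_avoid_def using avoid_bounds[of "{-s<..<s}" n]
    by (intro integral_convolution[where B = 1] nu U.real_distribution_axioms) auto
  have AEU: "AE z in unif \<eta>. \<bar>z\<bar> < \<eta>"
    unfolding unif_def by (subst AE_density) (auto simp: indicator_def)
  have i1: "integrable (unif \<eta>) (\<lambda>z. avoid M {-s<..<s} n (y + z))" for s y
    using avoid_bounds[of "{-s<..<s}" n] by (intro U.integrable_const_bound[where B = 1]) auto
  have i2: "integrable \<nu> (avoid M {-s<..<s} n)" for s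
    using avoid_bounds[of "{-s<..<s}" n] by (intro nu.integrable_const_bound[where B = 1]) auto
  have i3: "integrable \<nu> (\<lambda>y. \<integral>z. avoid M {-s<..<s} n (y + z) \<partial>unif \<eta>)" for s
  proof (rule nu.integrable_const_bound[where B = 1])
    show "AE y in \<nu>. norm (\<integral>z. avoid M {-s<..<s} n (y + z) \<partial>unif \<eta>) \<le> 1"
      using i1[of s] avoid_bounds[of "{-s<..<s}" n]
      by (auto simp: abs_of_nonneg integral_nonneg_AE intro!: U.integral_le_const)
    have "(\<lambda>y. \<integral>z. avoid M {-s<..<s} n (y + z) \<partial>unif \<eta>) \<in> borel_measurable borel"
      by (intro U.borel_measurable_lebesgue_integral) (simp add: case_prod_unfold)
    then show "(\<lambda>y. \<integral>z. avoid M {-s<..<s} n (y + z) \<partial>unif \<eta>) \<in> borel_measurable \<nu>" by simp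
  qed
  have c: "(\<integral>z. avoid M {-r<..<r} n y \<partial>unif \<eta>) = avoid M {-r<..<r} n y" for y
    using U.prob_space by simp
  have ic: "integrable (unif \<eta>) (\<lambda>z. avoid M {-r<..<r} n y)" for y by simp
  show "smeared_avoid M \<nu> (r + \<eta>) \<eta> n \<le> (\<integral>y. avoid M {-r<..<r} n y \<partial>\<nu>)"
    unfolding sa
  proof (rule integral_mono[OF i3 i2])
    fix y
    have "(\<integral>z. avoid M {-(r + \<eta>)<..<r + \<eta>} n (y + z) \<partial>unif \<eta>) \<le> (\<integral>z. avoid M {-r<..<r} n y \<partial>unif \<eta>)"
    proof (rule integral_mono_AE[OF i1 ic])
      show "AE z in unif \<eta>. avoid M {-(r + \<eta>)<..<r + \<eta>} n (y + z) \<le> avoid M {-r<..<r} n y"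
        using AEU by eventually_elim (rule avoid_shift_mono, auto)
    qed
    then show "(\<integral>z. avoid M {-(r + \<eta>)<..<r + \<eta>} n (y + z) \<partial>unif \<eta>) \<le> avoid M {-r<..<r} n y" unfolding c .
  qed
  show "(\<integral>y. avoid M {-r<..<r} n y \<partial>\<nu>) \<le> smeared_avoid M \<nu> (r - \<eta>) \<eta> n"
    unfolding sa
  proof (rule integral_mono[OF i2 i3])
    fix y
    have "(\<integral>z. avoid M {-r<..<r} n y \<partial>unif \<eta>) \<le> (\<integral>z. avoid M {-(r - \<eta>)<..<r - \<eta>} n (y + z) \<partial>unif \<eta>)"
    proof (rule integral_mono_AE[OF ic i1])
      show "AE z in unif \<eta>. avoid M {-r<..<r} n y \<le> avoid M {-(r - \<eta>)<..<r - \<eta>} n (y + z)"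
        using AEU
      proof eventually_elim
        case (elim z)
        have "avoid M {-r<..<r} n ((y + z) + - z) \<le> avoid M {-(r - \<eta>)<..<r - \<eta>} n (y + z)"
          using elim by (intro avoid_shift_mono) auto
        then show ?case by simp
      qed
    qed
    then show "avoid M {-r<..<r} n y \<le> (\<integral>z. avoid M {-(r - \<eta>)<..<r - \<eta>} n (y + z) \<partial>unif \<eta>)" unfolding c .
  qed
qed

section \<open>Limits of the avoidance probabilities\<close>

context cauchy_domain
begin

text \<open>For a single point every visit restarts the walk from the centre itself. The visit
  probabilities are summable, so those between n and 2n disappear. For a start at the centre u = v,
  hence v is the reciprocal of 1 plus the expected number of exact returns.\<close>

lemma point_renewal_limit:
  assumes nu: "real_distribution \<nu>"
    and u: "(\<lambda>n. \<integral>y. avoid D {0} n y \<partial>\<nu>) \<longlonglongrightarrow> u"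
    and v: "(\<lambda>n. avoid D {0} n 0) \<longlonglongrightarrow> v"
  shows "u + (\<Sum>k. measure (walk_law D \<nu> (Suc k)) {0}) * v = 1"
proof -
  define p where "p k = measure (walk_law D \<nu> k) {0}" for k
  define \<alpha> where "\<alpha> = (\<Sum>k. p (Suc k))"
  define U where "U n = (\<integral>y. avoid D {0} n y \<partial>\<nu>)" for n
  define V where "V n = avoid D {0} n 0" for n
  have p0: "p k \<ge> 0" for k by (simp add: p_def)
  have V01: "0 \<le> V n" "V n \<le> 1" for n using avoid_bounds[of "{0}" n 0] by (auto simp: V_def)
  have Vmono: "V n \<le> V m" if "m \<le> n" for m n unfolding V_def using that by (intro avoid_antimono) auto
  have "summable p" using atoms_summable[OF nu] by (simp add: p_def[abs_def])
  then have ps: "summable (\<lambda>k. p (Suc k))" by (simp add: summable_Suc_iff)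
  define s where "s n = (\<Sum>k=1..n. p k)" for n
  have s: "s \<longlonglongrightarrow> \<alpha>"
    using summable_LIMSEQ[OF ps] unfolding s_def \<alpha>_def by (simp add: sum.atLeast1_atMost_eq)
  have ren: "U n + (\<Sum>k=1..n. p k * V (n - k)) = 1" for n
  proof -
    have "(\<integral>y. indicator {0} y * avoid D {0} m y \<partial>walk_law D \<nu> k) = p k * V m" for k m
    proof -
      have "(\<integral>y. indicator {0} y * avoid D {0} m y \<partial>walk_law D \<nu> k) = (\<integral>y. indicator {0} y * V m \<partial>walk_law D \<nu> k)"
        by (intro Bochner_Integration.integral_cong) (auto simp: V_def indicator_def)
      also have "\<dots> = p k * V m"
        using real_distribution.space_eq_univ[OF real_distribution_walk_law[OF real_distribution_axioms nu, of k]]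
        by (simp add: p_def)
      finally show ?thesis .
    qed
    then show ?thesis using last_exit_decomposition[OF nu, of "{0}" n] by (simp add: U_def)
  qed
  have lo: "U n + s n * V n \<le> 1" for n
  proof -
    have "s n * V n \<le> (\<Sum>k=1..n. p k * V (n - k))"
      unfolding s_def sum_distrib_right using p0 by (intro sum_mono mult_left_mono Vmono) auto
    then show ?thesis using ren[of n] by simp
  qed
  have up: "1 \<le> U (2 * n) + s n * V n + (s (2 * n) - s n)" for n
  proof -
    have split: "{1..2*n} = {1..n} \<union> {Suc n..2*n}" by auto
    have "(\<Sum>k=1..2*n. p k * V (2 * n - k)) = (\<Sum>k=1..n. p k * V (2 * n - k)) + (\<Sum>k=Suc n..2*n. p k * V (2 * n - k))"
      unfolding split by (subst sum.union_disjoint) auto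
    also have "\<dots> \<le> (\<Sum>k=1..n. p k * V n) + (\<Sum>k=Suc n..2*n. p k * 1)"
      using p0 V01 by (intro add_mono sum_mono mult_left_mono Vmono) auto
    also have "\<dots> = s n * V n + (s (2 * n) - s n)"
    proof -
      have "s (2 * n) = s n + (\<Sum>k=Suc n..2*n. p k)" unfolding s_def split by (subst sum.union_disjoint) auto
      then show ?thesis by (simp add: s_def sum_distrib_right)
    qed
    finally show ?thesis using ren[of "2 * n"] by simp
  qed
  have U: "U \<longlonglongrightarrow> u" and V: "V \<longlonglongrightarrow> v" using u v by (simp_all add: U_def[abs_def] V_def[abs_def])
  have d: "filterlim (\<lambda>n::nat. 2 * n) at_top sequentially" by real_asymp
  have "(\<lambda>n. U n + s n * V n) \<longlonglongrightarrow> u + \<alpha> * v" by (intro tendsto_intros U V s)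
  then have "u + \<alpha> * v \<le> 1" by (rule LIMSEQ_le_const2) (use lo in auto)
  moreover have "(\<lambda>n. U (2 * n) + s n * V n + (s (2 * n) - s n)) \<longlonglongrightarrow> u + \<alpha> * v + (\<alpha> - \<alpha>)"
    by (intro tendsto_intros U V s filterlim_compose[OF U d] filterlim_compose[OF s d])
  then have "1 \<le> u + \<alpha> * v + (\<alpha> - \<alpha>)" by (rule LIMSEQ_le_const) (use up in auto)
  ultimately show ?thesis by (simp add: \<alpha>_def p_def)
qed

lemma avoid_interval_limit:
  assumes nu: "real_distribution \<nu>" and f0: "local_density > 0"
    and Gtop: "filterlim G at_top sequentially"
    and u: "(\<lambda>n. \<integral>y. avoid D {0} n y \<partial>\<nu>) \<longlonglongrightarrow> u"
    and v: "(\<lambda>n. avoid D {0} n 0) \<longlonglongrightarrow> v"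
    and N: "filterlim N sequentially (at_right 0)" and t: "t > 0"
    and lim: "((\<lambda>\<epsilon>. 2 * local_density * v * \<epsilon> * G (N \<epsilon>)) \<longlongrightarrow> t) (at_right 0)"
  shows "((\<lambda>\<epsilon>. \<integral>y. avoid D {-\<epsilon><..<\<epsilon>} (N \<epsilon>) y \<partial>\<nu>) \<longlongrightarrow> u / (1 + t)) (at_right 0)"
proof -
  have D: "real_distribution D" ..
  interpret nu: real_distribution \<nu> by (rule nu)
  define \<nu>0 where "\<nu>0 = return borel (0::real)"
  have nu0: "real_distribution \<nu>0" unfolding \<nu>0_def by (rule real_distribution_return)
  define f where "f = local_density"
  have f: "f > 0" using f0 by (simp add: f_def)
  define \<alpha>0 where "\<alpha>0 = (\<Sum>k. measure (walk_law D \<nu>0 (Suc k)) {0})"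
  define \<alpha> where "\<alpha> = (\<Sum>k. measure (walk_law D \<nu> (Suc k)) {0})"
  have \<alpha>00: "\<alpha>0 \<ge> 0" unfolding \<alpha>0_def
    by (rule suminf_nonneg[OF summable_Suc_iff[THEN iffD2, OF atoms_summable[OF nu0]]]) simp
  have "(\<lambda>n. \<integral>y. avoid D {0} n y \<partial>\<nu>0) \<longlonglongrightarrow> v"
    using v unfolding \<nu>0_def by (subst integral_return) auto
  from point_renewal_limit[OF nu0 this v] have v1: "v * (1 + \<alpha>0) = 1"
    by (simp add: \<alpha>0_def algebra_simps)
  have u1: "u + \<alpha> * v = 1" using point_renewal_limit[OF nu u v] by (simp add: \<alpha>_def)
  have v0: "v > 0" using v1 \<alpha>00 by (metis add_nonneg_pos add.commute mult_not_zero not_less_iff_gr_or_eq zero_less_mult_pos2 zero_less_one)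
  have v2: "1 + \<alpha>0 = 1 / v" using v1 v0 by (simp add: field_simps)
  define s where "s = t / (2 * f * v)"
  have "((\<lambda>\<epsilon>. 2 * local_density * v * \<epsilon> * G (N \<epsilon>) / (2 * f * v)) \<longlongrightarrow> t / (2 * f * v)) (at_right 0)"
    using f v0 by (intro tendsto_divide lim tendsto_const) auto
  then have sl: "((\<lambda>\<epsilon>. \<epsilon> * G (N \<epsilon>)) \<longlongrightarrow> s) (at_right 0)"
    using f v0 by (simp add: s_def f_def)
  \<comment> \<open>The horizon is chosen so that the coefficient of Q becomes b t / v, matching 1 +
    \<alpha>0 = 1 / v. This is why 1 + b t is the denominator of all three limits below.\<close>
  have fs: "2 * b * f * s = b * t / v" for b using f v0 by (simp add: s_def field_simps)
  note R = smeared_renewal_limit[OF _ _ _ less_imp_le[OF f0] Gtop N sl, folded f_def]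
  have pos: "\<forall>\<^sub>F \<epsilon> in at_right 0. (0::real) < \<epsilon>" by (simp add: eventually_at_right_less)
  \<comment> \<open>With the start at the centre and a = b all three terms contain the same unknown,
    with total coefficient tending to (1 + b t) / v.\<close>
  have lim1: "((\<lambda>\<epsilon>. unif_avoid D (b * \<epsilon>) (b * \<epsilon>) (N \<epsilon>)) \<longlongrightarrow> v / (1 + b * t)) (at_right 0)" if b: "b > 0" for b
  proof -
    have bt: "1 + b * t > 0" using b t by (simp add: add_pos_pos)
    have X: "((\<lambda>\<epsilon>. 1 + \<alpha>0 + 2 * b * f * (\<epsilon> * G (N \<epsilon>))) \<longlongrightarrow> 1 + \<alpha>0 + 2 * b * f * s) (at_right 0)"
      by (intro tendsto_intros sl)
    have Xv: "1 + \<alpha>0 + 2 * b * f * s = (1 + b * t) / v" unfolding v2 fs by (simp add: add_divide_distrib)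
    have "((\<lambda>\<epsilon>. (smeared_avoid D \<nu>0 (b * \<epsilon>) (b * \<epsilon>) (N \<epsilon>) + \<alpha>0 * unif_avoid D (b * \<epsilon>) (b * \<epsilon>) (N \<epsilon>)
        + 2 * b * f * (\<epsilon> * G (N \<epsilon>)) * unif_avoid D (b * \<epsilon>) (b * \<epsilon>) (N \<epsilon>)) / (1 + \<alpha>0 + 2 * b * f * (\<epsilon> * G (N \<epsilon>))))
        \<longlongrightarrow> 1 / (1 + \<alpha>0 + 2 * b * f * s)) (at_right 0)"
      using R[OF nu0, of b b] b bt v0 unfolding \<alpha>0_def[symmetric] by (intro tendsto_divide X) (auto simp: Xv)
    moreover have "\<forall>\<^sub>F \<epsilon> in at_right 0. 1 + \<alpha>0 + 2 * b * f * (\<epsilon> * G (N \<epsilon>)) > 0"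
      using X by (rule order_tendstoD) (use bt v0 in \<open>simp add: Xv\<close>)
    with pos have "\<forall>\<^sub>F \<epsilon> in at_right 0. (smeared_avoid D \<nu>0 (b * \<epsilon>) (b * \<epsilon>) (N \<epsilon>) + \<alpha>0 * unif_avoid D (b * \<epsilon>) (b * \<epsilon>) (N \<epsilon>)
        + 2 * b * f * (\<epsilon> * G (N \<epsilon>)) * unif_avoid D (b * \<epsilon>) (b * \<epsilon>) (N \<epsilon>)) / (1 + \<alpha>0 + 2 * b * f * (\<epsilon> * G (N \<epsilon>)))
        = unif_avoid D (b * \<epsilon>) (b * \<epsilon>) (N \<epsilon>)"
    proof eventually_elim
      case (elim \<epsilon>)
      have "smeared_avoid D \<nu>0 (b * \<epsilon>) (b * \<epsilon>) (N \<epsilon>) = unif_avoid D (b * \<epsilon>) (b * \<epsilon>) (N \<epsilon>)"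
        unfolding \<nu>0_def using elim b by (intro smeared_avoid_return_0 D) simp
      moreover have "w + \<alpha>0 * w + z * w = w * (1 + \<alpha>0 + z)" for w z by (simp add: algebra_simps)
      ultimately show ?case using elim by simp
    qed
    ultimately have "((\<lambda>\<epsilon>. unif_avoid D (b * \<epsilon>) (b * \<epsilon>) (N \<epsilon>)) \<longlongrightarrow> 1 / (1 + \<alpha>0 + 2 * b * f * s)) (at_right 0)"
      by (rule Lim_transform_eventually)
    then show ?thesis unfolding Xv by simp
  qed
  \<comment> \<open>Q is known now, and the identity is linear in q with coefficient 1 + \<alpha>0 =
    1 / v.\<close>
  have lim2: "((\<lambda>\<epsilon>. unif_avoid D (b * \<epsilon>) (a * \<epsilon>) (N \<epsilon>)) \<longlongrightarrow> v / (1 + b * t)) (at_right 0)" if ab: "0 < a" "a \<le> b" for a b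
  proof -
    have b: "b > 0" using ab by simp
    have bt: "1 + b * t > 0" using b t by (simp add: add_pos_pos)
    have "((\<lambda>\<epsilon>. (smeared_avoid D \<nu>0 (b * \<epsilon>) (a * \<epsilon>) (N \<epsilon>) + \<alpha>0 * unif_avoid D (b * \<epsilon>) (a * \<epsilon>) (N \<epsilon>)
        + 2 * b * f * (\<epsilon> * G (N \<epsilon>)) * unif_avoid D (b * \<epsilon>) (b * \<epsilon>) (N \<epsilon>)
        - 2 * b * f * (\<epsilon> * G (N \<epsilon>)) * unif_avoid D (b * \<epsilon>) (b * \<epsilon>) (N \<epsilon>)) * v)
        \<longlongrightarrow> (1 - 2 * b * f * s * (v / (1 + b * t))) * v) (at_right 0)"
      using R[OF nu0, of a b] ab unfolding \<alpha>0_def[symmetric] by (intro tendsto_intros lim1[OF b] sl) auto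
    moreover have "\<forall>\<^sub>F \<epsilon> in at_right 0. (smeared_avoid D \<nu>0 (b * \<epsilon>) (a * \<epsilon>) (N \<epsilon>) + \<alpha>0 * unif_avoid D (b * \<epsilon>) (a * \<epsilon>) (N \<epsilon>)
        + 2 * b * f * (\<epsilon> * G (N \<epsilon>)) * unif_avoid D (b * \<epsilon>) (b * \<epsilon>) (N \<epsilon>)
        - 2 * b * f * (\<epsilon> * G (N \<epsilon>)) * unif_avoid D (b * \<epsilon>) (b * \<epsilon>) (N \<epsilon>)) * v = unif_avoid D (b * \<epsilon>) (a * \<epsilon>) (N \<epsilon>)"
      using pos
    proof eventually_elim
      case (elim \<epsilon>)
      have "smeared_avoid D \<nu>0 (b * \<epsilon>) (a * \<epsilon>) (N \<epsilon>) = unif_avoid D (b * \<epsilon>) (a * \<epsilon>) (N \<epsilon>)"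
        unfolding \<nu>0_def using elim ab by (intro smeared_avoid_return_0 D) simp
      moreover have "(w + \<alpha>0 * w + z - z) * v = w * (v * (1 + \<alpha>0))" for w z by (simp add: algebra_simps)
      ultimately show ?case using v1 by simp
    qed
    ultimately have "((\<lambda>\<epsilon>. unif_avoid D (b * \<epsilon>) (a * \<epsilon>) (N \<epsilon>)) \<longlongrightarrow> (1 - 2 * b * f * s * (v / (1 + b * t))) * v) (at_right 0)"
      by (rule Lim_transform_eventually)
    moreover have "(1 - 2 * b * f * s * (v / (1 + b * t))) * v = v / (1 + b * t)"
      unfolding fs using v0 bt by (simp add: field_simps)
    ultimately show ?thesis by simp
  qed
  \<comment> \<open>The general start enters only through \<alpha> v = 1 - u, which turns the
    numerator into u.\<close>
  have lim3: "((\<lambda>\<epsilon>. smeared_avoid D \<nu> (b * \<epsilon>) (a * \<epsilon>) (N \<epsilon>)) \<longlongrightarrow> u / (1 + b * t)) (at_right 0)" if ab: "0 < a" "a \<le> b" for a b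
  proof -
    have b: "b > 0" using ab by simp
    have bt: "1 + b * t > 0" using b t by (simp add: add_pos_pos)
    have "((\<lambda>\<epsilon>. smeared_avoid D \<nu> (b * \<epsilon>) (a * \<epsilon>) (N \<epsilon>) + \<alpha> * unif_avoid D (b * \<epsilon>) (a * \<epsilon>) (N \<epsilon>)
        + 2 * b * f * (\<epsilon> * G (N \<epsilon>)) * unif_avoid D (b * \<epsilon>) (b * \<epsilon>) (N \<epsilon>)
        - (\<alpha> * unif_avoid D (b * \<epsilon>) (a * \<epsilon>) (N \<epsilon>)
        + 2 * b * f * (\<epsilon> * G (N \<epsilon>)) * unif_avoid D (b * \<epsilon>) (b * \<epsilon>) (N \<epsilon>)))
        \<longlongrightarrow> 1 - (\<alpha> * (v / (1 + b * t)) + 2 * b * f * s * (v / (1 + b * t)))) (at_right 0)"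
      using R[OF nu, of a b] ab unfolding \<alpha>_def[symmetric] by (intro tendsto_intros lim1[OF b] lim2[OF ab] sl) auto
    moreover have "1 - (\<alpha> * (v / (1 + b * t)) + 2 * b * f * s * (v / (1 + b * t))) = u / (1 + b * t)"
    proof -
      have "\<alpha> * v = 1 - u" using u1 by simp
      then have "\<alpha> * (v / (1 + b * t)) = (1 - u) / (1 + b * t)" by simp
      moreover have "b * t / v * (v / (1 + b * t)) = b * t / (1 + b * t)" using v0 by simp
      moreover have "1 - ((1 - u) / (1 + b * t) + b * t / (1 + b * t)) = u / (1 + b * t)"
      proof -
        define w where "w = 1 + b * t"
        have "1 - ((1 - u) / w + (w - 1) / w) = u / w" using bt by (simp add: w_def[symmetric] diff_divide_distrib)
        then show ?thesis by (simp add: w_def)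
      qed
      ultimately show ?thesis unfolding fs by (simp only:)
    qed
    ultimately show ?thesis by simp
  qed
  show ?thesis
  proof (rule tendstoI)
    fix e :: real assume e: "e > 0"
    \<comment> \<open>The smeared walks with a = d and b = 1 + d or b = 1 - d bracket the
      unperturbed one, and both limits approach u / (1 + t) as d tends to 0. The bound d < 1/2
      ensures a \<le> b in the second case.\<close>
    have cont: "((\<lambda>d. u / (1 + (1 + c * d) * t)) \<longlongrightarrow> u / (1 + (1 + c * 0) * t)) (at_right 0)" for c
      using t by (intro tendsto_intros) (auto simp: add_pos_pos)
    have "\<forall>\<^sub>F d in at_right 0. dist (u / (1 + (1 + 1 * d) * t)) (u / (1 + t)) < e / 2"
      "\<forall>\<^sub>F d in at_right 0. dist (u / (1 + (1 + (-1) * d) * t)) (u / (1 + t)) < e / 2"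
      using tendstoD[OF cont[of 1], of "e / 2"] tendstoD[OF cont[of "-1"], of "e / 2"] e by simp_all
    moreover have "\<forall>\<^sub>F d in at_right 0. (0::real) < d \<and> d < 1 / 2"
      by (auto simp: eventually_at_right_field intro!: exI[of _ "1 / 2"])
    ultimately have "\<forall>\<^sub>F d in at_right 0. 0 < d \<and> d < 1 / 2 \<and> dist (u / (1 + (1 + d) * t)) (u / (1 + t)) < e / 2
      \<and> dist (u / (1 + (1 - d) * t)) (u / (1 + t)) < e / 2"
      by eventually_elim simp
    then obtain d where d: "0 < d" "d < 1 / 2" "dist (u / (1 + (1 + d) * t)) (u / (1 + t)) < e / 2"
      "dist (u / (1 + (1 - d) * t)) (u / (1 + t)) < e / 2"
      using eventually_happens'[OF trivial_limit_at_right_real] by blast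
    have "\<forall>\<^sub>F \<epsilon> in at_right 0. dist (smeared_avoid D \<nu> ((1 + d) * \<epsilon>) (d * \<epsilon>) (N \<epsilon>)) (u / (1 + (1 + d) * t)) < e / 2"
      using d e by (intro tendstoD[OF lim3]) auto
    moreover have "\<forall>\<^sub>F \<epsilon> in at_right 0. dist (smeared_avoid D \<nu> ((1 - d) * \<epsilon>) (d * \<epsilon>) (N \<epsilon>)) (u / (1 + (1 - d) * t)) < e / 2"
      using d e by (intro tendstoD[OF lim3]) auto
    ultimately show "\<forall>\<^sub>F \<epsilon> in at_right 0. dist (\<integral>y. avoid D {-\<epsilon><..<\<epsilon>} (N \<epsilon>) y \<partial>\<nu>) (u / (1 + t)) < e"
      using pos
    proof eventually_elim
      case (elim \<epsilon>)
      have "smeared_avoid D \<nu> ((1 + d) * \<epsilon>) (d * \<epsilon>) (N \<epsilon>) \<le> (\<integral>y. avoid D {-\<epsilon><..<\<epsilon>} (N \<epsilon>) y \<partial>\<nu>)"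
        using avoid_sandwich(1)[OF nu, of "d * \<epsilon>" \<epsilon> "N \<epsilon>"] d elim by (simp add: ring_distribs)
      moreover have "(\<integral>y. avoid D {-\<epsilon><..<\<epsilon>} (N \<epsilon>) y \<partial>\<nu>) \<le> smeared_avoid D \<nu> ((1 - d) * \<epsilon>) (d * \<epsilon>) (N \<epsilon>)"
        using avoid_sandwich(2)[OF nu, of "d * \<epsilon>" \<epsilon> "N \<epsilon>"] d elim by (simp add: ring_distribs)
      ultimately show ?case using elim d unfolding dist_real_def by linarith
    qed
  qed
qed

end

subsection \<open>The walk avoids a point with positive probability\<close>

text \<open>The characteristic function of a purely atomic law is almost periodic: by simultaneous
  Dirichlet approximation it returns arbitrarily close to 1 along the positive integers.\<close>

lemma (in real_distribution) cramer_not_purely_atomic: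
  assumes cramer: "Limsup at_infinity (\<lambda>s::real. ereal (norm (char M s))) < 1"
  shows "measure M {x. measure M {x} > 0} < 1"
proof (rule ccontr)
  define At where "At = {x. measure M {x} > 0}"
  assume "\<not> measure M {x. measure M {x} > 0} < 1"
  then have At1: "measure M At = 1" unfolding At_def[symmetric] using prob_le_1[of At] by linarith
  have cnt: "countable At" unfolding At_def using countable_support by (simp add: zero_less_measure_iff)
  have ne: "At \<noteq> {}" using At1 by auto
  obtain \<rho> where \<rho>: "0 < \<rho>" "\<rho> < 1" "\<And>t. \<bar>t\<bar> \<ge> 1 \<Longrightarrow> cmod (char M t) \<le> \<rho>"
    using char_bounded_away_from_1[OF cramer, of 1] by auto
  \<comment> \<open>The chain at the end gives 1 - 3 e < \<rho>, which is false because \<rho> = 1 -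
    4 e.\<close>
  define e where "e = (1 - \<rho>) / 4"
  have e: "0 < e" "e < 1" using \<rho> by (auto simp: e_def)
  define d where "d = from_nat_into At"
  define F where "F n = d ` {..<n}" for n
  have "(\<lambda>n. measure M (F n)) \<longlonglongrightarrow> measure M (\<Union>n. F n)"
    by (rule finite_Lim_measure_incseq) (auto simp: F_def incseq_def intro!: borel_closed finite_imp_closed)
  moreover have "(\<Union>n. F n) = At"
  proof -
    have "(\<Union>n. F n) = range d" by (auto simp: F_def)
    then show ?thesis using range_from_nat_into[OF ne cnt] by (simp add: d_def)
  qed
  ultimately have "\<forall>\<^sub>F n in sequentially. measure M (F n) > 1 - e" using At1 e by (intro order_tendstoD(1)) auto
  then obtain n where n: "measure M (F n) > 1 - e" by (auto simp: eventually_sequentially)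
  have [measurable]: "F n \<in> sets borel" by (auto simp: F_def intro!: borel_closed finite_imp_closed)
  obtain L :: nat where L: "2 * pi / e < real L" using reals_Archimedean2 by blast
  moreover have "0 < 2 * pi / e" using e by simp
  ultimately have L0: "L > 0" by (metis less_trans of_nat_0_less_iff)
  \<comment> \<open>An error below 1 / L places each t x with x in \<open>F n\<close> within 2 pi /
    L \<le> e of a multiple of 2 pi. Positivity of \<open>q\<close> gives t \<ge> 1, where the
    modulus is at most \<open>\<rho>\<close>.\<close>
  obtain q p where q: "0 < q" "\<And>i. i < n \<Longrightarrow> \<bar>of_int q * (d i / (2 * pi)) - of_int (p i)\<bar> < 1 / L"
    using Dirichlet_approx_simult[OF L0, of n "\<lambda>i. d i / (2 * pi)"] by metis
  define t where "t = real_of_int q"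
  have t: "t \<ge> 1" using q by (simp add: t_def)
  have cosF: "cos (t * x) \<ge> 1 - e" if "x \<in> F n" for x
  proof -
    from that obtain i where i: "i < n" "x = d i" by (auto simp: F_def)
    define z where "z = t * x - 2 * pi * of_int (p i)"
    have "\<bar>z\<bar> = 2 * pi * \<bar>of_int q * (d i / (2 * pi)) - of_int (p i)\<bar>"
    proof -
      have "z = 2 * pi * (of_int q * (d i / (2 * pi)) - of_int (p i))"
        by (simp add: z_def t_def i field_simps)
      then show ?thesis by (simp add: abs_mult)
    qed
    also have "\<dots> \<le> 2 * pi * (1 / L)" using q(2)[OF i(1)] by (intro mult_left_mono) auto
    also have "\<dots> \<le> e" using L L0 e by (simp add: field_simps)
    finally have z: "\<bar>z\<bar> \<le> e" .
    have "z\<^sup>2 \<le> e * 1" using z e mult_mono[of "\<bar>z\<bar>" e "\<bar>z\<bar>" 1] by (simp add: power2_eq_square)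
    then have "1 - e \<le> cos z" using one_minus_cos_le[of z] e by simp
    also have "cos z = cos (t * x)"
      unfolding z_def using cos_int_2pin[of "p i"] sin_int_2pin[of "p i"] by (simp add: cos_diff mult_ac)
    finally show ?thesis .
  qed
  have "(1 - e) - 2 * e < (2 - e) * measure M (F n) - 1"
  proof -
    have "(2 - e) * (1 - e) < (2 - e) * measure M (F n)" using n e by (intro mult_strict_left_mono) auto
    moreover have "(2 - e) * (1 - e) - 1 = 1 - 3 * e + e\<^sup>2" by (simp add: power2_eq_square algebra_simps)
    moreover have "e\<^sup>2 \<ge> 0" by simp
    ultimately show ?thesis by linarith
  qed
  also have "\<dots> = (\<integral>x. (2 - e) * indicator (F n) x - 1 \<partial>M)"
    using prob_space by (simp add: less_top[symmetric])
  also have "\<dots> \<le> (\<integral>x. cos (t * x) \<partial>M)"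
  proof (rule integral_mono)
    show "(2 - e) * indicator (F n) x - 1 \<le> cos (t * x)" for x
      using cosF[of x] cos_ge_minus_one[of "t * x"] by (cases "x \<in> F n") auto
  qed (auto intro!: integrable_const_bound[where B = 1] simp: less_top[symmetric])
  also have "\<dots> = Re (char M t)"
  proof -
    have ii: "integrable M (\<lambda>x. iexp (t * x))" by (auto intro!: integrable_const_bound[where B = 1])
    show ?thesis unfolding char_def using ii by (simp add: Re_exp flip: integral_Re)
  qed
  also have "\<dots> \<le> cmod (char M t)" by (rule complex_Re_le_cmod)
  also have "\<dots> \<le> \<rho>" using t by (intro \<rho>) simp
  finally show False using \<rho> by (simp add: e_def field_simps)
qed

lemma walk_law_nonatomic:
  assumes D: "real_distribution D" and nu: "real_distribution \<nu>" and na: "\<And>w. measure \<nu> {w} = 0"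
  shows "measure (walk_law D \<nu> k) {w} = 0"
proof (induction k arbitrary: w)
  case (Suc k)
  interpret D: real_distribution D by (rule D)
  interpret L: real_distribution "walk_law D \<nu> k" by (rule real_distribution_walk_law[OF D nu])
  interpret C: real_distribution "convolution D (walk_law D \<nu> k)"
    by (rule real_distribution_convolution[OF D L.real_distribution_axioms])
  \<comment> \<open>The factors are exchanged so that the inner integral is over the nonatomic
    law.\<close>
  have "walk_law D \<nu> (Suc k) = convolution D (walk_law D \<nu> k)"
    unfolding walk_law.simps
    by (intro convolution_commutative D.finite_measure_axioms L.finite_measure_axioms) auto
  then have "measure (walk_law D \<nu> (Suc k)) {w} = (\<integral>y. indicator {w} y \<partial>convolution D (walk_law D \<nu> k))"
    by simp
  also have "\<dots> = (\<integral>x. \<integral>y. indicator {w} (x + y) \<partial>walk_law D \<nu> k \<partial>D)"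
    by (intro integral_convolution[where B = 1] D L.real_distribution_axioms) (auto simp: indicator_def)
  also have "(\<lambda>x. \<integral>y. indicator {w} (x + y) \<partial>walk_law D \<nu> k) = (\<lambda>x. 0 :: real)"
  proof
    fix x
    have "(\<lambda>y. indicator {w} (x + y) :: real) = indicator {w - x}" by (auto simp: indicator_def)
    then show "(\<integral>y. indicator {w} (x + y) \<partial>walk_law D \<nu> k) = (0::real)" using Suc[of "w - x"] by simp
  qed
  finally show ?case by simp
qed (simp add: na)

text \<open>With probability \<open>\<kappa>\<close> the first step comes from the nonatomic part of
  the law. From then on the position has no atoms, so the walk almost surely never meets 0, wherever
  it started. The bound is uniform in \<open>n\<close> and \<open>y\<close>, hence survives the
  limit for any initial law.\<close>

lemma (in real_distribution) avoid_point_bounded_below: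
  assumes na: "measure M {x. measure M {x} > 0} < 1"
  obtains \<kappa> where "\<kappa> > 0" "\<And>n y. avoid M {0} n y \<ge> \<kappa>"
proof -
  define At where "At = {x. measure M {x} > 0}"
  have "countable At" unfolding At_def using countable_support by (simp add: zero_less_measure_iff)
  then have [measurable]: "At \<in> sets borel" by (rule sets.countable[rotated]) auto
  define \<kappa> where "\<kappa> = measure M (- At)"
  have "\<kappa> = 1 - measure M At" unfolding \<kappa>_def using prob_compl[of At] by (simp add: Compl_eq_Diff_UNIV)
  then have \<kappa>: "\<kappa> > 0" using na by (simp add: At_def)
  have \<kappa>1: "\<kappa> \<le> 1" by (simp add: \<kappa>_def)
  \<comment> \<open>The step law conditioned to avoid its atoms.\<close>
  define D' where "D' = density M (\<lambda>x. ennreal (indicator (- At) x / \<kappa>))"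
  have ii: "integrable M (indicator (- At) :: real \<Rightarrow> real)" by (auto intro!: integrable_real_indicator simp: less_top[symmetric])
  have "emeasure D' (space D') = (\<integral>\<^sup>+x. ennreal (indicator (- At) x / \<kappa>) \<partial>M)"
    unfolding D'_def by (subst emeasure_density) (auto intro!: nn_integral_cong)
  also have "\<dots> = ennreal (\<integral>x. indicator (- At) x / \<kappa> \<partial>M)"
    using \<kappa> ii by (intro nn_integral_eq_integral) auto
  also have "\<dots> = 1" using \<kappa> by (simp add: \<kappa>_def)
  finally have "prob_space D'" by (rule prob_spaceI)
  then have D': "real_distribution D'"
    unfolding real_distribution_def real_distribution_axioms_def by (auto simp: D'_def)
  interpret D': real_distribution D' by (rule D')
  have int': "(\<integral>x. f x \<partial>D') = (\<integral>x. indicator (- At) x * f x \<partial>M) / \<kappa>" if [measurable]: "f \<in> borel_measurable borel" for f :: "real \<Rightarrow> real"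
  proof -
    have "(\<integral>x. f x \<partial>D') = (\<integral>x. indicator (- At) x / \<kappa> * f x \<partial>M)"
      unfolding D'_def using \<kappa> by (subst integral_density) auto
    also have "\<dots> = (\<integral>x. indicator (- At) x * f x / \<kappa> \<partial>M)" by simp
    finally show ?thesis by simp
  qed
  have na': "measure D' {w} = 0" for w
  proof -
    have "measure D' {w} = (\<integral>x. indicator {w} x \<partial>D')" by simp
    also have "\<dots> = (\<integral>x. indicator (- At) x * indicator {w} x \<partial>M) / \<kappa>" by (rule int') simp
    also have "(\<lambda>x. indicator (- At) x * indicator {w} x :: real) = indicator (- At \<inter> {w})" by (auto simp: indicator_def)
    also have "(\<integral>x. indicator (- At \<inter> {w}) x \<partial>M) = measure M (- At \<inter> {w})" by simp
    also have "\<dots> = 0"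
    proof (cases "w \<in> At")
      case False
      then have "- At \<inter> {w} = {w}" "\<not> measure M {w} > 0" by (auto simp: At_def)
      then show ?thesis using measure_nonneg[of M "{w}"] by simp
    qed simp
    finally show ?thesis by simp
  qed
  have "avoid M {0} n y \<ge> \<kappa>" for n y
  proof (cases n)
    case 0 then show ?thesis using \<kappa>1 by simp
  next
    case (Suc m)
    \<comment> \<open>The law after one nonatomic step from \<open>y\<close>. Started from it, every
      visit term of the last-exit decomposition is 0, so the avoidance probability is 1.\<close>
    define L0 where "L0 = distr D' borel (\<lambda>x. y + x)"
    have lam: "real_distribution L0" unfolding L0_def by (rule D'.real_distribution_distr) simp
    interpret lam: real_distribution L0 by (rule lam)
    have nal: "measure L0 {w} = 0" for w
    proof -
      have "(\<lambda>x. y + x) -` {w} \<inter> space D' = {w - y}" by auto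
      then show ?thesis unfolding L0_def using na' by (subst measure_distr) auto
    qed
    have AEl: "AE w in L0. w \<noteq> 0"
      using nal[of 0] by (intro AE_I[of _ _ "{0}"]) (auto simp: lam.emeasure_eq_measure)
    have "(\<integral>w. avoid M {0} m w \<partial>L0) = 1"
    proof -
      have "(\<integral>w. indicator {0} w * avoid M {0} (m - k) w \<partial>walk_law M L0 k) = 0" for k
      proof -
        interpret L: real_distribution "walk_law M L0 k" by (rule real_distribution_walk_law[OF real_distribution_axioms lam])
        have "AE w in walk_law M L0 k. w \<noteq> 0"
          using walk_law_nonatomic[OF real_distribution_axioms lam nal, of k 0]
          by (intro AE_I[of _ _ "{0}"]) (auto simp: L.emeasure_eq_measure)
        then show ?thesis by (intro integral_eq_zero_AE) (auto elim: eventually_mono)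
      qed
      then show ?thesis using last_exit_decomposition[OF lam, of "{0}" m] by simp
    qed
    moreover have "(\<integral>w. avoid M {0} m w \<partial>L0) = (\<integral>w. indicator (- {0}) w * avoid M {0} m w \<partial>L0)"
      using AEl by (intro integral_cong_AE) (auto elim: eventually_mono)
    moreover have "(\<integral>w. indicator (- {0}) w * avoid M {0} m w \<partial>L0) = (\<integral>x. indicator (- {0}) (y + x) * avoid M {0} m (y + x) \<partial>D')"
      unfolding L0_def by (subst integral_distr) auto
    moreover have "\<dots> = (\<integral>x. indicator (- At) x * (indicator (- {0}) (y + x) * avoid M {0} m (y + x)) \<partial>M) / \<kappa>"
      by (rule int') measurable
    ultimately have "\<kappa> = (\<integral>x. indicator (- At) x * (indicator (- {0}) (y + x) * avoid M {0} m (y + x)) \<partial>M)"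
      using \<kappa> by simp
    also have "\<dots> \<le> (\<integral>x. indicator (- {0}) (y + x) * avoid M {0} m (y + x) \<partial>M)"
    proof (rule integral_mono)
      show "integrable M (\<lambda>x. indicator (- At) x * (indicator (- {0}) (y + x) * avoid M {0} m (y + x)))"
        using avoid_bounds[of "{0}" m] by (intro integrable_const_bound[where B = 1]) (auto simp: indicator_def)
      show "integrable M (\<lambda>x. indicator (- {0}) (y + x) * avoid M {0} m (y + x))"
        by (rule avoid_integrable) auto
    qed (use avoid_nonneg[of "{0}" m] in \<open>auto simp: indicator_def\<close>)
    finally show ?thesis unfolding Suc by simp
  qed
  with \<kappa> show ?thesis by (rule that)
qed

subsection \<open>From the probability space to the walk kernel\<close>

context prob_space
begin

text \<open>Puts the start at index 0 of a single independent family, so that past and next step can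
  be separated by restricting indices. Independence is given relative to the sigma-algebra of the
  partial sums, which contains each step as a difference of consecutive sums.\<close>

lemma indep_vars_case_nat:
  fixes X :: "nat \<Rightarrow> 'a \<Rightarrow> real" and S :: "nat \<Rightarrow> 'a \<Rightarrow> real"
  assumes X: "indep_vars (\<lambda>_. borel) X UNIV" and Y0 [measurable]: "Y0 \<in> borel_measurable M"
    and S: "\<And>n \<omega>. S n \<omega> = (\<Sum>i<n. X i \<omega>)"
    and prod: "\<And>B E. B \<in> sets borel \<Longrightarrow>
      E \<in> sigma_sets (space M) (\<Union>n. {S n -` C \<inter> space M | C. C \<in> sets borel}) \<Longrightarrow>
      prob ((Y0 -` B \<inter> space M) \<inter> E) = prob (Y0 -` B \<inter> space M) * prob E"
  shows "indep_vars (\<lambda>_. borel) (case_nat Y0 X) UNIV"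
proof -
  have Xm [measurable]: "X i \<in> borel_measurable M" for i using X by (auto simp: indep_vars_def2)
  have Xsets: "indep_sets (\<lambda>i. {X i -` A \<inter> space M |A. A \<in> sets borel}) UNIV"
    using X by (auto simp: indep_vars_def2)
  define H where "H = (\<Union>n. {S n -` C \<inter> space M | C. C \<in> sets borel})"
  define T where "T = sigma (space M) H"
  have H: "H \<subseteq> Pow (space M)" by (auto simp: H_def)
  have sT: "sets T = sigma_sets (space M) H" "space T = space M"
    using H by (auto simp: T_def)
  have ST: "S n \<in> borel_measurable T" for n
  proof (rule measurableI)
    fix C :: "real set" assume "C \<in> sets borel"
    then show "S n -` C \<inter> space T \<in> sets T" unfolding sT by (intro sigma_sets.Basic) (auto simp: H_def)
  qed simp
  have "X i = (\<lambda>\<omega>. S (Suc i) \<omega> - S i \<omega>)" for i by (auto simp: S)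
  then have XT: "X i \<in> borel_measurable T" for i using ST by (simp only: borel_measurable_diff)
  have "indep_sets (\<lambda>i. {case_nat Y0 X i -` A \<inter> space M |A. A \<in> sets borel}) UNIV"
  proof (rule indep_setsI)
    fix i show "{case_nat Y0 X i -` A \<inter> space M |A. A \<in> sets borel} \<subseteq> events" by (cases i) auto
  next
    fix A and J :: "nat set"
    assume J: "J \<noteq> {}" "finite J" and A: "\<forall>j\<in>J. A j \<in> {case_nat Y0 X j -` B \<inter> space M |B. B \<in> sets borel}"
    \<comment> \<open>The indices of the steps occurring in \<open>J\<close>, with the shift caused
      by the start undone.\<close>
    define J' where "J' = {i. Suc i \<in> J}"
    have J': "finite J'" using J(2) finite_vimageI[of J Suc] by (simp add: J'_def vimage_def)
    have Jeq: "J = (if 0 \<in> J then {0} else {}) \<union> Suc ` J'"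
    proof safe
      fix i assume "i \<in> J" "i \<notin> Suc ` J'"
      then show "i \<in> (if 0 \<in> J then {0} else {})" by (cases i) (auto simp: J'_def)
    qed (auto simp: J'_def split: if_splits)
    have A': "A (Suc i) \<in> {X i -` B \<inter> space M |B. B \<in> sets borel}" if "i \<in> J'" for i
      using bspec[OF A, of "Suc i"] that by (simp add: J'_def)
    show "prob (\<Inter>j\<in>J. A j) = (\<Prod>j\<in>J. prob (A j))"
    proof (cases "J' = {}")
      case True
      then have "J = {0}" using Jeq J(1) by (auto split: if_splits)
      then show ?thesis by simp
    next
      case False
      define E where "E = (\<Inter>i\<in>J'. A (Suc i))"
      have pE: "prob E = (\<Prod>i\<in>J'. prob (A (Suc i)))"
        unfolding E_def using A' J' False by (intro indep_setsD[OF Xsets]) auto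
      have "A (Suc i) \<in> sets T" if i: "i \<in> J'" for i
      proof -
        from A'[OF i] obtain B where B: "B \<in> sets borel" "A (Suc i) = X i -` B \<inter> space M" by blast
        have "X i -` B \<inter> space T \<in> sets T" using XT B(1) by (rule measurable_sets)
        with B(2) show ?thesis by (simp add: sT(2))
      qed
      then have "E \<in> sets T" unfolding E_def using J' False by (intro sets.finite_INT) auto
      then have ES: "E \<in> sigma_sets (space M) H" by (simp add: sT)
      have pr: "(\<Prod>j\<in>Suc ` J'. prob (A j)) = prob E"
        unfolding pE by (subst prod.reindex) auto
      show ?thesis
      proof (cases "0 \<in> J")
        case True
        then have Je: "J = insert 0 (Suc ` J')" using Jeq by auto
        obtain B where B: "B \<in> sets borel" "A 0 = Y0 -` B \<inter> space M" using A True by auto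
        have "(\<Inter>j\<in>J. A j) = A 0 \<inter> E" unfolding Je E_def by auto
        then have "prob (\<Inter>j\<in>J. A j) = prob (A 0) * prob E" using prod[OF B(1), of E] ES B(2) by (simp add: H_def)
        also have "\<dots> = (\<Prod>j\<in>J. prob (A j))" unfolding Je using J' pr by simp
        finally show ?thesis .
      next
        case False
        then have Je: "J = Suc ` J'" using Jeq by auto
        have "(\<Inter>j\<in>J. A j) = E" unfolding Je E_def by auto
        then show ?thesis using pr by (simp add: Je)
      qed
    qed
  qed
  moreover have "case_nat Y0 X i \<in> borel_measurable M" for i by (cases i) auto
  ultimately show ?thesis by (simp add: indep_vars_def2)
qed

text \<open>The Markov property. In the proof \<open>a j\<close> tests the first \<open>j\<close>
  positions pathwise and the remaining n - j through the kernel. It does not depend on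
  \<open>j\<close>, and its values at 0 and n are the two sides.\<close>

lemma prob_avoid:
  fixes X :: "nat \<Rightarrow> 'a \<Rightarrow> real" and S :: "nat \<Rightarrow> 'a \<Rightarrow> real"
  assumes ind: "indep_vars (\<lambda>_. borel) (case_nat Y0 X) UNIV"
    and ident: "\<And>i. distr M borel (X i) = D"
    and S: "\<And>n \<omega>. S n \<omega> = (\<Sum>i<n. X i \<omega>)" and [measurable]: "B \<in> sets borel"
  shows "prob {\<omega> \<in> space M. \<forall>k\<in>{1..n}. Y0 \<omega> - x + S k \<omega> \<notin> B} =
    (\<integral>y. avoid D B n y \<partial>distr M borel (\<lambda>\<omega>. Y0 \<omega> - x))"
proof -
  have rv: "case_nat Y0 X i \<in> borel_measurable M" for i using ind by (auto simp: indep_vars_def2)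
  have Y0 [measurable]: "Y0 \<in> borel_measurable M" using rv[of 0] by simp
  have Xm [measurable]: "X i \<in> borel_measurable M" for i using rv[of "Suc i"] by simp
  have [measurable]: "S k \<in> borel_measurable M" for k unfolding S by measurable
  have D: "real_distribution D" unfolding ident[of 0, symmetric] by (rule real_distribution_distr) simp
  interpret D: real_distribution D by (rule D)
  define Z where "Z k \<omega> = Y0 \<omega> - x + S k \<omega>" for k \<omega>
  have [measurable]: "Z k \<in> borel_measurable M" for k unfolding Z_def by measurable
  define I where "I j \<omega> = (\<Prod>k=1..j. indicator (- B) (Z k \<omega>) :: real)" for j \<omega>
  have [measurable]: "I j \<in> borel_measurable M" for j unfolding I_def by measurable
  have I01: "0 \<le> I j \<omega>" "I j \<omega> \<le> 1" for j \<omega>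
    unfolding I_def by (auto intro!: prod_nonneg prod_le_1)
  define a where "a j = expectation (\<lambda>\<omega>. I j \<omega> * avoid D B (n - j) (Z j \<omega>))" for j
  have step: "a j = a (Suc j)" if j: "j < n" for j
  proof -
    define m where "m = n - Suc j"
    have nj: "n - j = Suc m" using j by (simp add: m_def)
    define g where "g y = indicator (- B) y * avoid D B m y" for y
    have [measurable]: "g \<in> borel_measurable borel" unfolding g_def by measurable
    have g: "\<bar>g y\<bar> \<le> 1" for y using D.avoid_bounds[of B m y] by (auto simp: g_def indicator_def)
    define P where "P \<omega> = (I j \<omega>, Z j \<omega>)" for \<omega>
    have Pm [measurable]: "P \<in> M \<rightarrow>\<^sub>M borel \<Otimes>\<^sub>M borel" unfolding P_def by measurable
    \<comment> \<open>The dummy second component gives \<open>Q\<close> the same type as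
      \<open>P\<close>, as \<open>indep_var\<close> demands.\<close>
    define Q where "Q \<omega> = (X j \<omega>, 0 :: real)" for \<omega>
    have Qm [measurable]: "Q \<in> M \<rightarrow>\<^sub>M borel \<Otimes>\<^sub>M borel" unfolding Q_def by measurable
    \<comment> \<open>\<open>P\<close> depends on the coordinates 0 to \<open>j\<close>, that is on
      the start and the first \<open>j\<close> steps. \<open>Q\<close> depends on coordinate
      \<open>Suc j\<close>, which is the step \<open>X j\<close>.\<close>
    have indP: "indep_var (borel \<Otimes>\<^sub>M borel) P (borel \<Otimes>\<^sub>M borel) Q"
    proof -
      let ?Pi = "Pi\<^sub>M {..j} (\<lambda>_. borel :: real measure)"
      define z where "z k f = f 0 - x + (\<Sum>i<k. f (Suc i))" for k and f :: "nat \<Rightarrow> real"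
      have zm: "z k \<in> borel_measurable ?Pi" if "k \<le> j" for k
        unfolding z_def using that
        by (intro borel_measurable_add borel_measurable_diff borel_measurable_sum borel_measurable_const measurable_component_singleton) auto
      define Fn where "Fn f = ((\<Prod>k=1..j. indicator (- B) (z k f) :: real), z j f)" for f
      have ind_m: "(indicator (- B) :: real \<Rightarrow> real) \<in> borel_measurable borel" by simp
      have Fm: "Fn \<in> ?Pi \<rightarrow>\<^sub>M borel \<Otimes>\<^sub>M borel"
        unfolding Fn_def using zm
        by (intro measurable_Pair borel_measurable_prod measurable_compose[OF _ ind_m]) auto
      have Gm: "(\<lambda>f. (f (Suc j), 0)) \<in> Pi\<^sub>M {Suc j} (\<lambda>_. borel :: real measure) \<rightarrow>\<^sub>M borel \<Otimes>\<^sub>M borel"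
        by (intro measurable_Pair measurable_component_singleton measurable_const) auto
      have "indep_var (borel \<Otimes>\<^sub>M borel) (Fn \<circ> (\<lambda>\<omega>. restrict (\<lambda>i. case_nat Y0 X i \<omega>) {..j}))
         (borel \<Otimes>\<^sub>M borel) ((\<lambda>f. (f (Suc j), 0)) \<circ> (\<lambda>\<omega>. restrict (\<lambda>i. case_nat Y0 X i \<omega>) {Suc j}))"
        by (rule indep_var_compose[OF indep_var_restrict[OF ind] Fm Gm]) auto
      moreover have "Fn \<circ> (\<lambda>\<omega>. restrict (\<lambda>i. case_nat Y0 X i \<omega>) {..j}) = P"
      proof
        fix \<omega>
        have "z k (restrict (\<lambda>i. case_nat Y0 X i \<omega>) {..j}) = Z k \<omega>" if "k \<le> j" for k
          unfolding z_def Z_def S using that by (intro arg_cong2[where f = "(+)"] sum.cong) auto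
        then show "(Fn \<circ> (\<lambda>\<omega>. restrict (\<lambda>i. case_nat Y0 X i \<omega>) {..j})) \<omega> = P \<omega>"
          unfolding Fn_def P_def I_def comp_def by (auto intro!: prod.cong)
      qed
      moreover have "(\<lambda>f. (f (Suc j), 0)) \<circ> (\<lambda>\<omega>. restrict (\<lambda>i. case_nat Y0 X i \<omega>) {Suc j}) = Q"
        by (auto simp: Q_def)
      ultimately show ?thesis by simp
    qed
    define \<phi> where "\<phi> = (\<lambda>(p::real \<times> real, q::real \<times> real). fst p * g (snd p + fst q))"
    let ?R = "borel \<Otimes>\<^sub>M borel :: (real \<times> real) measure"
    have [measurable]: "\<phi> \<in> borel_measurable (?R \<Otimes>\<^sub>M ?R)" unfolding \<phi>_def by measurable
    have law: "distr M ?R P \<Otimes>\<^sub>M distr M ?R Q = distr M (?R \<Otimes>\<^sub>M ?R) (\<lambda>\<omega>. (P \<omega>, Q \<omega>))"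
      using indP unfolding indep_var_distribution_eq by blast
    interpret LP: prob_space "distr M ?R P" by (rule prob_space_distr) simp
    interpret LQ: prob_space "distr M ?R Q" by (rule prob_space_distr) simp
    interpret LPQ: pair_prob_space "distr M ?R P" "distr M ?R Q" ..
    have bound: "\<bar>I j \<omega> * g y\<bar> \<le> 1" for \<omega> y
      unfolding abs_mult using I01[of j \<omega>] g[of y] mult_mono[of "\<bar>I j \<omega>\<bar>" 1 "\<bar>g y\<bar>" 1] by auto
    have int: "integrable (distr M ?R P \<Otimes>\<^sub>M distr M ?R Q) \<phi>"
      unfolding law
    proof (subst integrable_distr_eq)
      show "integrable M (\<lambda>\<omega>. \<phi> (P \<omega>, Q \<omega>))"
        using bound by (intro integrable_const_bound[where B = 1]) (auto simp: \<phi>_def P_def Q_def)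
    qed auto
    have inner: "(\<integral>q. \<phi> (p, q) \<partial>distr M ?R Q) = fst p * (\<integral>y. g (snd p + y) \<partial>D)" for p
    proof -
      have "(\<integral>q. \<phi> (p, q) \<partial>distr M ?R Q) = expectation (\<lambda>\<omega>. fst p * g (snd p + X j \<omega>))"
        by (subst integral_distr) (auto simp: \<phi>_def Q_def)
      also have "\<dots> = (\<integral>y. fst p * g (snd p + y) \<partial>distr M borel (X j))"
        by (subst integral_distr) auto
      finally show ?thesis by (simp add: ident)
    qed
    have "a j = expectation (\<lambda>\<omega>. \<integral>q. \<phi> (P \<omega>, q) \<partial>distr M ?R Q)"
      unfolding a_def nj inner by (simp add: P_def g_def)
    also have "\<dots> = (\<integral>p. \<integral>q. \<phi> (p, q) \<partial>distr M ?R Q \<partial>distr M ?R P)"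
      by (subst integral_distr) (auto intro!: LQ.borel_measurable_lebesgue_integral)
    also have "\<dots> = integral\<^sup>L (distr M ?R P \<Otimes>\<^sub>M distr M ?R Q) \<phi>"
      by (rule LPQ.integral_fst'[OF int])
    also have "\<dots> = expectation (\<lambda>\<omega>. \<phi> (P \<omega>, Q \<omega>))"
      unfolding law by (subst integral_distr) auto
    also have "\<dots> = a (Suc j)"
      unfolding a_def by (intro Bochner_Integration.integral_cong) (auto simp: \<phi>_def P_def Q_def g_def I_def m_def Z_def S add_ac)
    finally show ?thesis .
  qed
  have "a 0 = a j" if "j \<le> n" for j using that by (induction j) (auto simp: step)
  from this[of n] have "a 0 = a n" by simp
  moreover have "a 0 = (\<integral>y. avoid D B n y \<partial>distr M borel (\<lambda>\<omega>. Y0 \<omega> - x))"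
    by (subst integral_distr) (auto simp: a_def I_def Z_def S)
  moreover have "a n = prob {\<omega> \<in> space M. \<forall>k\<in>{1..n}. Y0 \<omega> - x + S k \<omega> \<notin> B}"
  proof -
    have "a n = expectation (indicator {\<omega> \<in> space M. \<forall>k\<in>{1..n}. Z k \<omega> \<notin> B})"
      unfolding a_def
    proof (intro Bochner_Integration.integral_cong refl)
      fix \<omega> assume w: "\<omega> \<in> space M"
      show "I n \<omega> * avoid D B (n - n) (Z n \<omega>) = indicator {\<omega> \<in> space M. \<forall>k\<in>{1..n}. Z k \<omega> \<notin> B} \<omega>"
      proof (cases "\<forall>k\<in>{1..n}. Z k \<omega> \<notin> B")
        case True
        then have "I n \<omega> = 1" unfolding I_def by (intro prod.neutral) auto
        then show ?thesis using True w by simp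
      next
        case False
        then obtain k where "k \<in> {1..n}" "Z k \<omega> \<in> B" by auto
        then have "I n \<omega> = 0" unfolding I_def by (intro prod_zero) (auto intro!: bexI[of _ k])
        then show ?thesis using False by simp
      qed
    qed
    also have "\<dots> = prob {\<omega> \<in> space M. \<forall>k\<in>{1..n}. Z k \<omega> \<notin> B}" by simp
    finally show ?thesis by (simp add: Z_def)
  qed
  ultimately show ?thesis by simp
qed

lemma walk_law_eq_distr:
  fixes X :: "nat \<Rightarrow> 'a \<Rightarrow> real" and S :: "nat \<Rightarrow> 'a \<Rightarrow> real"
  assumes X: "indep_vars (\<lambda>_. borel) X UNIV"
    and ident: "\<And>i. distr M borel (X i) = D"
    and S: "\<And>n \<omega>. S n \<omega> = (\<Sum>i<n. X i \<omega>)"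
  shows "walk_law D (return borel 0) k = distr M borel (S k)"
proof (induction k)
  case 0
  have "S 0 = (\<lambda>\<omega>. 0)" by (auto simp: S)
  then show ?case by simp
next
  case (Suc k)
  have [measurable]: "X i \<in> borel_measurable M" for i using X by (auto simp: indep_vars_def2)
  have [measurable]: "S k \<in> borel_measurable M" for k unfolding S by measurable
  have "indep_vars (\<lambda>_. borel) X (insert k {..<k})" by (rule indep_vars_subset[OF X]) simp
  then have iv: "indep_var borel (X k) borel (S k)"
    unfolding S by (rule indep_vars_sum[rotated 2]) auto
  have "distr M borel (S (Suc k)) = distr M borel (\<lambda>\<omega>. X k \<omega> + S k \<omega>)" by (simp add: S[abs_def] add.commute)
  also have "\<dots> = convolution D (distr M borel (S k))"
    using sum_indep_random_variable[OF iv] by (simp add: ident)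
  also have "\<dots> = convolution (distr M borel (S k)) D"
    by (intro convolution_commutative) (auto simp: ident[of 0, symmetric] intro!: finite_measure_distr)
  finally show ?case by (simp add: Suc)
qed

end

text \<open>Comparing the exponents at 2t and t, the term t ln t leaves the phase 2 c t b ln 2,
  which must be a multiple of 2 pi for every t > 0. If b were nonzero, t = pi / (2 c |b| ln 2) would
  make it pi or -pi.\<close>

lemma stable1_doubling_symmetric:
  fixes \<Phi> :: "real \<Rightarrow> complex"
  assumes c: "c > 0"
    and \<Phi>: "\<And>t. \<Phi> t = exp (- complex_of_real (c * \<bar>t\<bar>) *
                (1 + \<i> * complex_of_real (\<beta> * (2 / pi) * sgn t * ln \<bar>t\<bar>))
              + \<i> * complex_of_real (m * t))"
    and double: "\<And>t. \<Phi> (2 * t) = \<Phi> t ^ 2"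
  shows "\<beta> = 0"
proof (rule ccontr)
  assume \<beta>: "\<beta> \<noteq> 0"
  define b where "b = \<beta> * (2 / pi)"
  have b: "b \<noteq> 0" using \<beta> by (simp add: b_def)
  have "cos (2 * c * t * b * ln 2) = 1" if t: "t > 0" for t
  proof -
    define w where "w t = - complex_of_real (c * t) * (1 + \<i> * complex_of_real (b * ln t)) + \<i> * complex_of_real (m * t)" for t
    have Pw: "\<Phi> t = exp (w t)" if "t > 0" for t using that by (simp add: \<Phi> w_def b_def)
    have "exp (w (2 * t)) = exp (2 * w t)"
      using double[of t] t by (simp add: Pw exp_double)
    then have "exp (w (2 * t) - 2 * w t) = 1" by (simp add: exp_diff)
    moreover have "w (2 * t) - 2 * w t = \<i> * complex_of_real (- (2 * c * t * b * ln 2))"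
      using t by (simp add: w_def ln_mult algebra_simps)
    ultimately have "Re (iexp (- (2 * c * t * b * ln 2))) = 1" by simp
    then show ?thesis by (simp add: Re_exp)
  qed
  from this[of "pi / (2 * c * \<bar>b\<bar> * ln 2)"] have "cos (pi * (b / \<bar>b\<bar>)) = 1"
    using c b by (simp add: field_simps)
  moreover have "b / \<bar>b\<bar> = 1 \<or> b / \<bar>b\<bar> = -1" using b by (auto simp: abs_if)
  ultimately show False by (auto simp: times_divide_eq_right[symmetric] simp del: times_divide_eq_right)
qed

section \<open>Level crossing of G and the hitting-time event\<close>

lemma Gfun_of_nat: "Gfun A (real m) = (\<Sum>k=1..m. 1 / A k)"
  by (simp add: Gfun_def)

text \<open>\<open>N \<epsilon>\<close> is the last index at which \<gamma> \<epsilon> G is at most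
  t, so a condition on \<open>G\<close> at a hitting time becomes a deterministic horizon. The level
  is missed by less than one summand \<gamma> \<epsilon> / A(N + 1), which tends to 0.\<close>

lemma (in cauchy_domain) G_level_crossing:
  fixes \<gamma> t :: real
  assumes Gtop: "filterlim G at_top sequentially" and \<gamma>: "\<gamma> > 0" and t: "t > 0"
  obtains N :: "real \<Rightarrow> nat" where "\<And>\<epsilon> m. \<epsilon> > 0 \<Longrightarrow> \<gamma> * \<epsilon> * G m \<le> t \<longleftrightarrow> m \<le> N \<epsilon>"
    "filterlim N sequentially (at_right 0)"
    "((\<lambda>\<epsilon>. \<gamma> * \<epsilon> * G (N \<epsilon>)) \<longlongrightarrow> t) (at_right 0)"
proof -
  define N where "N \<epsilon> = Max {n. \<gamma> * \<epsilon> * G n \<le> t}" for \<epsilon>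
  have Gmono: "G m \<le> G n" if "m \<le> n" for m n
    unfolding G_def using that A_pos by (intro sum_mono2) (auto simp: less_imp_le)
  have G0: "G 0 = 0" by (simp add: G_def)
  have iff: "\<gamma> * \<epsilon> * G m \<le> t \<longleftrightarrow> m \<le> N \<epsilon>" if \<epsilon>: "\<epsilon> > 0" for \<epsilon> m
  proof -
    have "\<forall>\<^sub>F n in sequentially. G n > t / (\<gamma> * \<epsilon>)"
      using Gtop[unfolded filterlim_at_top_dense] by blast
    then obtain n0 where n0: "\<And>n. n \<ge> n0 \<Longrightarrow> G n > t / (\<gamma> * \<epsilon>)" by (auto simp: eventually_sequentially)
    have "{n. \<gamma> * \<epsilon> * G n \<le> t} \<subseteq> {..<n0}"
    proof
      fix n assume "n \<in> {n. \<gamma> * \<epsilon> * G n \<le> t}"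
      then have "\<not> G n > t / (\<gamma> * \<epsilon>)" using \<gamma> \<epsilon> by (simp add: field_simps)
      then show "n \<in> {..<n0}" using n0 by (meson lessThan_iff not_le)
    qed
    then have fin: "finite {n. \<gamma> * \<epsilon> * G n \<le> t}" by (rule finite_subset) simp
    have "0 \<in> {n. \<gamma> * \<epsilon> * G n \<le> t}" using t by (simp add: G0)
    then have "N \<epsilon> \<in> {n. \<gamma> * \<epsilon> * G n \<le> t}" unfolding N_def using fin by (intro Max_in) auto
    then have N: "\<gamma> * \<epsilon> * G (N \<epsilon>) \<le> t" by simp
    show ?thesis
    proof
      assume "\<gamma> * \<epsilon> * G m \<le> t"
      then show "m \<le> N \<epsilon>" unfolding N_def using fin by (intro Max_ge) auto
    next
      assume "m \<le> N \<epsilon>"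
      then have "\<gamma> * \<epsilon> * G m \<le> \<gamma> * \<epsilon> * G (N \<epsilon>)" using \<gamma> \<epsilon> by (intro mult_left_mono Gmono) auto
      with N show "\<gamma> * \<epsilon> * G m \<le> t" by simp
    qed
  qed
  have pos: "\<forall>\<^sub>F \<epsilon> in at_right 0. (0::real) < \<epsilon>" by (simp add: eventually_at_right_less)
  have Ntop: "filterlim N sequentially (at_right 0)"
    unfolding filterlim_at_top
  proof
    fix n
    have "((\<lambda>\<epsilon>. \<gamma> * \<epsilon> * G n) \<longlongrightarrow> \<gamma> * 0 * G n) (at_right 0)" by (intro tendsto_intros)
    then have "\<forall>\<^sub>F \<epsilon> in at_right 0. \<gamma> * \<epsilon> * G n < t" by (rule order_tendstoD) (simp add: t)
    with pos show "\<forall>\<^sub>F \<epsilon> in at_right 0. n \<le> N \<epsilon>"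
      by eventually_elim (use iff in \<open>auto intro: less_imp_le\<close>)
  qed
  have "(\<lambda>n. 1 / A n) \<longlonglongrightarrow> 0"
    by (rule tendsto_divide_0[OF tendsto_const filterlim_at_top_imp_at_infinity[OF A_at_top]])
  then have "(\<lambda>n. 1 / A (Suc n)) \<longlonglongrightarrow> 0" by (rule LIMSEQ_Suc)
  from filterlim_compose[OF this Ntop]
  have A0: "((\<lambda>\<epsilon>. 1 / A (Suc (N \<epsilon>))) \<longlongrightarrow> 0) (at_right 0)" .
  have "((\<lambda>\<epsilon>. \<gamma> * \<epsilon> * G (N \<epsilon>)) \<longlongrightarrow> t) (at_right 0)"
  proof (rule tendsto_sandwich)
    have "((\<lambda>\<epsilon>. t - \<gamma> * \<epsilon> * (1 / A (Suc (N \<epsilon>)))) \<longlongrightarrow> t - \<gamma> * 0 * 0) (at_right 0)"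
      by (intro tendsto_intros A0)
    then show "((\<lambda>\<epsilon>. t - \<gamma> * \<epsilon> * (1 / A (Suc (N \<epsilon>)))) \<longlongrightarrow> t) (at_right 0)" by simp
    show "((\<lambda>\<epsilon>. t) \<longlongrightarrow> t) (at_right (0::real))" by simp
    show "\<forall>\<^sub>F \<epsilon> in at_right 0. \<gamma> * \<epsilon> * G (N \<epsilon>) \<le> t"
      using pos by eventually_elim (simp add: iff)
    show "\<forall>\<^sub>F \<epsilon> in at_right 0. t - \<gamma> * \<epsilon> * (1 / A (Suc (N \<epsilon>))) \<le> \<gamma> * \<epsilon> * G (N \<epsilon>)"
      using pos
    proof eventually_elim
      case (elim \<epsilon>)
      have "\<not> \<gamma> * \<epsilon> * G (Suc (N \<epsilon>)) \<le> t" using iff[OF elim, of "Suc (N \<epsilon>)"] by simp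
      moreover have "G (Suc (N \<epsilon>)) = G (N \<epsilon>) + 1 / A (Suc (N \<epsilon>))" by (simp add: G_def)
      ultimately show ?case by (simp add: distrib_left)
    qed
  qed
  with iff Ntop show ?thesis by (rule that)
qed

text \<open>A hitting time is an integer or infinite, so \<open>Gfun\<close> matters here only at
  integers. A path that never hits fails on both sides.\<close>

lemma hit_time_event:
  assumes N: "\<And>m. \<gamma> * \<epsilon> * Gfun A (real m) \<le> t \<longleftrightarrow> m \<le> (n::nat)"
  shows "(case hit_time S' x \<epsilon> \<omega> of enat m \<Rightarrow> \<gamma> * \<epsilon> * Gfun A (real m) \<le> t | \<infinity> \<Rightarrow> False)
    \<longleftrightarrow> (\<exists>m\<in>{1..n}. \<bar>S' m \<omega> - x\<bar> < \<epsilon>)"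
proof (cases "\<exists>m\<ge>1. \<bar>S' m \<omega> - x\<bar> < \<epsilon>")
  case True
  define l where "l = (LEAST m. m \<ge> 1 \<and> \<bar>S' m \<omega> - x\<bar> < \<epsilon>)"
  have l: "l \<ge> 1 \<and> \<bar>S' l \<omega> - x\<bar> < \<epsilon>" 
    unfolding l_def by (rule LeastI_ex[where P = "\<lambda>m. m \<ge> 1 \<and> \<bar>S' m \<omega> - x\<bar> < \<epsilon>"]) (use True in blast)
  have le: "l \<le> m" if "m \<ge> 1" "\<bar>S' m \<omega> - x\<bar> < \<epsilon>" for m
    unfolding l_def using that by (intro Least_le conjI)
  have "hit_time S' x \<epsilon> \<omega> = enat l" using True by (simp add: hit_time_def l_def)
  then have "(case hit_time S' x \<epsilon> \<omega> of enat m \<Rightarrow> \<gamma> * \<epsilon> * Gfun A (real m) \<le> t | \<infinity> \<Rightarrow> False) \<longleftrightarrow> l \<le> n"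
    by (simp only: enat.case N)
  also have "\<dots> \<longleftrightarrow> (\<exists>m\<in>{1..n}. \<bar>S' m \<omega> - x\<bar> < \<epsilon>)"
  proof
    assume "l \<le> n"
    then show "\<exists>m\<in>{1..n}. \<bar>S' m \<omega> - x\<bar> < \<epsilon>" using l by (intro bexI[of _ l]) auto
  next
    assume "\<exists>m\<in>{1..n}. \<bar>S' m \<omega> - x\<bar> < \<epsilon>"
    then obtain m where "1 \<le> m" "m \<le> n" "\<bar>S' m \<omega> - x\<bar> < \<epsilon>" by auto
    then show "l \<le> n" using le[of m] by simp
  qed
  finally show ?thesis .
next
  case False
  then have "hit_time S' x \<epsilon> \<omega> = \<infinity>" by (simp add: hit_time_def)
  with False show ?thesis by auto
qed

theorem theorem1p2:
  fixes M :: "'a measure"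
    and X :: "nat \<Rightarrow> 'a \<Rightarrow> real"
    and S :: "nat \<Rightarrow> 'a \<Rightarrow> real"
    and S0' :: "'a \<Rightarrow> real"
    and A :: "nat \<Rightarrow> real"
    and \<mu> :: "real measure"
    and f :: "real \<Rightarrow> real"
    and x t :: real
  assumes M: "prob_space M"
    and indep: "prob_space.indep_vars M (\<lambda>_. borel) X UNIV"
    and ident: "\<And>i. distr M borel (X i) = distr M borel (X 0)"
    and S_def: "\<And>n \<omega>. S n \<omega> = (\<Sum>i<n. X i \<omega>)"
    and recurrent: "rw_recurrent M S"
    and A_pos: "\<And>n. A n > 0"
    and conv: "weak_conv_m (\<lambda>n. distr M borel (\<lambda>\<omega>. S n \<omega> / A n)) \<mu>"
    and stable: "stable1 \<mu>"
    and dens: "\<mu> = density lborel (\<lambda>y. ennreal (f y))"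
    and f_nonneg: "\<And>y. f y \<ge> 0"
    and f_cont: "continuous_on UNIV f"
    and cramer: "Limsup at_infinity (\<lambda>s::real. ereal (norm (char (distr M borel (X 0)) s))) < 1"
    and S0'_meas: "S0' \<in> borel_measurable M"
    and S0'_indep: "prob_space.indep_set M
        {S0' -` B \<inter> space M | B. B \<in> sets borel}
        (sigma_sets (space M) (\<Union>n. {S n -` C \<inter> space M | C. C \<in> sets borel}))"
    and t_pos: "t > 0"
  shows
    "let S' = (\<lambda>n \<omega>. S0' \<omega> + S n \<omega>);
         \<Omega>x = {\<omega> \<in> space M. \<forall>n\<ge>1. S' n \<omega> \<noteq> x};
         \<Omega>s = {\<omega> \<in> space M. \<forall>n\<ge>1. S n \<omega> \<noteq> 0};
         \<gamma> = 2 * f 0 * measure M \<Omega>s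
     in ((\<lambda>\<epsilon>. cprob M
            {\<omega> \<in> space M. case hit_time S' x \<epsilon> \<omega> of
                enat m \<Rightarrow> \<gamma> * \<epsilon> * Gfun A (real m) \<le> t
              | \<infinity> \<Rightarrow> False} \<Omega>x)
         \<longlongrightarrow> t / (1 + t)) (at_right 0)"
proof -
  interpret prob_space M by (rule M)
  define D where "D = distr M borel (X 0)"
  have ident': "distr M borel (X i) = D" for i unfolding D_def by (rule ident)
  have Xm [measurable]: "X i \<in> borel_measurable M" for i using indep by (auto simp: indep_vars_def2)
  have Sm [measurable]: "S n \<in> borel_measurable M" for n unfolding S_def by measurable
  note S0'_meas [measurable]
  have D: "real_distribution D" unfolding D_def by (rule real_distribution_distr) simp
  have mu: "real_distribution \<mu>" using stable by (simp add: stable1_def)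
  interpret mu: real_distribution \<mu> by (rule mu)
  from stable obtain c \<beta> m where c: "c > 0" and \<Phi>: "\<And>t. char \<mu> t = exp (- complex_of_real (c * \<bar>t\<bar>) *
                (1 + \<i> * complex_of_real (\<beta> * (2 / pi) * sgn t * ln \<bar>t\<bar>))
              + \<i> * complex_of_real (m * t))"
    unfolding stable1_def by blast
  have char_n: "char (distr M borel (\<lambda>\<omega>. S n \<omega> / A n)) s = char D (s / A n) ^ n" for n s
  proof -
    have "char (distr M borel (\<lambda>\<omega>. S n \<omega> / A n)) s = char (distr M borel (\<lambda>\<omega>. \<Sum>i<n. X i \<omega>)) (s / A n)"
      unfolding char_def by (simp add: integral_distr S_def[symmetric])
    also have "\<dots> = (\<Prod>i<n. char (distr M borel (X i)) (s / A n))"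
      by (rule char_distr_sum) (rule indep_vars_subset[OF indep], simp)
    finally show ?thesis by (simp add: ident')
  qed
  \<comment> \<open>The modulus of the limit sees neither \<open>\<beta>\<close> nor
    \<open>m\<close>, so the locale is available before the skewness is excluded.\<close>
  interpret C: cauchy_domain D A "char \<mu>" c
  proof (unfold cauchy_domain_def cauchy_domain_axioms_def, intro conjI allI impI)
    show "real_distribution D" by (rule D)
    show "0 < A n" for n by (rule A_pos)
    show "0 < c" by (rule c)
    show "isCont (char \<mu>) s" for s by (rule mu.isCont_char)
    show "cmod (char \<mu> s) = exp (- c * \<bar>s\<bar>)" for s by (simp add: \<Phi>)
    show "Limsup at_infinity (\<lambda>s. ereal (cmod (char D s))) < 1" using cramer by (simp add: D_def)
    fix e K :: real assume "0 < e"
    from char_uniform_convergence_on_compacts[OF _ mu conv this, of K]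
    show "\<forall>\<^sub>F n in sequentially. \<forall>s. \<bar>s\<bar> \<le> K \<longrightarrow> cmod (char D (s / A n) ^ n - char \<mu> s) \<le> e"
      by (simp add: char_n)
  qed
  have \<beta>: "\<beta> = 0" using c \<Phi> C.Phi_double by (rule stable1_doubling_symmetric)
  have f0: "C.local_density > 0" by (rule C.local_density_pos[where m = m]) (simp add: \<Phi> \<beta>)
  have ff: "f 0 = C.local_density" by (rule C.density_at_0[OF mu refl dens f_nonneg f_cont])
  have nu0: "real_distribution (return borel (0::real))" by (rule real_distribution_return)
  have wl: "walk_law D (return borel 0) k = distr M borel (S k)" for k
    by (rule walk_law_eq_distr[OF indep ident' S_def])
  have Gtop: "filterlim C.G at_top sequentially"
  proof (rule C.G_at_top[OF nu0])
    show "\<not> summable (\<lambda>k. measure (walk_law D (return borel 0) k) {w. \<bar>w\<bar> < 1 / 2})"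
    proof
      assume "summable (\<lambda>k. measure (walk_law D (return borel 0) k) {w. \<bar>w\<bar> < 1 / 2})"
      moreover have "measure (walk_law D (return borel 0) k) {w. \<bar>w\<bar> < 1 / 2} = prob {\<omega> \<in> space M. \<bar>S k \<omega>\<bar> < 1 / 2}" for k
        unfolding wl by (subst measure_distr) (auto intro!: arg_cong[where f = prob])
      ultimately have "summable (\<lambda>k. prob {\<omega> \<in> space M. \<bar>S k \<omega>\<bar> < 1 / 2})" by simp
      \<comment> \<open>Borel-Cantelli: almost surely only finitely many visits to (-1/2, 1/2),
        contradicting recurrence.\<close>
      then have "AE \<omega> in M. \<forall>\<^sub>F k in sequentially. \<omega> \<in> space M - {\<omega> \<in> space M. \<bar>S k \<omega>\<bar> < 1 / 2}"
        by (intro borel_cantelli_AE1) (auto simp: less_top[symmetric])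
      moreover have "AE \<omega> in M. \<exists>\<^sub>\<infinity>n. \<bar>S n \<omega>\<bar> < 1 / 2" 
        by (rule recurrent[unfolded rw_recurrent_def, rule_format]) simp
      ultimately have "AE \<omega> in M. False"
      proof eventually_elim
        case (elim \<omega>)
        from elim(1) have "\<forall>\<^sub>F k in sequentially. \<not> \<bar>S k \<omega>\<bar> < 1 / 2" by eventually_elim auto
        then have "\<not> (\<exists>\<^sub>\<infinity>n. \<bar>S n \<omega>\<bar> < 1 / 2)" 
          unfolding cofinite_eq_sequentially frequently_def by simp
        with elim(2) show False by simp
      qed
      then show False by simp
    qed
  qed
  \<comment> \<open>Subtracting \<open>x\<close> moves the target to 0, so that \<open>x\<close> and
    the law of \<open>S0'\<close> enter only through the initial law.\<close>
  define \<nu> where "\<nu> = distr M borel (\<lambda>\<omega>. S0' \<omega> - x)"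
  have nu: "real_distribution \<nu>" unfolding \<nu>_def by (rule real_distribution_distr) simp
  interpret nu: real_distribution \<nu> by (rule nu)
  have indS: "indep_vars (\<lambda>_. borel) (case_nat S0' X) UNIV"
    using S0'_indep by (intro indep_vars_case_nat[OF indep S0'_meas S_def] indep_setD) auto
  \<comment> \<open>A constant start is independent of any event. This instance describes the walk
    from 0 and thereby identifies v with \<open>prob \<Omega>s\<close>.\<close>
  have ind0: "indep_vars (\<lambda>_. borel) (case_nat (\<lambda>\<omega>. 0) X) UNIV"
  proof (rule indep_vars_case_nat[OF indep _ S_def])
    fix B :: "real set" and E
    assume E: "E \<in> sigma_sets (space M) (\<Union>n. {S n -` C \<inter> space M | C. C \<in> sets borel})"
    have "E \<subseteq> space M" by (rule sigma_sets_into_sp[OF _ E]) auto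
    then have "space M \<inter> E = E" by auto
    then show "prob (((\<lambda>\<omega>. 0) -` B \<inter> space M) \<inter> E) = prob ((\<lambda>\<omega>. 0) -` B \<inter> space M) * prob E"
      by (cases "0 \<in> B") (auto simp: prob_space)
  qed simp
  define \<Omega>x where "\<Omega>x = {\<omega> \<in> space M. \<forall>n\<ge>1. S0' \<omega> + S n \<omega> \<noteq> x}"
  define \<Omega>s where "\<Omega>s = {\<omega> \<in> space M. \<forall>n\<ge>1. S n \<omega> \<noteq> 0}"
  define F where "F n = {\<omega> \<in> space M. \<forall>k\<in>{1..n}. S0' \<omega> - x + S k \<omega> \<notin> {0}}" for n
  have Fm [measurable]: "F n \<in> sets M" for n unfolding F_def by measurable
  have Fx: "(\<Inter>n. F n) = \<Omega>x"
  proof safe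
    fix \<omega> assume w: "\<omega> \<in> (\<Inter>n. F n)"
    have "S0' \<omega> + S n \<omega> \<noteq> x" if "n \<ge> 1" for n
      using w that by (auto simp: F_def dest!: spec[of _ n])
    then show "\<omega> \<in> \<Omega>x" using w by (auto simp: \<Omega>x_def F_def)
  qed (auto simp: \<Omega>x_def F_def)
  have [measurable]: "\<Omega>x \<in> sets M" unfolding Fx[symmetric] by measurable
  have "(\<lambda>n. prob (F n)) \<longlonglongrightarrow> prob \<Omega>x"
    unfolding Fx[symmetric] by (rule finite_Lim_measure_decseq) (auto simp: decseq_def F_def)
  moreover have PF: "prob (F n) = (\<integral>y. avoid D {0} n y \<partial>\<nu>)" for n
    unfolding F_def \<nu>_def by (rule prob_avoid[OF indS ident' S_def]) simp
  ultimately have u: "(\<lambda>n. \<integral>y. avoid D {0} n y \<partial>\<nu>) \<longlonglongrightarrow> prob \<Omega>x" by simp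
  have v: "(\<lambda>n. avoid D {0} n 0) \<longlonglongrightarrow> prob \<Omega>s"
  proof -
    define H where "H n = {\<omega> \<in> space M. \<forall>k\<in>{1..n}. 0 - 0 + S k \<omega> \<notin> {0}}" for n
    have Hs: "(\<Inter>n. H n) = \<Omega>s"
    proof safe
      fix \<omega> assume w: "\<omega> \<in> (\<Inter>n. H n)"
      have "S n \<omega> \<noteq> 0" if "n \<ge> 1" for n
        using w that by (auto simp: H_def dest!: spec[of _ n])
      then show "\<omega> \<in> \<Omega>s" using w by (auto simp: \<Omega>s_def H_def)
    qed (auto simp: \<Omega>s_def H_def)
    have [measurable]: "H n \<in> sets M" for n unfolding H_def by measurable
    have "(\<lambda>n. prob (H n)) \<longlonglongrightarrow> prob \<Omega>s"
      unfolding Hs[symmetric] by (rule finite_Lim_measure_decseq) (auto simp: decseq_def H_def)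
    moreover have "prob (H n) = avoid D {0} n 0" for n
    proof -
      have "prob (H n) = (\<integral>y. avoid D {0} n y \<partial>distr M borel (\<lambda>\<omega>. 0 - 0))"
        unfolding H_def by (rule prob_avoid[OF ind0 ident' S_def]) simp
      also have "\<dots> = avoid D {0} n 0" by (subst integral_distr) (auto simp: prob_space)
      finally show ?thesis .
    qed
    ultimately show ?thesis by simp
  qed
  obtain \<kappa> where \<kappa>: "\<kappa> > 0" "\<And>n y. avoid D {0} n y \<ge> \<kappa>"
    by (rule C.avoid_point_bounded_below[OF C.cramer_not_purely_atomic[OF C.cramer]]) blast
  have ux: "prob \<Omega>x > 0"
  proof -
    have "\<kappa> \<le> (\<integral>y. avoid D {0} n y \<partial>\<nu>)" for n
      using \<kappa>(2) C.avoid_bounds[of "{0}" n]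
      by (intro nu.integral_ge_const nu.integrable_const_bound[where B = 1]) auto
    then have "\<kappa> \<le> prob \<Omega>x" by (intro LIMSEQ_le_const[OF u]) auto
    with \<kappa>(1) show ?thesis by simp
  qed
  have vs: "prob \<Omega>s > 0"
  proof -
    have "\<kappa> \<le> prob \<Omega>s" using \<kappa>(2) by (intro LIMSEQ_le_const[OF v]) auto
    with \<kappa>(1) show ?thesis by simp
  qed
  define \<gamma> where "\<gamma> = 2 * f 0 * prob \<Omega>s"
  have \<gamma>: "\<gamma> > 0" using f0 vs by (simp add: \<gamma>_def ff)
  obtain N where N: "\<And>\<epsilon> m. \<epsilon> > 0 \<Longrightarrow> \<gamma> * \<epsilon> * C.G m \<le> t \<longleftrightarrow> m \<le> N \<epsilon>"
    and Ntop: "filterlim N sequentially (at_right 0)"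
    and Nlim: "((\<lambda>\<epsilon>. \<gamma> * \<epsilon> * C.G (N \<epsilon>)) \<longlongrightarrow> t) (at_right 0)"
    by (rule C.G_level_crossing[OF Gtop \<gamma> t_pos]) blast
  have alim: "((\<lambda>\<epsilon>. \<integral>y. avoid D {-\<epsilon><..<\<epsilon>} (N \<epsilon>) y \<partial>\<nu>) \<longlongrightarrow> prob \<Omega>x / (1 + t)) (at_right 0)"
    using Nlim by (intro C.avoid_interval_limit[OF nu f0 Gtop u v Ntop t_pos]) (simp add: \<gamma>_def ff)
  define K where "K \<epsilon> = {\<omega> \<in> space M. \<forall>k\<in>{1..N \<epsilon>}. S0' \<omega> - x + S k \<omega> \<notin> {-\<epsilon><..<\<epsilon>}}" for \<epsilon>
  have [measurable]: "K \<epsilon> \<in> sets M" for \<epsilon> unfolding K_def by measurable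
  have PK: "prob (K \<epsilon>) = (\<integral>y. avoid D {-\<epsilon><..<\<epsilon>} (N \<epsilon>) y \<partial>\<nu>)" for \<epsilon>
    unfolding K_def \<nu>_def by (rule prob_avoid[OF indS ident' S_def]) simp
  have Klim: "((\<lambda>\<epsilon>. prob (K \<epsilon>)) \<longlongrightarrow> prob \<Omega>x / (1 + t)) (at_right 0)" unfolding PK by (rule alim)
  have pos: "\<forall>\<^sub>F \<epsilon> in at_right 0. (0::real) < \<epsilon>" by (simp add: eventually_at_right_less)
  \<comment> \<open>These paths miss the interval up to the horizon but hit \<open>x\<close> exactly
    at some later time. They lie in \<open>F (N \<epsilon>) - \<Omega>x\<close>, whose probability
    tends to 0, so in the limit \<open>K \<epsilon>\<close> behaves like a subset of
    \<open>\<Omega>x\<close>.\<close>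
  have diff: "((\<lambda>\<epsilon>. prob (K \<epsilon> - \<Omega>x)) \<longlongrightarrow> 0) (at_right 0)"
  proof (rule tendsto_sandwich[where f = "\<lambda>_. 0"])
    show "\<forall>\<^sub>F \<epsilon> in at_right 0. prob (K \<epsilon> - \<Omega>x) \<le> prob (F (N \<epsilon>)) - prob \<Omega>x"
      using pos
    proof eventually_elim
      case (elim \<epsilon>)
      have "prob (K \<epsilon> - \<Omega>x) \<le> prob (F (N \<epsilon>) - \<Omega>x)"
        using elim by (intro finite_measure_mono) (auto simp: K_def F_def)
      also have "\<dots> = prob (F (N \<epsilon>)) - prob \<Omega>x"
        using Fx by (intro finite_measure_Diff) auto
      finally show ?case .
    qed
    have "((\<lambda>\<epsilon>. prob (F (N \<epsilon>)) - prob \<Omega>x) \<longlongrightarrow> prob \<Omega>x - prob \<Omega>x) (at_right 0)"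
      using filterlim_compose[OF u Ntop] unfolding PF by (intro tendsto_intros)
    then show "((\<lambda>\<epsilon>. prob (F (N \<epsilon>)) - prob \<Omega>x) \<longlongrightarrow> 0) (at_right 0)" by simp
  qed auto
  define W where "W \<epsilon> = {\<omega> \<in> space M. case hit_time (\<lambda>n \<omega>. S0' \<omega> + S n \<omega>) x \<epsilon> \<omega> of
                enat m \<Rightarrow> \<gamma> * \<epsilon> * Gfun A (real m) \<le> t
              | \<infinity> \<Rightarrow> False}" for \<epsilon>
  \<comment> \<open>By the choice of \<open>N\<close> the event is the complement of
    \<open>K \<epsilon>\<close>. The part of \<open>K \<epsilon>\<close> outside
    \<open>\<Omega>x\<close> is split off, since \<open>Klim\<close> concerns the unconditioned
    probability.\<close>
  have W: "cprob M (W \<epsilon>) \<Omega>x = (prob \<Omega>x - (prob (K \<epsilon>) - prob (K \<epsilon> - \<Omega>x))) / prob \<Omega>x" if \<epsilon>: "\<epsilon> > 0" for \<epsilon>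
  proof -
    have "W \<epsilon> = space M - K \<epsilon>"
    proof -
      have "\<gamma> * \<epsilon> * Gfun A (real m) \<le> t \<longleftrightarrow> m \<le> N \<epsilon>" for m
        using N[OF \<epsilon>, of m] by (simp add: Gfun_of_nat C.G_def)
      then have "W \<epsilon> = {\<omega> \<in> space M. \<exists>m\<in>{1..N \<epsilon>}. \<bar>S0' \<omega> + S m \<omega> - x\<bar> < \<epsilon>}"
        unfolding W_def by (intro Collect_cong conj_cong refl hit_time_event)
      also have "\<dots> = space M - K \<epsilon>"
        by (auto simp: K_def abs_less_iff algebra_simps)
      finally show ?thesis .
    qed
    then have "W \<epsilon> \<inter> \<Omega>x = \<Omega>x - (K \<epsilon> \<inter> \<Omega>x)" by (auto simp: \<Omega>x_def)
    then have "prob (W \<epsilon> \<inter> \<Omega>x) = prob \<Omega>x - prob (K \<epsilon> \<inter> \<Omega>x)"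
      by (simp add: finite_measure_Diff)
    moreover have "prob (K \<epsilon>) = prob (K \<epsilon> \<inter> \<Omega>x) + prob (K \<epsilon> - \<Omega>x)"
      by (subst finite_measure_Union[symmetric]) (auto intro!: arg_cong[where f = prob])
    ultimately show ?thesis by (simp add: cprob_def)
  qed
  have "((\<lambda>\<epsilon>. (prob \<Omega>x - (prob (K \<epsilon>) - prob (K \<epsilon> - \<Omega>x))) / prob \<Omega>x) \<longlongrightarrow>
      (prob \<Omega>x - (prob \<Omega>x / (1 + t) - 0)) / prob \<Omega>x) (at_right 0)"
    using ux by (intro tendsto_intros Klim diff) auto
  moreover have "(prob \<Omega>x - (prob \<Omega>x / (1 + t) - 0)) / prob \<Omega>x = t / (1 + t)"
  proof -
    have "(prob \<Omega>x - (prob \<Omega>x / (1 + t) - 0)) / prob \<Omega>x = 1 - 1 / (1 + t)"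
      using ux by (simp add: diff_divide_distrib)
    also have "\<dots> = t / (1 + t)" using t_pos by (simp add: field_simps)
    finally show ?thesis .
  qed
  moreover have "\<forall>\<^sub>F \<epsilon> in at_right 0. (prob \<Omega>x - (prob (K \<epsilon>) - prob (K \<epsilon> - \<Omega>x))) / prob \<Omega>x = cprob M (W \<epsilon>) \<Omega>x"
    using pos by eventually_elim (simp add: W)
  ultimately have "((\<lambda>\<epsilon>. cprob M (W \<epsilon>) \<Omega>x) \<longlongrightarrow> t / (1 + t)) (at_right 0)"
    using Lim_transform_eventually by (simp only:)
  then show ?thesis
    unfolding Let_def W_def \<gamma>_def \<Omega>x_def \<Omega>s_def .
qed

end
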